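(* Assume that for every $i\in\mathcal N$ the cost function $c_i:\mathbb R\to\mathbb R$ is strictly convex and continuously differentiable, and that the optimal load control problem (OLC) is feasible. Then the automatic load control algorithm (ALC) together with the network dynamics (NET) globally asymptotically converges to a point $(d^*,\omega^*,P^*,\psi^*,\gamma^*,r^*,\sigma^* )$, where $(d^*,\omega^*,P^*,\psi^* )$ is an optimal solution of the reformulated problem (R-OLC). That is, every solution of the closed-loop system (NET)–(ALC), from any initial state with nonnegative $\gamma_i^\pm,\sigma_{ij}^\pm$, converges as $t\to\infty$ to some such point (which may depend on the initial state).
   Context: **Network.** $G(\mathcal N,\mathcal E)$ is a finite connected directed graph of buses and lines, with arbitrary line orientations (if $ij\in\mathcal E$ then $ji\notin\mathcal E$). The buses are divided into generator buses and load buses, $\mathcal N=\mathcal G\cup\mathcal L$ (disjoint). The buses are grouped into control areas (a partition of $\mathcal N$), and $\mathcal E_{in}\subset\mathcal E$ is the set of lines joining two buses of the same control area. Constants: $B_{ij}>0$ ($ij\in\mathcal E$), $D_i>0$ ($i\in\mathcal N$), $M_i>0$ ($i\in\mathcal G$), a fixed power injection $P^{in}=(P_i^{in})_{i\in\mathcal N}$, load limits $\underline d_i,\overline d_i$ and line limits $\underline P_{ij},\overline P_{ij}$. **(OLC)** Minimize $\sum_{i\in\mathcal N}c_i(d_i)$ over $d,\theta\in\mathbb R^{\mathcal N}$ subject to $d_i=P_i^{in}-\sum_{j:ij\in\mathcal E_{in}}B_{ij}(\theta_i-\theta_j)+\sum_{k:ki\in\mathcal E_{in}}B_{ki}(\theta_k-\theta_i)$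 and $\underline d_i\le d_i\le\overline d_i$ for $i\in\mathcal N$; $\underline P_{ij}\le B_{ij}(\theta_i-\theta_j)\le\overline P_{ij}$ for $ij\in\mathcal E_{in}$. **(R-OLC)** Minimize $\sum_{i\in\mathcal N}c_i(d_i)+\sum_{i\in\mathcal N}\frac12D_i\omega_i^2$ over $d,\omega,\psi\in\mathbb R^{\mathcal N}$, $P\in\mathbb R^{\mathcal E}$ subject to $d_i=P_i^{in}-D_i\omega_i-\sum_{j:ij\in\mathcal E}P_{ij}+\sum_{k:ki\in\mathcal E}P_{ki}$, $\ \underline d_i\le d_i\le\overline d_i$, $\ d_i=P_i^{in}-\sum_{j:ij\in\mathcal E_{in}}B_{ij}(\psi_i-\psi_j)+\sum_{k:ki\in\mathcal E_{in}}B_{ki}(\psi_k-\psi_i)$ for $i\in\mathcal N$; $\underline P_{ij}\le B_{ij}(\psi_i-\psi_j)\le\overline P_{ij}$ for $ij\in\mathcal E_{in}$. **(NET)** $M_i\dot\omega_i=-\big(D_i\omega_i+d_i-P_i^{in}+\sum_{j:ij\in\mathcal E}P_{ij}-\sum_{k:ki\in\mathcal E}P_{ki}\big)$ for $i\in\mathcal G$; $0=D_i\omega_i+d_i-P_i^{in}+\sum_{j:ij\in\mathcal E}P_{ij}-\sum_{k:ki\in\mathcal E}P_{ki}$ for $i\in\mathcal L$; $\dot P_{ij}=B_{ij}(\omega_i-\omega_j)$ for $ij\in\mathcal E$. **(ALC)** The notation $[x]^+_y$ means $x$ if $x>0$ or $y>0$, and $0$ otherwise. The quantities $\epsilon_{\bullet}>0$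 (step sizes) and $K_i>0$ are constants, with $\epsilon_{\omega_i}=1/M_i$ for $i\in\mathcal G$. Set $\eta_i=(\epsilon_{\omega_i}+\epsilon_{\mu_i})/\epsilon_{\omega_i}$ for $i\in\mathcal G$, $\eta_i=1$ for $i\in\mathcal L$, and let $\mu_i$ abbreviate $\frac{\epsilon_{\mu_i}}{\epsilon_{\omega_i}}\omega_i+\frac{\epsilon_{\mu_i}}{K_i}r_i$ for $i\in\mathcal G$ and $\frac{\epsilon_{\mu_i}}{K_i}r_i$ for $i\in\mathcal L$. For $i\in\mathcal N$: $\dot d_i=\epsilon_{d_i}\big(-c_i'(d_i)+\eta_i\omega_i+\frac{\epsilon_{\mu_i}}{K_i}r_i-\gamma_i^++\gamma_i^-\big)$; $\dot\psi_i=\epsilon_{\psi_i}\big[\sum_{j:ij\in\mathcal E_{in}}(\mu_i-\mu_j-\sigma_{ij}^++\sigma_{ij}^-)B_{ij}+\sum_{k:ki\in\mathcal E_{in}}(\mu_i-\mu_k+\sigma_{ki}^+-\sigma_{ki}^-)B_{ki}\big]$; $\dot\gamma_i^+=\epsilon_{\gamma_i^+}[d_i-\overline d_i]^+_{\gamma_i^+}$, $\ \dot\gamma_i^-=\epsilon_{\gamma_i^-}[-d_i+\underline d_i]^+_{\gamma_i^-}$; $\dot r_i=K_i\big[D_i\omega_i+\sum_{j:ij\in\mathcal E}P_{ij}-\sum_{k:ki\in\mathcal E}P_{ki}-\sum_{j:ij\in\mathcal E_{in}}B_{ij}(\psi_i-\psi_j)+\sum_{k:ki\in\mathcal E_{in}}B_{ki}(\psi_k-\psi_i)\big]$;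 and for $ij\in\mathcal E_{in}$: $\dot\sigma_{ij}^+=\epsilon_{\sigma_{ij}^+}[B_{ij}(\psi_i-\psi_j)-\overline P_{ij}]^+_{\sigma_{ij}^+}$, $\ \dot\sigma_{ij}^-=\epsilon_{\sigma_{ij}^-}[-B_{ij}(\psi_i-\psi_j)+\underline P_{ij}]^+_{\sigma_{ij}^-}$. The variables $\gamma_i^\pm,\sigma_{ij}^\pm$ are nonnegative multipliers (the projection keeps them nonnegative). Notation: $\gamma=(\gamma_i^+,\gamma_i^-)_{i\in\mathcal N}$, $\sigma=(\sigma_{ij}^+,\sigma_{ij}^-)_{ij\in\mathcal E_{in}}$, $r=(r_i)_{i\in\mathcal N}$. Solutions are understood in the usual Carathéodory sense. *)

theory Defs
  imports "HOL-Analysis.Analysis" "HOL-Library.Disjoint_Sets"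
begin

section \<open>Power network\<close>

text \<open>
  Buses are the elements of a finite type. Quantities attached to lines are total functions on
  ordered pairs of buses; only their values on \<open>lines\<close> (for the quantities indexed by lines inside a
  control area: on \<open>inner_lines\<close>) are ever used. The same applies to the inertias, which matter
  at generator buses only.
\<close>

record 'n power_network =
  lines :: "('n \<times> 'n) set"
  generators :: "'n set"
  load_buses :: "'n set"
  areas :: "'n set set"
  suscept :: "'n \<Rightarrow> 'n \<Rightarrow> real"   \<comment> \<open>\<open>B\<close>\<close>
  damping :: "'n \<Rightarrow> real"         \<comment> \<open>\<open>D\<close>\<close>
  inertia :: "'n \<Rightarrow> real"         \<comment> \<open>\<open>M\<close>\<close>
  injection :: "'n \<Rightarrow> real"       \<comment> \<open>\<open>P\<^sup>i\<^sup>n\<close>\<close>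
  load_min :: "'n \<Rightarrow> real"
  load_max :: "'n \<Rightarrow> real"
  flow_min :: "'n \<Rightarrow> 'n \<Rightarrow> real"
  flow_max :: "'n \<Rightarrow> 'n \<Rightarrow> real"

definition inner_lines :: "'n power_network \<Rightarrow> ('n \<times> 'n) set" where
  "inner_lines N = {(i, j) \<in> lines N. \<exists>A\<in>areas N. i \<in> A \<and> j \<in> A}"

text \<open>Connectedness of the directed graph means that the underlying undirected graph is connected.\<close>

definition valid_network :: "'n::finite power_network \<Rightarrow> bool" where
  "valid_network N \<longleftrightarrow>
     (\<forall>i j. (i, j) \<in> lines N \<longrightarrow> (j, i) \<notin> lines N) \<and>
     (\<forall>i j. (i, j) \<in> (lines N \<union> (lines N)\<inverse>)\<^sup>*) \<and>
     generators N \<union> load_buses N = UNIV \<and> generators N \<inter> load_buses N = {} \<and>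
     partition_on UNIV (areas N) \<and>
     (\<forall>(i, j)\<in>lines N. suscept N i j > 0) \<and>
     (\<forall>i. damping N i > 0) \<and>
     (\<forall>i\<in>generators N. inertia N i > 0)"

text \<open>Total flow leaving bus \<open>i\<close> minus total flow entering it, along the lines in \<open>S\<close>.\<close>

definition net_outflow :: "('n \<times> 'n) set \<Rightarrow> ('n \<Rightarrow> 'n \<Rightarrow> real) \<Rightarrow> 'n::finite \<Rightarrow> real" where
  "net_outflow S F i = (\<Sum>j | (i, j) \<in> S. F i j) - (\<Sum>k | (k, i) \<in> S. F k i)"

definition dc_flow :: "'n power_network \<Rightarrow> ('n \<Rightarrow> real) \<Rightarrow> 'n \<Rightarrow> 'n \<Rightarrow> real" where
  "dc_flow N \<theta> i j = suscept N i j * (\<theta> i - \<theta> j)"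


section \<open>Optimal load control\<close>

definition olc_feasible_point ::
    "'n::finite power_network \<Rightarrow> ('n \<Rightarrow> real) \<times> ('n \<Rightarrow> real) \<Rightarrow> bool" where
  "olc_feasible_point N = (\<lambda>(d, \<theta>).
     (\<forall>i. d i = injection N i - net_outflow (inner_lines N) (dc_flow N \<theta>) i \<and>
          load_min N i \<le> d i \<and> d i \<le> load_max N i) \<and>
     (\<forall>(i, j)\<in>inner_lines N.
        flow_min N i j \<le> dc_flow N \<theta> i j \<and> dc_flow N \<theta> i j \<le> flow_max N i j))"

definition olc_feasible :: "'n::finite power_network \<Rightarrow> bool" where
  "olc_feasible N \<longleftrightarrow> (\<exists>p. olc_feasible_point N p)"

type_synonym 'n rolc_point =
  "('n \<Rightarrow> real) \<times> ('n \<Rightarrow> real) \<times> ('n \<Rightarrow> 'n \<Rightarrow> real) \<times> ('n \<Rightarrow> real)"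

definition rolc_feasible_point :: "'n::finite power_network \<Rightarrow> 'n rolc_point \<Rightarrow> bool" where
  "rolc_feasible_point N = (\<lambda>(d, \<omega>, P, \<psi>).
     (\<forall>i. d i = injection N i - damping N i * \<omega> i - net_outflow (lines N) P i \<and>
          load_min N i \<le> d i \<and> d i \<le> load_max N i \<and>
          d i = injection N i - net_outflow (inner_lines N) (dc_flow N \<psi>) i) \<and>
     (\<forall>(i, j)\<in>inner_lines N.
        flow_min N i j \<le> dc_flow N \<psi> i j \<and> dc_flow N \<psi> i j \<le> flow_max N i j))"

definition rolc_cost ::
    "'n::finite power_network \<Rightarrow> ('n \<Rightarrow> real \<Rightarrow> real) \<Rightarrow> 'n rolc_point \<Rightarrow> real" where
  "rolc_cost N c = (\<lambda>(d, \<omega>, P, \<psi>).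
     (\<Sum>i\<in>UNIV. c i (d i)) + (\<Sum>i\<in>UNIV. 1 / 2 * damping N i * (\<omega> i)\<^sup>2))"

definition rolc_optimal ::
    "'n::finite power_network \<Rightarrow> ('n \<Rightarrow> real \<Rightarrow> real) \<Rightarrow> 'n rolc_point \<Rightarrow> bool" where
  "rolc_optimal N c p \<longleftrightarrow> is_arg_min (rolc_cost N c) (rolc_feasible_point N) p"


section \<open>Caratheodory solutions\<close>

text \<open>Absolute continuity of a real function on a compact interval (the \<open>\<epsilon>\<close>-\<open>\<delta>\<close> notion; the library
  only has absolute continuity of measures).\<close>

definition absolutely_continuous_on :: "real \<Rightarrow> real \<Rightarrow> (real \<Rightarrow> real) \<Rightarrow> bool" where
  "absolutely_continuous_on a b f \<longleftrightarrow>
     (\<forall>\<epsilon>>0. \<exists>\<delta>>0. \<forall>I.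
        finite I \<and> (\<forall>(u, v)\<in>I. a \<le> u \<and> u \<le> v \<and> v \<le> b) \<and>
        disjoint_family_on (\<lambda>(u, v). {u<..<v}) I \<and>
        (\<Sum>(u, v)\<in>I. v - u) < \<delta>
        \<longrightarrow> (\<Sum>(u, v)\<in>I. \<bar>f v - f u\<bar>) < \<epsilon>)"

text \<open>\<open>y\<close> satisfies \<open>y' = g\<close> on \<open>[0, \<infinity>)\<close>, where \<open>g t\<close> is the right-hand side evaluated along the
  trajectory at time \<open>t\<close>. Values at negative times are irrelevant.\<close>

definition caratheodory_ode :: "(real \<Rightarrow> real) \<Rightarrow> (real \<Rightarrow> real) \<Rightarrow> bool" where
  "caratheodory_ode y g \<longleftrightarrow>
     (\<forall>T\<ge>0. absolutely_continuous_on 0 T y) \<and>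
     (AE t in lebesgue. t > 0 \<longrightarrow> (y has_real_derivative g t) (at t))"


section \<open>Closed-loop system\<close>

record 'n alc_gains =
  eps_d :: "'n \<Rightarrow> real"
  eps_psi :: "'n \<Rightarrow> real"
  eps_gamma_hi :: "'n \<Rightarrow> real"
  eps_gamma_lo :: "'n \<Rightarrow> real"
  eps_sigma_hi :: "'n \<Rightarrow> 'n \<Rightarrow> real"
  eps_sigma_lo :: "'n \<Rightarrow> 'n \<Rightarrow> real"
  eps_omega :: "'n \<Rightarrow> real"
  eps_mu :: "'n \<Rightarrow> real"
  gain_K :: "'n \<Rightarrow> real"

definition valid_gains :: "'n power_network \<Rightarrow> 'n alc_gains \<Rightarrow> bool" where
  "valid_gains N e \<longleftrightarrow>
     (\<forall>i. eps_d e i > 0 \<and> eps_psi e i > 0 \<and> eps_gamma_hi e i > 0 \<and> eps_gamma_lo e i > 0 \<and>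
          eps_mu e i > 0 \<and> gain_K e i > 0) \<and>
     (\<forall>(i, j)\<in>inner_lines N. eps_sigma_hi e i j > 0 \<and> eps_sigma_lo e i j > 0) \<and>
     (\<forall>i\<in>generators N. eps_omega e i = 1 / inertia N i)"

text \<open>The suffixes \<open>hi\<close> and \<open>lo\<close> stand for the superscripts \<open>+\<close> and \<open>-\<close> (upper and lower limits).\<close>

record 'n alc_state =
  st_d :: "'n \<Rightarrow> real"
  st_omega :: "'n \<Rightarrow> real"
  st_P :: "'n \<Rightarrow> 'n \<Rightarrow> real"
  st_psi :: "'n \<Rightarrow> real"
  st_gamma_hi :: "'n \<Rightarrow> real"
  st_gamma_lo :: "'n \<Rightarrow> real"
  st_r :: "'n \<Rightarrow> real"
  st_sigma_hi :: "'n \<Rightarrow> 'n \<Rightarrow> real"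
  st_sigma_lo :: "'n \<Rightarrow> 'n \<Rightarrow> real"

text \<open>\<open>pos_proj x y\<close> is \<open>[x]\<^sup>+\<close> with subscript \<open>y\<close>.\<close>

definition pos_proj :: "real \<Rightarrow> real \<Rightarrow> real" where
  "pos_proj x y = (if x > 0 \<or> y > 0 then x else 0)"

definition alc_eta :: "'n power_network \<Rightarrow> 'n alc_gains \<Rightarrow> 'n \<Rightarrow> real" where
  "alc_eta N e i =
     (if i \<in> generators N then (eps_omega e i + eps_mu e i) / eps_omega e i else 1)"

definition alc_mu :: "'n power_network \<Rightarrow> 'n alc_gains \<Rightarrow> 'n alc_state \<Rightarrow> 'n \<Rightarrow> real" where
  "alc_mu N e s i =
     (if i \<in> generators N
      then eps_mu e i / eps_omega e i * st_omega s i + eps_mu e i / gain_K e i * st_r s i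
      else eps_mu e i / gain_K e i * st_r s i)"

definition power_imbalance :: "'n::finite power_network \<Rightarrow> 'n alc_state \<Rightarrow> 'n \<Rightarrow> real" where
  "power_imbalance N s i =
     damping N i * st_omega s i + st_d s i - injection N i + net_outflow (lines N) (st_P s) i"

text \<open>The swing equation at a generator bus is divided by its inertia. At load buses the algebraic
  balance equation holds at all times \<open>t \<ge> 0\<close>.\<close>

definition net_solution :: "'n::finite power_network \<Rightarrow> (real \<Rightarrow> 'n alc_state) \<Rightarrow> bool" where
  "net_solution N x \<longleftrightarrow>
     (\<forall>i\<in>generators N. caratheodory_ode (\<lambda>t. st_omega (x t) i)
        (\<lambda>t. - power_imbalance N (x t) i / inertia N i)) \<and>
     (\<forall>i\<in>load_buses N. \<forall>t\<ge>0. 0 = power_imbalance N (x t) i) \<and>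
     (\<forall>(i, j)\<in>lines N. caratheodory_ode (\<lambda>t. st_P (x t) i j)
        (\<lambda>t. suscept N i j * (st_omega (x t) i - st_omega (x t) j)))"

definition rhs_d ::
    "'n power_network \<Rightarrow> 'n alc_gains \<Rightarrow> ('n \<Rightarrow> real \<Rightarrow> real) \<Rightarrow> 'n alc_state \<Rightarrow> 'n \<Rightarrow> real" where
  "rhs_d N e c s i = eps_d e i *
     (- deriv (c i) (st_d s i) + alc_eta N e i * st_omega s i
      + eps_mu e i / gain_K e i * st_r s i - st_gamma_hi s i + st_gamma_lo s i)"

definition rhs_psi ::
    "'n::finite power_network \<Rightarrow> 'n alc_gains \<Rightarrow> 'n alc_state \<Rightarrow> 'n \<Rightarrow> real" where
  "rhs_psi N e s i = eps_psi e i *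
     ((\<Sum>j | (i, j) \<in> inner_lines N.
         (alc_mu N e s i - alc_mu N e s j - st_sigma_hi s i j + st_sigma_lo s i j) * suscept N i j)
    + (\<Sum>k | (k, i) \<in> inner_lines N.
         (alc_mu N e s i - alc_mu N e s k + st_sigma_hi s k i - st_sigma_lo s k i) * suscept N k i))"

definition rhs_r :: "'n::finite power_network \<Rightarrow> 'n alc_gains \<Rightarrow> 'n alc_state \<Rightarrow> 'n \<Rightarrow> real" where
  "rhs_r N e s i = gain_K e i *
     (damping N i * st_omega s i + net_outflow (lines N) (st_P s) i
      - net_outflow (inner_lines N) (dc_flow N (st_psi s)) i)"

definition alc_solution ::
    "'n::finite power_network \<Rightarrow> 'n alc_gains \<Rightarrow> ('n \<Rightarrow> real \<Rightarrow> real) \<Rightarrow> (real \<Rightarrow> 'n alc_state) \<Rightarrow> bool"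
where
  "alc_solution N e c x \<longleftrightarrow>
     (\<forall>i. caratheodory_ode (\<lambda>t. st_d (x t) i) (\<lambda>t. rhs_d N e c (x t) i) \<and>
          caratheodory_ode (\<lambda>t. st_psi (x t) i) (\<lambda>t. rhs_psi N e (x t) i) \<and>
          caratheodory_ode (\<lambda>t. st_gamma_hi (x t) i)
            (\<lambda>t. eps_gamma_hi e i *
                 pos_proj (st_d (x t) i - load_max N i) (st_gamma_hi (x t) i)) \<and>
          caratheodory_ode (\<lambda>t. st_gamma_lo (x t) i)
            (\<lambda>t. eps_gamma_lo e i *
                 pos_proj (- st_d (x t) i + load_min N i) (st_gamma_lo (x t) i)) \<and>
          caratheodory_ode (\<lambda>t. st_r (x t) i) (\<lambda>t. rhs_r N e (x t) i)) \<and>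
     (\<forall>(i, j)\<in>inner_lines N.
          caratheodory_ode (\<lambda>t. st_sigma_hi (x t) i j)
            (\<lambda>t. eps_sigma_hi e i j *
                 pos_proj (dc_flow N (st_psi (x t)) i j - flow_max N i j) (st_sigma_hi (x t) i j)) \<and>
          caratheodory_ode (\<lambda>t. st_sigma_lo (x t) i j)
            (\<lambda>t. eps_sigma_lo e i j *
                 pos_proj (- dc_flow N (st_psi (x t)) i j + flow_min N i j)
                   (st_sigma_lo (x t) i j)))"

definition multipliers_nonneg :: "'n power_network \<Rightarrow> 'n alc_state \<Rightarrow> bool" where
  "multipliers_nonneg N s \<longleftrightarrow>
     (\<forall>i. st_gamma_hi s i \<ge> 0 \<and> st_gamma_lo s i \<ge> 0) \<and>
     (\<forall>(i, j)\<in>inner_lines N. st_sigma_hi s i j \<ge> 0 \<and> st_sigma_lo s i j \<ge> 0)"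

text \<open>Convergence in the (finite-dimensional) state space, i.e. in each coordinate.\<close>

definition state_converges ::
    "'n power_network \<Rightarrow> (real \<Rightarrow> 'n alc_state) \<Rightarrow> 'n alc_state \<Rightarrow> bool" where
  "state_converges N x s \<longleftrightarrow>
     (\<forall>i. ((\<lambda>t. st_d (x t) i) \<longlongrightarrow> st_d s i) at_top \<and>
          ((\<lambda>t. st_omega (x t) i) \<longlongrightarrow> st_omega s i) at_top \<and>
          ((\<lambda>t. st_psi (x t) i) \<longlongrightarrow> st_psi s i) at_top \<and>
          ((\<lambda>t. st_gamma_hi (x t) i) \<longlongrightarrow> st_gamma_hi s i) at_top \<and>
          ((\<lambda>t. st_gamma_lo (x t) i) \<longlongrightarrow> st_gamma_lo s i) at_top \<and>
          ((\<lambda>t. st_r (x t) i) \<longlongrightarrow> st_r s i) at_top) \<and>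
     (\<forall>(i, j)\<in>lines N. ((\<lambda>t. st_P (x t) i j) \<longlongrightarrow> st_P s i j) at_top) \<and>
     (\<forall>(i, j)\<in>inner_lines N.
          ((\<lambda>t. st_sigma_hi (x t) i j) \<longlongrightarrow> st_sigma_hi s i j) at_top \<and>
          ((\<lambda>t. st_sigma_lo (x t) i j) \<longlongrightarrow> st_sigma_lo s i j) at_top)"


section \<open>Cost functions\<close>

definition strictly_convex_on :: "real set \<Rightarrow> (real \<Rightarrow> real) \<Rightarrow> bool" where
  "strictly_convex_on S f \<longleftrightarrow> convex S \<and>
     (\<forall>x\<in>S. \<forall>y\<in>S. \<forall>u>0. \<forall>v>0. x \<noteq> y \<and> u + v = 1 \<longrightarrow>
        f (u * x + v * y) < u * f x + v * f y)"

end

theory Submission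
  imports Defs
begin

text \<open>
The closed loop is a primal-dual gradient flow. Let \<open>\<mu>\<close> replace \<open>r\<close> as a coordinate. Then \<open>\<mu>\<close> is the
multiplier of the balance constraint that involves the virtual phase angles \<open>\<psi>\<close>, and the frequency
\<open>\<omega>\<close> is the multiplier of the physical balance; the term \<open>1/2 * D * \<omega>\<^sup>2\<close> of the reformulated problem
makes these two roles of \<open>\<omega>\<close> agree. The variables \<open>d\<close>, \<open>P\<close>, \<open>\<psi>\<close> descend and \<open>\<omega>\<close>, \<open>\<mu>\<close>, \<open>\<gamma>\<close>, \<open>\<sigma>\<close>
ascend the Lagrangian, at load buses with \<open>\<omega>\<close> maximized instantaneously. A point that satisfies the
Karush-Kuhn-Tucker conditions (\<open>kkt_point\<close>) is optimal (\<open>kkt_point_imp_rolc_optimal\<close>), and one exists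
because the problem is feasible with affine constraints (\<open>kkt_point_exists\<close>, by Farkas' lemma).

Fix such a point \<open>z\<close>. The squared distance to \<open>z\<close>, weighted by the inverse step sizes (\<open>energy\<close>), is
nonincreasing: all bilinear terms of its derivative cancel, and what remains (\<open>half_energy_rate_le\<close>)
is minus a sum of nonnegative terms in \<open>d\<close>, in \<open>\<omega>\<close> and in the products of multipliers with the
slacks of the optimum. So trajectories are bounded, and these terms tend to zero, hence \<open>d\<close> tends to
the optimal load and \<open>\<omega>\<close> to \<open>0\<close> (\<open>dissipation_limits\<close>).

The cost is not strictly convex in \<open>P\<close> and \<open>\<psi>\<close>, so the other coordinates take more work. The usual
tool would be LaSalle's invariance principle; but the projections make the vector field
discontinuous, so invariance of limit sets is not at hand, and the argument stays in the time domain.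
Call a signal slowly varying if its increments over windows of fixed length die out. A signal of
this kind whose derivative is uniformly continuous has a derivative that tends to zero (\<open>barbalat\<close>),
and so does a bounded signal whose derivative is slowly varying
(\<open>slowly_varying_derivative_of_bounded\<close>). These two facts alternate. Since \<open>d\<close> converges, each
\<open>\<gamma>\<close> decays or freezes, thus is slowly varying; since \<open>d'\<close> tends to zero, \<open>\<mu>\<close> is a combination of
slowly varying signals; since \<open>\<mu>'\<close> tends to zero, the flows of \<open>\<psi>\<close> tend to the optimal ones
(\<open>dc_flow_tendsto\<close>); hence \<open>\<sigma>\<close> is slowly varying, so \<open>\<psi>'\<close> is, and it tends to zero because \<open>\<psi>\<close>
is bounded. Every stationarity condition thus holds asymptotically, and every limit point of the
trajectory is again a Karush-Kuhn-Tucker point (\<open>limit_point_is_kkt_point\<close>). The energy with respect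
to such a limit point is nonincreasing and tends to zero along a sequence of times, so it tends to
zero, which is convergence (\<open>converges_to_kkt_point\<close>).

Solutions are only absolutely continuous, with derivatives almost everywhere. All the calculus that
is used derives from one monotonicity statement, \<open>absolutely_continuous_on_increment_le\<close>.
\<close>

section \<open>Absolutely continuous functions\<close>

lemma absolutely_continuous_on_subinterval:
  assumes "absolutely_continuous_on a b f" "a \<le> a'" "b' \<le> b"
  shows "absolutely_continuous_on a' b' f"
  unfolding absolutely_continuous_on_def
proof (intro allI impI)
  fix \<epsilon> :: real assume "\<epsilon> > 0"
  then obtain \<delta> where "\<delta> > 0" and \<delta>: "\<forall>I. finite I \<and> (\<forall>(u, v)\<in>I. a \<le> u \<and> u \<le> v \<and> v \<le> b) \<and>
        disjoint_family_on (\<lambda>(u, v). {u<..<v}) I \<and> (\<Sum>(u, v)\<in>I. v - u) < \<delta>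
        \<longrightarrow> (\<Sum>(u, v)\<in>I. \<bar>f v - f u\<bar>) < \<epsilon>"
    using assms(1) unfolding absolutely_continuous_on_def by blast
  show "\<exists>\<delta>>0. \<forall>I. finite I \<and> (\<forall>(u, v)\<in>I. a' \<le> u \<and> u \<le> v \<and> v \<le> b') \<and>
        disjoint_family_on (\<lambda>(u, v). {u<..<v}) I \<and> (\<Sum>(u, v)\<in>I. v - u) < \<delta>
        \<longrightarrow> (\<Sum>(u, v)\<in>I. \<bar>f v - f u\<bar>) < \<epsilon>"
  proof (intro exI[of _ \<delta>] conjI allI impI)
    fix I assume I: "finite I \<and> (\<forall>(u, v)\<in>I. a' \<le> u \<and> u \<le> v \<and> v \<le> b') \<and>
        disjoint_family_on (\<lambda>(u, v). {u<..<v}) I \<and> (\<Sum>(u, v)\<in>I. v - u) < \<delta>"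
    then have "\<forall>(u, v)\<in>I. a \<le> u \<and> u \<le> v \<and> v \<le> b" using assms(2,3) by fastforce
    then show "(\<Sum>(u, v)\<in>I. \<bar>f v - f u\<bar>) < \<epsilon>" using I \<delta> by blast
  qed (use \<open>\<delta> > 0\<close> in simp)
qed

text \<open>
  Sums, scalar multiples and, on compact intervals, products of absolutely continuous functions all
  satisfy such a bound.
\<close>

lemma absolutely_continuous_on_dominated:
  assumes f: "absolutely_continuous_on a b f" and g: "absolutely_continuous_on a b g"
    and C: "C > 0"
    and dom: "\<And>u v. a \<le> u \<Longrightarrow> u \<le> v \<Longrightarrow> v \<le> b \<Longrightarrow>
              \<bar>h v - h u\<bar> \<le> C * (\<bar>f v - f u\<bar> + \<bar>g v - g u\<bar>)"
  shows "absolutely_continuous_on a b h"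
  unfolding absolutely_continuous_on_def
proof (intro allI impI)
  fix \<epsilon> :: real assume "\<epsilon> > 0"
  then have e: "\<epsilon> / (2 * C) > 0" using C by simp
  obtain \<delta>1 where "\<delta>1 > 0" and 1: "\<forall>I. finite I \<and> (\<forall>(u, v)\<in>I. a \<le> u \<and> u \<le> v \<and> v \<le> b) \<and>
        disjoint_family_on (\<lambda>(u, v). {u<..<v}) I \<and> (\<Sum>(u, v)\<in>I. v - u) < \<delta>1
        \<longrightarrow> (\<Sum>(u, v)\<in>I. \<bar>f v - f u\<bar>) < \<epsilon> / (2 * C)"
    using f e unfolding absolutely_continuous_on_def by blast
  obtain \<delta>2 where "\<delta>2 > 0" and 2: "\<forall>I. finite I \<and> (\<forall>(u, v)\<in>I. a \<le> u \<and> u \<le> v \<and> v \<le> b) \<and>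
        disjoint_family_on (\<lambda>(u, v). {u<..<v}) I \<and> (\<Sum>(u, v)\<in>I. v - u) < \<delta>2
        \<longrightarrow> (\<Sum>(u, v)\<in>I. \<bar>g v - g u\<bar>) < \<epsilon> / (2 * C)"
    using g e unfolding absolutely_continuous_on_def by blast
  show "\<exists>\<delta>>0. \<forall>I. finite I \<and> (\<forall>(u, v)\<in>I. a \<le> u \<and> u \<le> v \<and> v \<le> b) \<and>
        disjoint_family_on (\<lambda>(u, v). {u<..<v}) I \<and> (\<Sum>(u, v)\<in>I. v - u) < \<delta>
        \<longrightarrow> (\<Sum>(u, v)\<in>I. \<bar>h v - h u\<bar>) < \<epsilon>"
  proof (intro exI[of _ "min \<delta>1 \<delta>2"] conjI allI impI)
    fix I assume I: "finite I \<and> (\<forall>(u, v)\<in>I. a \<le> u \<and> u \<le> v \<and> v \<le> b) \<and>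
        disjoint_family_on (\<lambda>(u, v). {u<..<v}) I \<and> (\<Sum>(u, v)\<in>I. v - u) < min \<delta>1 \<delta>2"
    have "(\<Sum>(u, v)\<in>I. \<bar>h v - h u\<bar>) \<le> (\<Sum>(u, v)\<in>I. C * (\<bar>f v - f u\<bar> + \<bar>g v - g u\<bar>))"
      using I dom by (intro sum_mono) fastforce
    also have "\<dots> = C * ((\<Sum>(u, v)\<in>I. \<bar>f v - f u\<bar>) + (\<Sum>(u, v)\<in>I. \<bar>g v - g u\<bar>))"
      by (simp add: sum_distrib_left sum.distrib[symmetric] case_prod_unfold)
    also have "\<dots> < C * (\<epsilon> / (2 * C) + \<epsilon> / (2 * C))"
      using I 1 2 C by (intro mult_strict_left_mono add_strict_mono) auto
    also have "\<dots> = \<epsilon>" using C by simp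
    finally show "(\<Sum>(u, v)\<in>I. \<bar>h v - h u\<bar>) < \<epsilon>" .
  qed (use \<open>\<delta>1 > 0\<close> \<open>\<delta>2 > 0\<close> in simp)
qed

lemma absolutely_continuous_on_affine: "absolutely_continuous_on a b (\<lambda>t. k + m * t)"
  unfolding absolutely_continuous_on_def
proof (intro allI impI)
  fix \<epsilon> :: real assume e: "\<epsilon> > 0"
  have m: "\<bar>m\<bar> + 1 > 0" by linarith
  show "\<exists>\<delta>>0. \<forall>I. finite I \<and> (\<forall>(u, v)\<in>I. a \<le> u \<and> u \<le> v \<and> v \<le> b) \<and>
        disjoint_family_on (\<lambda>(u, v). {u<..<v}) I \<and> (\<Sum>(u, v)\<in>I. v - u) < \<delta>
        \<longrightarrow> (\<Sum>(u, v)\<in>I. \<bar>k + m * v - (k + m * u)\<bar>) < \<epsilon>"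
  proof (intro exI[of _ "\<epsilon> / (\<bar>m\<bar> + 1)"] conjI allI impI)
    fix I assume I: "finite I \<and> (\<forall>(u, v)\<in>I. a \<le> u \<and> u \<le> v \<and> v \<le> b) \<and>
        disjoint_family_on (\<lambda>(u, v). {u<..<v}) I \<and> (\<Sum>(u, v)\<in>I. v - u) < \<epsilon> / (\<bar>m\<bar> + 1)"
    have "(\<Sum>(u, v)\<in>I. \<bar>k + m * v - (k + m * u)\<bar>) \<le> (\<Sum>(u, v)\<in>I. (\<bar>m\<bar> + 1) * (v - u))"
    proof (intro sum_mono, clarify)
      fix u v assume "(u, v) \<in> I"
      then have "u \<le> v" using I by auto
      have "\<bar>k + m * v - (k + m * u)\<bar> = \<bar>m\<bar> * (v - u)"
        using \<open>u \<le> v\<close> by (simp add: abs_mult[symmetric] right_diff_distrib[symmetric])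
          (simp add: abs_mult)
      then show "\<bar>k + m * v - (k + m * u)\<bar> \<le> (\<bar>m\<bar> + 1) * (v - u)"
        using \<open>u \<le> v\<close> by (simp add: algebra_simps)
    qed
    also have "\<dots> = (\<bar>m\<bar> + 1) * (\<Sum>(u, v)\<in>I. v - u)"
      by (simp add: sum_distrib_left case_prod_unfold)
    also have "\<dots> < (\<bar>m\<bar> + 1) * (\<epsilon> / (\<bar>m\<bar> + 1))"
      using I m by (intro mult_strict_left_mono) auto
    also have "\<dots> = \<epsilon>" using m by simp
    finally show "(\<Sum>(u, v)\<in>I. \<bar>k + m * v - (k + m * u)\<bar>) < \<epsilon>" .
  qed (use e m in simp)
qed

lemma absolutely_continuous_on_imp_continuous_on:
  assumes "absolutely_continuous_on a b f"
  shows "continuous_on {a..b} f"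
proof (rule uniformly_continuous_imp_continuous, unfold uniformly_continuous_on_def, intro allI impI)
  fix \<epsilon> :: real assume "\<epsilon> > 0"
  then obtain \<delta> where "\<delta> > 0" and \<delta>: "\<forall>I. finite I \<and> (\<forall>(u, v)\<in>I. a \<le> u \<and> u \<le> v \<and> v \<le> b) \<and>
        disjoint_family_on (\<lambda>(u, v). {u<..<v}) I \<and> (\<Sum>(u, v)\<in>I. v - u) < \<delta>
        \<longrightarrow> (\<Sum>(u, v)\<in>I. \<bar>f v - f u\<bar>) < \<epsilon>"
    using assms unfolding absolutely_continuous_on_def by blast
  have *: "\<bar>f v - f u\<bar> < \<epsilon>" if "a \<le> u" "u \<le> v" "v \<le> b" "v - u < \<delta>" for u v
    using \<delta>[rule_format, of "{(u, v)}"] that by (auto simp: disjoint_family_on_def)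
  show "\<exists>d>0. \<forall>x\<in>{a..b}. \<forall>x'\<in>{a..b}. dist x' x < d \<longrightarrow> dist (f x') (f x) < \<epsilon>"
  proof (intro exI[of _ \<delta>] conjI ballI impI)
    fix u v assume uv: "u \<in> {a..b}" "v \<in> {a..b}" "dist v u < \<delta>"
    show "dist (f v) (f u) < \<epsilon>"
    proof (cases "u \<le> v")
      case True then show ?thesis using *[of u v] uv by (simp add: dist_real_def)
    next
      case False then show ?thesis using *[of v u] uv by (simp add: dist_real_def)
    qed
  qed fact
qed

text \<open>
  Choose an open set around the exceptional null set whose measure is below the \<open>\<delta>\<close> of absolute
  continuity, and a gauge that stays in it at exceptional points and that makes \<open>f v - f u \<le> \<epsilon> * (v - u)\<close>
  hold around the other points. In a tagged division fine for this gauge, the intervals with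
  exceptional tags contribute less than \<open>\<epsilon>\<close> in total, and the others at most \<open>\<epsilon> * (b - a)\<close>.
\<close>

lemma absolutely_continuous_on_increment_le:
  fixes f :: "real \<Rightarrow> real"
  assumes ac: "absolutely_continuous_on a b f" and "a \<le> b" and E: "negligible E"
    and der: "\<And>t. t \<in> {a..b} - E \<Longrightarrow> \<exists>g\<le>0. (f has_real_derivative g) (at t)"
  shows "f b \<le> f a"
proof (rule field_le_epsilon)
  fix \<eta> :: real assume "\<eta> > 0"
  \<comment> \<open>ordinary tags cost \<open>\<epsilon> * (b - a)\<close> and exceptional tags \<open>\<epsilon>\<close>\<close>
  define \<epsilon> where "\<epsilon> = \<eta> / (b - a + 1)"
  have e: "\<epsilon> > 0" using \<open>\<eta> > 0\<close> \<open>a \<le> b\<close> by (simp add: \<epsilon>_def)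
  obtain \<delta> where "\<delta> > 0" and \<delta>: "\<And>I. finite I \<Longrightarrow> \<forall>(u, v)\<in>I. a \<le> u \<and> u \<le> v \<and> v \<le> b \<Longrightarrow>
        disjoint_family_on (\<lambda>(u, v). {u<..<v}) I \<Longrightarrow> (\<Sum>(u, v)\<in>I. v - u) < \<delta>
        \<Longrightarrow> (\<Sum>(u, v)\<in>I. \<bar>f v - f u\<bar>) < \<epsilon>"
    using ac e unfolding absolutely_continuous_on_def by meson
  have Es: "E \<in> sets lebesgue" and E0: "emeasure lebesgue E = 0"
    using E by (auto simp: negligible_iff_null_sets)
  obtain U where U: "open U" "E \<subseteq> U" "U - E \<in> lmeasurable" "emeasure lebesgue (U - E) < ennreal \<delta>"
    using sets_lebesgue_outer_open[OF Es \<open>\<delta> > 0\<close>] by metis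
  have Us: "U \<in> sets lebesgue" using U(1) by (simp add: borel_open)
  have "emeasure lebesgue U \<le> emeasure lebesgue (U - E) + emeasure lebesgue E"
    by (metis Es Us Un_Diff_cancel2 U(2) emeasure_subadditive sets.Diff subset_Un_eq sup.absorb1)
  then have Um: "emeasure lebesgue U < ennreal \<delta>" using U(4) E0 by simp
  have "\<exists>r>0. if t \<in> E then ball t r \<subseteq> U else (t \<in> {a..b} \<longrightarrow>
         (\<forall>u\<in>ball t r. \<forall>v\<in>ball t r. u \<le> t \<and> t \<le> v \<longrightarrow> f v - f u \<le> \<epsilon> * (v - u)))" for t
  proof (cases "t \<in> E \<or> t \<notin> {a..b}")
    case True
    then show ?thesis
    proof (cases "t \<in> E")
      case True then show ?thesis using U(1,2) by (auto simp: open_contains_ball)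
    next
      case False then show ?thesis using \<open>t \<in> E \<or> t \<notin> {a..b}\<close> by (auto intro: exI[of _ 1])
    qed
  next
    case False
    then obtain g where g: "g \<le> 0" "(f has_real_derivative g) (at t)" using der by auto
    then obtain r where r: "r > 0" "\<And>y. norm (y - t) < r \<Longrightarrow> norm (f y - f t - (y - t) * g) \<le> \<epsilon> * norm (y - t)"
      using e unfolding has_field_derivative_def has_derivative_at_alt
      by (auto simp: mult.commute)
    have "f v - f u \<le> \<epsilon> * (v - u)" if "u \<in> ball t r" "v \<in> ball t r" "u \<le> t" "t \<le> v" for u v
    proof -
      have "\<bar>f u - f t - (u - t) * g\<bar> \<le> \<epsilon> * \<bar>u - t\<bar>" "\<bar>f v - f t - (v - t) * g\<bar> \<le> \<epsilon> * \<bar>v - t\<bar>"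
        using r(2)[of u] r(2)[of v] that by (auto simp: dist_real_def abs_minus_commute)
      moreover have "(u - t) * g \<ge> 0" "(v - t) * g \<le> 0"
        using that g(1) by (auto simp: mult_nonpos_nonpos mult_nonneg_nonpos)
      ultimately show ?thesis using that by (simp add: algebra_simps)
    qed
    then show ?thesis using r(1) False by auto
  qed
  then obtain r where rpos: "\<And>t. r t > 0"
    and rE: "\<And>t. t \<in> E \<Longrightarrow> ball t (r t) \<subseteq> U"
    and rN: "\<And>t u v. t \<notin> E \<Longrightarrow> t \<in> {a..b} \<Longrightarrow> u \<in> ball t (r t) \<Longrightarrow> v \<in> ball t (r t) \<Longrightarrow> u \<le> t \<Longrightarrow> t \<le> v
            \<Longrightarrow> f v - f u \<le> \<epsilon> * (v - u)"
    by metis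
  have "gauge (\<lambda>t. ball t (r t))" using rpos by (simp add: gauge_ball_dependent)
  then obtain p where p: "p tagged_division_of {a..b}" and fine: "(\<lambda>t. ball t (r t)) fine p"
    using fine_division_exists_real by metis
  note pD = tagged_division_ofD[OF p]
  have K: "\<exists>u v. K = {u..v} \<and> u \<le> t \<and> t \<le> v \<and> Inf K = u \<and> Sup K = v \<and> a \<le> u \<and> v \<le> b
      \<and> u \<in> ball t (r t) \<and> v \<in> ball t (r t)"
    if tK: "(t, K) \<in> p" for t K
  proof -
    obtain u v where uv: "K = {u..v}" using pD(4)[OF tK] by auto
    have "t \<in> K" "K \<subseteq> {a..b}" "K \<subseteq> ball t (r t)" using pD(2)[OF tK] pD(3)[OF tK] fineD[OF fine tK] by auto
    then show ?thesis using uv by (intro exI[of _ u] exI[of _ v]) (auto simp: subset_iff)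
  qed
  \<comment> \<open>Degenerate intervals are left out, so that an interval determines its tag.\<close>
  define q where "q = {(t, K) \<in> p. t \<in> E \<and> Inf K < Sup K}"
  define I where "I = (\<lambda>(t, K). (Inf K, Sup K)) ` q"
  have qp: "q \<subseteq> p" by (auto simp: q_def)
  have fq: "finite q" using pD(1) qp finite_subset by blast
  have disj: "{Inf K1<..<Sup K1} \<inter> {Inf K2<..<Sup K2} = {}"
    if "(t1, K1) \<in> q" "(t2, K2) \<in> q" "(t1, K1) \<noteq> (t2, K2)" for t1 K1 t2 K2
  proof -
    have "interior K1 \<inter> interior K2 = {}" using pD(5) that qp by blast
    moreover have "interior K1 = {Inf K1<..<Sup K1}" "interior K2 = {Inf K2<..<Sup K2}"
      using K that qp by (metis interior_atLeastAtMost_real subsetD)+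
    ultimately show ?thesis by simp
  qed
  have inj: "inj_on (\<lambda>(t, K). (Inf K, Sup K)) q"
  proof (rule inj_onI, clarify)
    fix t1 K1 t2 K2 assume A: "(t1, K1) \<in> q" "(t2, K2) \<in> q" "Inf K1 = Inf K2" "Sup K1 = Sup K2"
    show "t1 = t2 \<and> K1 = K2"
    proof (rule ccontr)
      assume "\<not> (t1 = t2 \<and> K1 = K2)"
      then have "{Inf K1<..<Sup K1} = {}" using disj[OF A(1,2)] A(3,4) by auto
      then show False using A(1) by (auto simp: q_def)
    qed
  qed
  have dI: "disjoint_family_on (\<lambda>(u, v). {u<..<v}) I"
    unfolding disjoint_family_on_def I_def using disj by fastforce
  have "(\<Sum>(u, v)\<in>I. \<bar>f v - f u\<bar>) < \<epsilon>"
  proof (rule \<delta>)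
    show "finite I" using fq by (simp add: I_def)
    have bI: "a \<le> u \<and> u \<le> v \<and> v \<le> b" if "(u, v) \<in> I" for u v
      using that K qp unfolding I_def by fastforce
    then show "\<forall>(u, v)\<in>I. a \<le> u \<and> u \<le> v \<and> v \<le> b" by blast
    show "disjoint_family_on (\<lambda>(u, v). {u<..<v}) I" by (rule dI)
    have "ennreal (\<Sum>(u, v)\<in>I. v - u) = (\<Sum>(u, v)\<in>I. ennreal (v - u))"
      by (subst sum_ennreal[symmetric]) (use bI in \<open>auto simp: case_prod_unfold\<close>)
    also have "\<dots> = (\<Sum>w\<in>I. emeasure lebesgue (case w of (u, v) \<Rightarrow> {u<..<v}))"
      using bI by (intro sum.cong) auto
    also have "\<dots> = emeasure lebesgue (\<Union>w\<in>I. case w of (u, v) \<Rightarrow> {u<..<v})"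
      by (rule sum_emeasure) (use dI \<open>finite I\<close> in auto)
    also have "\<dots> \<le> emeasure lebesgue U"
    proof (rule emeasure_mono[OF _ Us], clarsimp)
      fix u v z assume "(u, v) \<in> I" "u < z" "z < v"
      then obtain t K' where "(t, K') \<in> q" "u = Inf K'" "v = Sup K'" by (auto simp: I_def)
      then have "z \<in> K'" "t \<in> E" "(t, K') \<in> p" using K[of t K'] qp \<open>u < z\<close> \<open>z < v\<close> by (auto simp: q_def)
      then show "z \<in> U" using rE fineD[OF fine] by blast
    qed
    finally show "(\<Sum>(u, v)\<in>I. v - u) < \<delta>"
      using Um by (metis (no_types, lifting) \<open>\<delta> > 0\<close> ennreal_less_iff ennreal_leI leD le_less_trans linorder_not_le)
  qed
  then have "(\<Sum>(t, K)\<in>q. \<bar>f (Sup K) - f (Inf K)\<bar>) < \<epsilon>"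
    unfolding I_def by (subst (asm) sum.reindex[OF inj]) (simp add: case_prod_unfold)
  moreover have "(\<Sum>(t, K)\<in>q. f (Sup K) - f (Inf K)) \<le> (\<Sum>(t, K)\<in>q. \<bar>f (Sup K) - f (Inf K)\<bar>)"
    by (intro sum_mono) auto
  ultimately have bad: "(\<Sum>(t, K)\<in>q. f (Sup K) - f (Inf K)) < \<epsilon>" by linarith
  have good: "(\<Sum>(t, K)\<in>p - q. f (Sup K) - f (Inf K)) \<le> (\<Sum>(t, K)\<in>p - q. \<epsilon> * (Sup K - Inf K))"
  proof (intro sum_mono, clarify)
    fix t K' assume A: "(t, K') \<in> p" "(t, K') \<notin> q"
    obtain u v where uv: "K' = {u..v}" "u \<le> t" "t \<le> v" "Inf K' = u" "Sup K' = v" "a \<le> u" "v \<le> b"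
      "u \<in> ball t (r t)" "v \<in> ball t (r t)" using K[OF A(1)] by blast
    show "f (Sup K') - f (Inf K') \<le> \<epsilon> * (Sup K' - Inf K')"
    proof (cases "t \<in> E")
      case True
      then have "u = v" using A uv by (auto simp: q_def)
      then show ?thesis using uv by simp
    next
      case False then show ?thesis using rN[of t u v] uv by auto
    qed
  qed
  also have "\<dots> \<le> (\<Sum>(t, K)\<in>p. \<epsilon> * (Sup K - Inf K))"
    by (rule sum_mono2[OF pD(1)]) (use K e in fastforce)+
  also have "\<dots> = \<epsilon> * (\<Sum>(t, K)\<in>p. Sup K - Inf K)"
    by (simp add: sum_distrib_left case_prod_unfold)
  also have "(\<Sum>(t, K)\<in>p. Sup K - Inf K) = b - a"
    using additive_tagged_division_1[OF \<open>a \<le> b\<close> p, of "\<lambda>x. x"] by simp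
  finally have good: "(\<Sum>(t, K)\<in>p - q. f (Sup K) - f (Inf K)) \<le> \<epsilon> * (b - a)" .
  have "f b - f a = (\<Sum>(t, K)\<in>p. f (Sup K) - f (Inf K))"
    using additive_tagged_division_1[OF \<open>a \<le> b\<close> p, of f] by simp
  also have "\<dots> = (\<Sum>(t, K)\<in>p - q. f (Sup K) - f (Inf K)) + (\<Sum>(t, K)\<in>q. f (Sup K) - f (Inf K))"
    using sum.subset_diff[OF qp pD(1)] by simp
  also have "\<dots> \<le> \<epsilon> * (b - a + 1)" using good bad by (simp add: algebra_simps)
  also have "\<dots> = \<eta>" using \<open>a \<le> b\<close> by (simp add: \<epsilon>_def)
  finally show "f b \<le> f a + \<eta>" by simp
qed

section \<open>Calculus of Caratheodory solutions\<close>

lemma caratheodory_odeD_ac: "caratheodory_ode y g \<Longrightarrow> 0 \<le> a \<Longrightarrow> absolutely_continuous_on a b y"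
  unfolding caratheodory_ode_def
  by (rule absolutely_continuous_on_subinterval[of 0 "max 0 b"]) auto

lemma caratheodory_ode_exceptional_set:
  assumes "caratheodory_ode y g"
  obtains E where "negligible E" "\<And>t. t > 0 \<Longrightarrow> t \<notin> E \<Longrightarrow> (y has_real_derivative g t) (at t)"
proof -
  obtain E where "{t \<in> space lebesgue. \<not> (t > 0 \<longrightarrow> (y has_real_derivative g t) (at t))} \<subseteq> E"
     "E \<in> null_sets lebesgue"
    using assms unfolding caratheodory_ode_def eventually_ae_filter by auto
  then show thesis using that[of E] by (auto simp: negligible_iff_null_sets)
qed

text \<open>
  The values of \<open>w\<close> and \<open>k\<close> are prescribed on the time axis of the solution only. This matters for
  identities that use the power balance at load buses, which says nothing about negative times.
\<close>

lemma caratheodory_ode_linear_combination: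
  assumes y: "caratheodory_ode y g" and z: "caratheodory_ode z h"
    and wp: "\<And>t. t \<ge> 0 \<Longrightarrow> w t = p * y t + q * z t"
    and wd: "\<And>t. t > 0 \<Longrightarrow> k t = p * g t + q * h t"
  shows "caratheodory_ode w k"
  unfolding caratheodory_ode_def
proof (intro conjI allI impI)
  fix T :: real assume "T \<ge> 0"
  show "absolutely_continuous_on 0 T w"
  proof (rule absolutely_continuous_on_dominated)
    show "absolutely_continuous_on 0 T y" "absolutely_continuous_on 0 T z"
      using y z by (auto intro: caratheodory_odeD_ac)
    show "\<bar>p\<bar> + \<bar>q\<bar> + 1 > 0" by linarith
    fix u v :: real assume "0 \<le> u" "u \<le> v"
    then have "\<bar>w v - w u\<bar> = \<bar>p * (y v - y u) + q * (z v - z u)\<bar>" by (simp add: wp algebra_simps)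
    also have "\<dots> \<le> \<bar>p\<bar> * \<bar>y v - y u\<bar> + \<bar>q\<bar> * \<bar>z v - z u\<bar>"
      by (metis abs_mult abs_triangle_ineq)
    also have "\<dots> \<le> (\<bar>p\<bar> + \<bar>q\<bar> + 1) * (\<bar>y v - y u\<bar> + \<bar>z v - z u\<bar>)"
      by (simp add: algebra_simps add_nonneg_nonneg)
    finally show "\<bar>w v - w u\<bar> \<le> (\<bar>p\<bar> + \<bar>q\<bar> + 1) * (\<bar>y v - y u\<bar> + \<bar>z v - z u\<bar>)" .
  qed
next
  have "AE t in lebesgue. t > 0 \<longrightarrow> (y has_real_derivative g t) (at t)"
    "AE t in lebesgue. t > 0 \<longrightarrow> (z has_real_derivative h t) (at t)"
    using y z by (auto simp: caratheodory_ode_def)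
  then show "AE t in lebesgue. t > 0 \<longrightarrow> (w has_real_derivative k t) (at t)"
  proof eventually_elim
    case (elim t)
    show ?case
    proof
      assume t: "t > 0"
      have "((\<lambda>t. p * y t + q * z t) has_real_derivative k t) (at t)"
        using elim t by (auto intro!: derivative_eq_intros simp: wd)
      then show "(w has_real_derivative k t) (at t)"
        by (rule DERIV_cong_ev[THEN iffD1, rotated 3])
          (use t eventually_nhds_in_open[of "{0<..}" t] in \<open>auto simp: wp elim: eventually_mono\<close>)
    qed
  qed
qed

lemma caratheodory_ode_const: "caratheodory_ode (\<lambda>t. k) (\<lambda>t. 0)"
  using absolutely_continuous_on_affine[of _ _ k 0] by (auto simp: caratheodory_ode_def)

lemma caratheodory_ode_affine: "caratheodory_ode (\<lambda>t. m * t) (\<lambda>t. m)"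
  using absolutely_continuous_on_affine[of _ _ 0 m]
  by (auto simp: caratheodory_ode_def intro!: derivative_eq_intros)

lemma caratheodory_ode_add:
  "caratheodory_ode y g \<Longrightarrow> caratheodory_ode z h \<Longrightarrow> caratheodory_ode (\<lambda>t. y t + z t) (\<lambda>t. g t + h t)"
  by (rule caratheodory_ode_linear_combination[where p = 1 and q = 1]) auto

lemma caratheodory_ode_cmult:
  "caratheodory_ode y g \<Longrightarrow> caratheodory_ode (\<lambda>t. k * y t) (\<lambda>t. k * g t)"
  by (rule caratheodory_ode_linear_combination[where p = k and q = 0 and z = y and h = g]) auto

lemma caratheodory_ode_sum:
  "(\<And>k. k \<in> K \<Longrightarrow> caratheodory_ode (y k) (g k)) \<Longrightarrow>
     caratheodory_ode (\<lambda>t. \<Sum>k\<in>K. y k t) (\<lambda>t. \<Sum>k\<in>K. g k t)"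
proof (induction K rule: infinite_finite_induct)
  case (insert k K)
  then show ?case using caratheodory_ode_add[of "y k" "g k"] by simp
qed (simp_all add: caratheodory_ode_const)

lemma caratheodory_ode_square:
  assumes y: "caratheodory_ode y g"
  shows "caratheodory_ode (\<lambda>t. (y t - k)\<^sup>2) (\<lambda>t. 2 * ((y t - k) * g t))"
  unfolding caratheodory_ode_def
proof (intro conjI allI impI)
  fix T :: real assume "T \<ge> 0"
  have "absolutely_continuous_on 0 T y" using y by (auto simp: caratheodory_ode_def \<open>T \<ge> 0\<close>)
  then have "compact (y ` {0..T})"
    by (intro compact_continuous_image absolutely_continuous_on_imp_continuous_on) auto
  then have "bounded (y ` {0..T})" by (rule compact_imp_bounded)
  then obtain M where M: "\<And>t. t \<in> {0..T} \<Longrightarrow> \<bar>y t\<bar> \<le> M"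
    unfolding bounded_iff by (metis image_eqI real_norm_def)
  show "absolutely_continuous_on 0 T (\<lambda>t. (y t - k)\<^sup>2)"
  proof (rule absolutely_continuous_on_dominated)
    show "absolutely_continuous_on 0 T y" by fact
    show "absolutely_continuous_on 0 T y" by fact
    have "M \<ge> 0" using M[of 0] \<open>T \<ge> 0\<close> by force
    then show "2 * M + 2 * \<bar>k\<bar> + 1 > 0" by linarith
    fix u v assume uv: "0 \<le> u" "u \<le> v" "v \<le> T"
    have "\<bar>(y v - k)\<^sup>2 - (y u - k)\<^sup>2\<bar> = \<bar>y v + y u - 2 * k\<bar> * \<bar>y v - y u\<bar>"
      by (simp add: power2_eq_square abs_mult[symmetric] algebra_simps)
    also have "\<dots> \<le> (2 * M + 2 * \<bar>k\<bar> + 1) * (\<bar>y v - y u\<bar> + \<bar>y v - y u\<bar>)"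
      using M[of u] M[of v] uv by (intro mult_mono) auto
    finally show "\<bar>(y v - k)\<^sup>2 - (y u - k)\<^sup>2\<bar> \<le> (2 * M + 2 * \<bar>k\<bar> + 1) * (\<bar>y v - y u\<bar> + \<bar>y v - y u\<bar>)" .
  qed
next
  have "AE t in lebesgue. t > 0 \<longrightarrow> (y has_real_derivative g t) (at t)"
    using y by (auto simp: caratheodory_ode_def)
  then show "AE t in lebesgue. t > 0 \<longrightarrow> ((\<lambda>t. (y t - k)\<^sup>2) has_real_derivative 2 * ((y t - k) * g t)) (at t)"
    by eventually_elim (auto intro!: derivative_eq_intros)
qed

text \<open>
  The mean value inequality: subtract \<open>m * t\<close> and apply monotonicity. Leaving out the left end point
  helps in \<open>projected_ode_nonneg\<close>, where the bound on \<open>g\<close> starts after a switching time.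
\<close>

lemma caratheodory_ode_increment_le:
  assumes y: "caratheodory_ode y g" and ab: "0 \<le> a" "a \<le> b"
    and le: "\<And>t. a < t \<Longrightarrow> t \<le> b \<Longrightarrow> g t \<le> m"
  shows "y b - y a \<le> m * (b - a)"
proof -
  have ode: "caratheodory_ode (\<lambda>t. y t - m * t) (\<lambda>t. g t - m)"
    by (rule caratheodory_ode_linear_combination[OF y caratheodory_ode_affine[of m], of _ 1 "-1"]) auto
  obtain E where E: "negligible E"
    "\<And>t. t > 0 \<Longrightarrow> t \<notin> E \<Longrightarrow> ((\<lambda>t. y t - m * t) has_real_derivative g t - m) (at t)"
    using caratheodory_ode_exceptional_set[OF ode] by blast
  have "y b - m * b \<le> y a - m * a"
  \<comment> \<open>at the end point \<open>a\<close> the derivative may exceed \<open>m\<close>, and may fail to exist if \<open>a = 0\<close>\<close>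
  proof (rule absolutely_continuous_on_increment_le[of a b "\<lambda>t. y t - m * t" "insert a E"])
    show "absolutely_continuous_on a b (\<lambda>t. y t - m * t)" by (rule caratheodory_odeD_ac[OF ode ab(1)])
    show "negligible (insert a E)" using E(1) by simp
    fix t assume t: "t \<in> {a..b} - insert a E"
    then have "a < t" "t \<le> b" "t > 0" using ab by auto
    then show "\<exists>g'\<le>0. ((\<lambda>t. y t - m * t) has_real_derivative g') (at t)"
      using le[of t] E(2)[of t] t by (intro exI[of _ "g t - m"]) auto
  qed fact
  then show ?thesis by (simp add: algebra_simps)
qed

lemma caratheodory_ode_increment_approx:
  assumes y: "caratheodory_ode y g" and ab: "0 \<le> a" "a \<le> b"
    and le: "\<And>t. a < t \<Longrightarrow> t \<le> b \<Longrightarrow> \<bar>g t - m\<bar> \<le> \<epsilon>"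
  shows "\<bar>y b - y a - m * (b - a)\<bar> \<le> \<epsilon> * (b - a)"
proof -
  have "y b - y a \<le> (m + \<epsilon>) * (b - a)"
    by (rule caratheodory_ode_increment_le[OF y ab]) (use le in force)
  moreover have "- 1 * y b - (- 1 * y a) \<le> (\<epsilon> - m) * (b - a)"
    by (rule caratheodory_ode_increment_le[OF caratheodory_ode_cmult[OF y] ab]) (use le in force)
  ultimately show ?thesis by (simp add: algebra_simps abs_le_iff)
qed

lemma caratheodory_ode_continuous_on:
  assumes "caratheodory_ode y g" "0 \<le> a"
  shows "continuous_on {a..b} y"
  using absolutely_continuous_on_imp_continuous_on[OF caratheodory_odeD_ac[OF assms]] .

text \<open>
  While \<open>y\<close> is negative, the projection lets it only increase. So it cannot have decreased since the
  last time at which it was nonnegative.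
\<close>

lemma projected_ode_nonneg:
  assumes y: "caratheodory_ode y (\<lambda>t. k * pos_proj (f t) (y t))" and k: "k \<ge> 0"
    and y0: "y 0 \<ge> 0" and "t \<ge> 0"
  shows "y t \<ge> 0"
proof (rule ccontr)
  assume neg: "\<not> y t \<ge> 0"
  define S where "S = {s \<in> {0..t}. y s \<ge> 0}"
  have "closed ({0..t} \<inter> y -` {0..})"
    by (intro continuous_closed_preimage caratheodory_ode_continuous_on[OF y]) auto
  also have "{0..t} \<inter> y -` {0..} = S" by (auto simp: S_def)
  finally have "closed S" .
  moreover have "bounded S" unfolding S_def by (rule bounded_subset[of "{0..t}"]) auto
  moreover have "0 \<in> S" using y0 \<open>t \<ge> 0\<close> by (simp add: S_def)
  ultimately obtain s where s: "s \<in> S" "\<And>s'. s' \<in> S \<Longrightarrow> s' \<le> s"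
    using compact_attains_sup[of S] compact_eq_bounded_closed by blast
  have st: "0 \<le> s" "s \<le> t" "y s \<ge> 0" using s(1) by (auto simp: S_def)
  have "- 1 * y t - (- 1 * y s) \<le> 0 * (t - s)"
  proof (rule caratheodory_ode_increment_le[OF caratheodory_ode_cmult[OF y] st(1,2)])
    fix r assume r: "s < r" "r \<le> t"
    then have "r \<notin> S" using s(2)[of r] by linarith
    then have "y r < 0" using r st by (simp add: S_def)
    then show "- 1 * (k * pos_proj (f r) (y r)) \<le> 0" using k by (auto simp: pos_proj_def)
  qed
  then show False using st(3) neg by simp
qed

section \<open>Asymptotics of bounded and slowly varying signals\<close>

definition bounded_signal :: "(real \<Rightarrow> real) \<Rightarrow> bool" where
  "bounded_signal f \<longleftrightarrow> (\<exists>M. \<forall>t\<ge>0. \<bar>f t\<bar> \<le> M)"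

lemma bounded_signalI: "(\<And>t. t \<ge> 0 \<Longrightarrow> \<bar>f t\<bar> \<le> M) \<Longrightarrow> bounded_signal f"
  by (auto simp: bounded_signal_def)

lemma bounded_signalE:
  assumes "bounded_signal f"
  obtains M where "M > 0" "\<And>t. t \<ge> 0 \<Longrightarrow> \<bar>f t\<bar> \<le> M"
proof -
  obtain M where "\<And>t. t \<ge> 0 \<Longrightarrow> \<bar>f t\<bar> \<le> M" using assms by (auto simp: bounded_signal_def)
  then have "\<bar>f t\<bar> \<le> \<bar>M\<bar> + 1" if "t \<ge> 0" for t using that
    by (metis abs_ge_self add_increasing2 order_trans zero_le_one)
  then show thesis by (intro that[of "\<bar>M\<bar> + 1"]) auto
qed

lemma bounded_signal_dominated:
  assumes "bounded_signal g" "\<And>t. t \<ge> 0 \<Longrightarrow> \<bar>f t\<bar> \<le> \<bar>g t\<bar>"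
  shows "bounded_signal f"
proof -
  obtain M where "\<And>t. t \<ge> 0 \<Longrightarrow> \<bar>g t\<bar> \<le> M" using assms(1) by (auto simp: bounded_signal_def)
  then show ?thesis using assms(2) order_trans by (intro bounded_signalI[of _ M]) blast
qed

lemma bounded_signal_const: "bounded_signal (\<lambda>t. k)"
  by (auto simp: bounded_signal_def)

lemma bounded_signal_add:
  assumes "bounded_signal f" "bounded_signal g"
  shows "bounded_signal (\<lambda>t. f t + g t)"
proof -
  obtain M K where "\<And>t. t \<ge> 0 \<Longrightarrow> \<bar>f t\<bar> \<le> M" "\<And>t. t \<ge> 0 \<Longrightarrow> \<bar>g t\<bar> \<le> K"
    using assms by (auto simp: bounded_signal_def)
  then show ?thesis by (intro bounded_signalI[of _ "M + K"]) (meson abs_triangle_ineq add_mono order_trans)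
qed

lemma bounded_signal_cmult:
  assumes "bounded_signal f"
  shows "bounded_signal (\<lambda>t. k * f t)"
proof -
  obtain M where "\<And>t. t \<ge> 0 \<Longrightarrow> \<bar>f t\<bar> \<le> M" using assms by (auto simp: bounded_signal_def)
  then show ?thesis by (intro bounded_signalI[of _ "\<bar>k\<bar> * M"]) (auto simp: abs_mult intro: mult_left_mono)
qed

lemma bounded_signal_minus:
  "bounded_signal f \<Longrightarrow> bounded_signal (\<lambda>t. - f t)"
  by (simp add: bounded_signal_def)

lemma bounded_signal_diff:
  "bounded_signal f \<Longrightarrow> bounded_signal g \<Longrightarrow> bounded_signal (\<lambda>t. f t - g t)"
  using bounded_signal_add[of f "\<lambda>t. - g t"] bounded_signal_minus[of g] by simp

lemma bounded_signal_multc: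
  "bounded_signal f \<Longrightarrow> bounded_signal (\<lambda>t. f t * k)"
  using bounded_signal_cmult[of f k] by (simp add: mult.commute)

lemma bounded_signal_divide:
  "bounded_signal f \<Longrightarrow> bounded_signal (\<lambda>t. f t / k)"
  using bounded_signal_multc[of f "1 / k"] by simp

lemma bounded_signal_sum:
  "(\<And>k. k \<in> K \<Longrightarrow> bounded_signal (f k)) \<Longrightarrow> bounded_signal (\<lambda>t. \<Sum>k\<in>K. f k t)"
proof (induction K rule: infinite_finite_induct)
  case (insert k K)
  then show ?case using bounded_signal_add[of "f k"] by simp
qed (simp_all add: bounded_signal_const)

lemma bounded_signal_compose:
  assumes f: "bounded_signal f" and h: "continuous_on UNIV (h :: real \<Rightarrow> real)"
  shows "bounded_signal (\<lambda>t. h (f t))"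
proof -
  obtain M where M: "\<And>t. t \<ge> 0 \<Longrightarrow> \<bar>f t\<bar> \<le> M" using f by (auto simp: bounded_signal_def)
  have "compact (h ` {-M..M})"
    by (intro compact_continuous_image continuous_on_subset[OF h]) auto
  then have "bounded (h ` {-M..M})" by (rule compact_imp_bounded)
  then obtain K where K: "\<And>x. x \<in> {-M..M} \<Longrightarrow> \<bar>h x\<bar> \<le> K"
    unfolding bounded_iff by (metis image_eqI real_norm_def)
  have "f t \<in> {-M..M}" if "t \<ge> 0" for t using M[OF that] by (simp add: abs_le_iff)
  with K show ?thesis by (intro bounded_signalI[of _ K]) blast
qed

lemma bounded_signal_pos_proj:
  "bounded_signal f \<Longrightarrow> bounded_signal (\<lambda>t. pos_proj (f t) (y t))"
  by (erule bounded_signal_dominated) (simp add: pos_proj_def)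

lemma uniformly_continuous_on_compose_bounded:
  assumes f: "bounded_signal f" "uniformly_continuous_on {0..} f"
    and h: "continuous_on UNIV (h :: real \<Rightarrow> real)"
  shows "uniformly_continuous_on {0..} (\<lambda>t. h (f t))"
proof -
  obtain M where M: "\<And>t. t \<ge> 0 \<Longrightarrow> \<bar>f t\<bar> \<le> M" using f(1) by (auto simp: bounded_signal_def)
  have "uniformly_continuous_on {-M..M} h"
    by (intro compact_uniformly_continuous continuous_on_subset[OF h]) auto
  moreover have "f t \<in> {-M..M}" if "t \<ge> 0" for t using M[OF that] by (simp add: abs_le_iff)
  then have "f ` {0..} \<subseteq> {-M..M}" by (simp add: image_subset_iff)
  ultimately have "uniformly_continuous_on (f ` {0..}) h"
    unfolding uniformly_continuous_on_def by (meson subsetD)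
  then show ?thesis by (rule uniformly_continuous_on_compose[OF f(2)])
qed

lemma uniformly_continuous_on_divide_const:
  fixes f :: "real \<Rightarrow> real"
  shows "uniformly_continuous_on S f \<Longrightarrow> uniformly_continuous_on S (\<lambda>t. f t / k)"
  using uniformly_continuous_on_cmul_right[of S f "1 / k"] by simp

lemma caratheodory_ode_uniformly_continuous:
  assumes y: "caratheodory_ode y g" and g: "bounded_signal g"
  shows "uniformly_continuous_on {0..} y"
proof -
  obtain M where M: "M > 0" "\<And>t. t \<ge> 0 \<Longrightarrow> \<bar>g t\<bar> \<le> M" using bounded_signalE[OF g] by blast
  have le: "\<bar>y b - y a\<bar> \<le> M * \<bar>b - a\<bar>" if "0 \<le> a" "a \<le> b" for a b
    using caratheodory_ode_increment_approx[OF y that, of 0 M] M(2) that by simp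
  have lip: "\<bar>y b - y a\<bar> \<le> M * \<bar>b - a\<bar>" if "0 \<le> a" "0 \<le> b" for a b
    using le[of a b] le[of b a] that by (cases "a \<le> b") (auto simp: abs_minus_commute)
  show ?thesis unfolding uniformly_continuous_on_def
  proof (intro allI impI)
    fix \<epsilon> :: real assume "\<epsilon> > 0"
    show "\<exists>d>0. \<forall>x\<in>{0..}. \<forall>x'\<in>{0..}. dist x' x < d \<longrightarrow> dist (y x') (y x) < \<epsilon>"
    proof (intro exI[of _ "\<epsilon> / M"] conjI ballI impI)
      fix a b :: real assume "a \<in> {0..}" "b \<in> {0..}" and d: "dist b a < \<epsilon> / M"
      then have "\<bar>y b - y a\<bar> \<le> M * \<bar>b - a\<bar>" using lip by simp
      also have "\<dots> < \<epsilon>" using d M(1) by (simp add: dist_real_def pos_less_divide_eq mult.commute)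
      finally show "dist (y b) (y a) < \<epsilon>" by (simp add: dist_real_def)
    qed (use \<open>\<epsilon> > 0\<close> M(1) in simp)
  qed
qed

text \<open>
  Convergent signals are slowly varying, but so is \<open>sin (ln t)\<close>. This is what can be said about the
  multipliers before their convergence is known.
\<close>

definition slowly_varying :: "(real \<Rightarrow> real) \<Rightarrow> bool" where
  "slowly_varying f \<longleftrightarrow>
     (\<forall>T>0. \<forall>\<epsilon>>0. \<forall>\<^sub>F t in at_top. \<forall>s\<in>{0..T}. \<bar>f (t + s) - f t\<bar> \<le> \<epsilon>)"

lemma slowly_varyingD:
  "slowly_varying f \<Longrightarrow> T > 0 \<Longrightarrow> \<epsilon> > 0 \<Longrightarrow> \<forall>\<^sub>F t in at_top. \<forall>s\<in>{0..T}. \<bar>f (t + s) - f t\<bar> \<le> \<epsilon>"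
  by (simp add: slowly_varying_def)

lemma slowly_varying_linear_combination:
  assumes "slowly_varying f" "slowly_varying g"
  shows "slowly_varying (\<lambda>t. p * f t + q * g t)"
  unfolding slowly_varying_def
proof (intro allI impI)
  fix T \<epsilon> :: real assume T: "T > 0" and e: "\<epsilon> > 0"
  define \<delta> where "\<delta> = \<epsilon> / (\<bar>p\<bar> + \<bar>q\<bar> + 1)"
  have d: "\<delta> > 0" "(\<bar>p\<bar> + \<bar>q\<bar> + 1) * \<delta> = \<epsilon>" using e by (auto simp: \<delta>_def add_nonneg_pos)
  show "\<forall>\<^sub>F t in at_top. \<forall>s\<in>{0..T}. \<bar>p * f (t + s) + q * g (t + s) - (p * f t + q * g t)\<bar> \<le> \<epsilon>"
    using slowly_varyingD[OF assms(1) T d(1)] slowly_varyingD[OF assms(2) T d(1)]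
  proof eventually_elim
    case (elim t)
    show ?case
    proof
      fix s assume s: "s \<in> {0..T}"
      have "\<bar>p * f (t + s) + q * g (t + s) - (p * f t + q * g t)\<bar>
          = \<bar>p * (f (t + s) - f t) + q * (g (t + s) - g t)\<bar>" by (simp add: algebra_simps)
      also have "\<dots> \<le> \<bar>p\<bar> * \<bar>f (t + s) - f t\<bar> + \<bar>q\<bar> * \<bar>g (t + s) - g t\<bar>"
        by (metis abs_mult abs_triangle_ineq)
      also have "\<dots> \<le> \<bar>p\<bar> * \<delta> + \<bar>q\<bar> * \<delta>" using elim s by (intro add_mono mult_left_mono) auto
      also have "\<dots> \<le> \<epsilon>" using d by (simp add: algebra_simps)
      finally show "\<bar>p * f (t + s) + q * g (t + s) - (p * f t + q * g t)\<bar> \<le> \<epsilon>" .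
    qed
  qed
qed

lemma tendsto_imp_slowly_varying:
  assumes "(f \<longlongrightarrow> l) at_top"
  shows "slowly_varying f"
  unfolding slowly_varying_def
proof (intro allI impI)
  fix T \<epsilon> :: real assume "T > 0" and e: "\<epsilon> > 0"
  then have "\<forall>\<^sub>F t in at_top. dist (f t) l < \<epsilon> / 2" using assms tendstoD by (metis half_gt_zero)
  then obtain t0 where t0: "\<And>t. t \<ge> t0 \<Longrightarrow> dist (f t) l < \<epsilon> / 2" by (auto simp: eventually_at_top_linorder)
  show "\<forall>\<^sub>F t in at_top. \<forall>s\<in>{0..T}. \<bar>f (t + s) - f t\<bar> \<le> \<epsilon>"
    using eventually_ge_at_top[of t0]
  proof eventually_elim
    case (elim t)
    show ?case
    proof
      fix s assume "s \<in> {0..T}"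
      then have "dist (f (t + s)) l < \<epsilon> / 2" "dist (f t) l < \<epsilon> / 2" using t0 elim by auto
      then show "\<bar>f (t + s) - f t\<bar> \<le> \<epsilon>" unfolding dist_real_def by linarith
    qed
  qed
qed

lemma slowly_varying_const: "slowly_varying (\<lambda>t. k)"
  by (rule tendsto_imp_slowly_varying) (rule tendsto_const)

lemma slowly_varying_add:
  "slowly_varying f \<Longrightarrow> slowly_varying g \<Longrightarrow> slowly_varying (\<lambda>t. f t + g t)"
  using slowly_varying_linear_combination[of f g 1 1] by simp

lemma slowly_varying_diff:
  "slowly_varying f \<Longrightarrow> slowly_varying g \<Longrightarrow> slowly_varying (\<lambda>t. f t - g t)"
  using slowly_varying_linear_combination[of f g 1 "-1"] by simp

lemma slowly_varying_cmult:
  "slowly_varying f \<Longrightarrow> slowly_varying (\<lambda>t. k * f t)"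
  using slowly_varying_linear_combination[of f f k 0] by simp

lemma slowly_varying_sum:
  "(\<And>k. k \<in> K \<Longrightarrow> slowly_varying (f k)) \<Longrightarrow> slowly_varying (\<lambda>t. \<Sum>k\<in>K. f k t)"
proof (induction K rule: infinite_finite_induct)
  case (insert k K)
  then show ?case using slowly_varying_add[of "f k"] by simp
qed (simp_all add: slowly_varying_const)

lemma slowly_varying_of_derivative_tendsto_0:
  assumes y: "caratheodory_ode y g" and g: "(g \<longlongrightarrow> 0) at_top"
  shows "slowly_varying y"
  unfolding slowly_varying_def
proof (intro allI impI)
  fix T \<epsilon> :: real assume T: "T > 0" and e: "\<epsilon> > 0"
  then have "\<forall>\<^sub>F t in at_top. dist (g t) 0 < \<epsilon> / T" using tendstoD[OF g] by simp
  then obtain t0 where t0: "\<And>t. t \<ge> t0 \<Longrightarrow> \<bar>g t\<bar> < \<epsilon> / T" by (auto simp: eventually_at_top_linorder)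
  show "\<forall>\<^sub>F t in at_top. \<forall>s\<in>{0..T}. \<bar>y (t + s) - y t\<bar> \<le> \<epsilon>"
    using eventually_ge_at_top[of "max 0 t0"]
  proof eventually_elim
    case (elim t)
    show ?case
    proof
      fix s assume s: "s \<in> {0..T}"
      have "\<bar>y (t + s) - y t - 0 * (t + s - t)\<bar> \<le> \<epsilon> / T * (t + s - t)"
      proof (rule caratheodory_ode_increment_approx[OF y])
        fix r assume "t < r"
        then show "\<bar>g r - 0\<bar> \<le> \<epsilon> / T" using t0[of r] elim by simp
      qed (use elim s in auto)
      also have "\<dots> \<le> \<epsilon> / T * T" using s e T by (intro mult_left_mono) auto
      finally show "\<bar>y (t + s) - y t\<bar> \<le> \<epsilon>" using T by simp
    qed
  qed
qed

text \<open>
  By uniform continuity, a value of \<open>g\<close> away from zero persists over a window of fixed length, and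
  moves \<open>y\<close> by a fixed amount over this window.
\<close>

lemma barbalat:
  assumes y: "caratheodory_ode y g" "slowly_varying y" and g: "uniformly_continuous_on {0..} g"
  shows "(g \<longlongrightarrow> 0) at_top"
proof (rule tendstoI)
  fix \<epsilon> :: real assume e: "\<epsilon> > 0"
  then have e3: "\<epsilon> / 3 > 0" by simp
  obtain \<delta>' where "\<delta>' > 0" and \<delta>': "\<And>s t. s \<ge> 0 \<Longrightarrow> t \<ge> 0 \<Longrightarrow> dist t s < \<delta>' \<Longrightarrow> dist (g t) (g s) < \<epsilon> / 3"
    using g e3 unfolding uniformly_continuous_on_def by (metis atLeast_iff)
  define \<delta> where "\<delta> = \<delta>' / 2"
  have d: "\<delta> > 0" using \<open>\<delta>' > 0\<close> by (simp add: \<delta>_def)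
  have "\<forall>\<^sub>F t in at_top. \<forall>s\<in>{0..\<delta>}. \<bar>y (t + s) - y t\<bar> \<le> \<epsilon> / 3 * \<delta>"
    by (rule slowly_varyingD[OF y(2)]) (use d e in auto)
  then show "\<forall>\<^sub>F t in at_top. dist (g t) 0 < \<epsilon>"
    using eventually_ge_at_top[of 0]
  proof eventually_elim
    case (elim t)
    have "\<bar>y (t + \<delta>) - y t - g t * (t + \<delta> - t)\<bar> \<le> \<epsilon> / 3 * (t + \<delta> - t)"
    proof (rule caratheodory_ode_increment_approx[OF y(1)])
      fix s assume "t < s" "s \<le> t + \<delta>"
      then have "dist (g s) (g t) < \<epsilon> / 3" using \<open>0 \<le> t\<close> d
        by (intro \<delta>') (auto simp: \<delta>_def dist_real_def)
      then show "\<bar>g s - g t\<bar> \<le> \<epsilon> / 3" by (simp add: dist_real_def)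
    qed (use \<open>0 \<le> t\<close> d in auto)
    moreover have "\<bar>y (t + \<delta>) - y t\<bar> \<le> \<epsilon> / 3 * \<delta>" using elim(1) d by simp
    ultimately have "\<bar>g t * \<delta>\<bar> \<le> \<epsilon> / 3 * \<delta> + \<epsilon> / 3 * \<delta>"
      unfolding add_diff_cancel_left' by arith
    then have "\<bar>g t\<bar> * \<delta> \<le> (2 * \<epsilon> / 3) * \<delta>" using d by (simp add: abs_mult)
    then have "\<bar>g t\<bar> \<le> 2 * \<epsilon> / 3" using d by (rule mult_right_le_imp_le)
    then show ?case using e by simp
  qed
qed

text \<open>
  Over a window of length \<open>T\<close> the signal \<open>y\<close> moves by about \<open>T * g t\<close>, but by at most \<open>2 * M\<close> if \<open>M\<close>
  bounds it. As the window may be arbitrarily long, \<open>g\<close> must tend to zero.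
\<close>

lemma slowly_varying_derivative_of_bounded:
  assumes y: "caratheodory_ode y g" "bounded_signal y" and g: "slowly_varying g"
  shows "(g \<longlongrightarrow> 0) at_top"
proof (rule tendstoI)
  fix \<epsilon> :: real assume e: "\<epsilon> > 0"
  obtain M where M: "M > 0" "\<And>t. t \<ge> 0 \<Longrightarrow> \<bar>y t\<bar> \<le> M" using bounded_signalE[OF y(2)] by blast
  \<comment> \<open>long enough to make \<open>2 * M / T = \<epsilon> / 3\<close>\<close>
  define T where "T = 6 * M / \<epsilon>"
  have T: "T > 0" using e M by (simp add: T_def)
  have "\<forall>\<^sub>F t in at_top. \<forall>s\<in>{0..T}. \<bar>g (t + s) - g t\<bar> \<le> \<epsilon> / 3"
    by (rule slowly_varyingD[OF g T]) (use e in auto)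
  then show "\<forall>\<^sub>F t in at_top. dist (g t) 0 < \<epsilon>"
    using eventually_ge_at_top[of 0]
  proof eventually_elim
    case (elim t)
    have "\<bar>y (t + T) - y t - g t * (t + T - t)\<bar> \<le> \<epsilon> / 3 * (t + T - t)"
    proof (rule caratheodory_ode_increment_approx[OF y(1)])
      fix s assume "t < s" "s \<le> t + T"
      then show "\<bar>g s - g t\<bar> \<le> \<epsilon> / 3" using elim(1)[rule_format, of "s - t"] by auto
    qed (use elim T in auto)
    moreover have "\<bar>y (t + T)\<bar> \<le> M" "\<bar>y t\<bar> \<le> M" using M(2) elim T by auto
    moreover have "M = \<epsilon> / 6 * T" using e by (simp add: T_def)
    ultimately have "\<bar>g t * T\<bar> \<le> \<epsilon> / 3 * T + (\<epsilon> / 6 * T + \<epsilon> / 6 * T)"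
      unfolding add_diff_cancel_left' by arith
    then have "\<bar>g t\<bar> * T \<le> (2 * \<epsilon> / 3) * T" using T by (simp add: abs_mult)
    then have "\<bar>g t\<bar> \<le> 2 * \<epsilon> / 3" using T by (rule mult_right_le_imp_le)
    then show ?case using e by simp
  qed
qed

lemma caratheodory_ode_decreasing_converges:
  assumes V: "caratheodory_ode V v" "\<And>t. t \<ge> 0 \<Longrightarrow> V t \<ge> 0" "\<And>t. t \<ge> 0 \<Longrightarrow> v t \<le> 0"
  obtains l where "(V \<longlongrightarrow> l) at_top"
proof -
  have dec: "V b \<le> V a" if "0 \<le> a" "a \<le> b" for a b
    using caratheodory_ode_increment_le[OF V(1) that, of 0] V(3) that by auto
  define l where "l = Inf (V ` {0..})"
  have bb: "bdd_below (V ` {0..})" using V(2) by (auto intro!: bdd_belowI[of _ 0])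
  have "(V \<longlongrightarrow> l) at_top"
  proof (rule order_tendstoI)
    fix a assume "a < l"
    then have "a < V t" if "t \<ge> 0" for t using cINF_lower[OF bb, of t] that by (auto simp: l_def)
    then show "\<forall>\<^sub>F t in at_top. a < V t" by (rule eventually_at_top_linorderI)
  next
    fix a assume "l < a"
    then obtain t0 where "t0 \<ge> 0" "V t0 < a" using cInf_less_iff[OF _ bb] by (auto simp: l_def)
    then have "V t < a" if "t \<ge> t0" for t using dec[of t0 t] that by auto
    then show "\<forall>\<^sub>F t in at_top. V t < a" by (rule eventually_at_top_linorderI)
  qed
  then show thesis by (rule that)
qed

text \<open>
  A function \<open>V\<close> that is bounded below can be dissipated at rate \<open>w\<close> for a finite total amount only.
  As in \<open>barbalat\<close>, uniform continuity excludes that \<open>w\<close> returns to a positive level for ever.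
\<close>

lemma dissipation_tendsto_0:
  assumes V: "caratheodory_ode V v" "\<And>t. t \<ge> 0 \<Longrightarrow> V t \<ge> 0"
    and w: "\<And>t. t \<ge> 0 \<Longrightarrow> w t \<ge> 0" "\<And>t. t \<ge> 0 \<Longrightarrow> v t \<le> - w t" "uniformly_continuous_on {0..} w"
  shows "(w \<longlongrightarrow> 0) at_top"
proof (rule tendstoI)
  fix \<epsilon> :: real assume e: "\<epsilon> > 0"
  have "v t \<le> 0" if "t \<ge> 0" for t using w(1,2)[OF that] by linarith
  then obtain l where "(V \<longlongrightarrow> l) at_top"
    using caratheodory_ode_decreasing_converges[OF V(1) V(2)] by blast
  then have slow: "slowly_varying V" by (rule tendsto_imp_slowly_varying)
  obtain \<delta>' where "\<delta>' > 0" and \<delta>': "\<And>s t. s \<ge> 0 \<Longrightarrow> t \<ge> 0 \<Longrightarrow> dist t s < \<delta>' \<Longrightarrow> dist (w t) (w s) < \<epsilon> / 2"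
    using w(3) e unfolding uniformly_continuous_on_def by (metis atLeast_iff half_gt_zero)
  define \<delta> where "\<delta> = \<delta>' / 2"
  have d: "\<delta> > 0" using \<open>\<delta>' > 0\<close> by (simp add: \<delta>_def)
  have "\<forall>\<^sub>F t in at_top. \<forall>s\<in>{0..\<delta>}. \<bar>V (t + s) - V t\<bar> \<le> \<epsilon> / 3 * \<delta>"
    by (rule slowly_varyingD[OF slow]) (use d e in auto)
  then show "\<forall>\<^sub>F t in at_top. dist (w t) 0 < \<epsilon>"
    using eventually_ge_at_top[of 0]
  proof eventually_elim
    case (elim t)
    have "V (t + \<delta>) - V t \<le> (\<epsilon> / 2 - w t) * (t + \<delta> - t)"
    proof (rule caratheodory_ode_increment_le[OF V(1)])
      fix s assume s: "t < s" "s \<le> t + \<delta>"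
      then have "dist (w s) (w t) < \<epsilon> / 2" using \<open>0 \<le> t\<close> d
        by (intro \<delta>') (auto simp: \<delta>_def dist_real_def)
      then show "v s \<le> \<epsilon> / 2 - w t" using w(2)[of s] s \<open>0 \<le> t\<close>
        unfolding dist_real_def by linarith
    qed (use \<open>0 \<le> t\<close> d in auto)
    moreover have "\<bar>V (t + \<delta>) - V t\<bar> \<le> \<epsilon> / 3 * \<delta>" using elim(1) d by simp
    ultimately have "(w t - \<epsilon> / 2) * \<delta> \<le> \<epsilon> / 3 * \<delta>"
      unfolding add_diff_cancel_left' left_diff_distrib by arith
    then have "w t - \<epsilon> / 2 \<le> \<epsilon> / 3" using d by (rule mult_right_le_imp_le)
    then show ?case using e w(1)[of t] \<open>0 \<le> t\<close> by simp
  qed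
qed

text \<open>
  The signal lives in a compact interval, and off a neighbourhood of \<open>z\<close> the modulus of \<open>h\<close> has a
  positive minimum there.
\<close>

lemma tendsto_unique_zero:
  assumes y: "bounded_signal y" and h: "continuous_on UNIV (h :: real \<Rightarrow> real)"
    and zero: "\<And>x. h x = 0 \<Longrightarrow> x = z" and lim: "((\<lambda>t. h (y t)) \<longlongrightarrow> 0) at_top"
  shows "(y \<longlongrightarrow> z) at_top"
proof (rule tendstoI)
  fix \<epsilon> :: real assume e: "\<epsilon> > 0"
  obtain M where M: "\<And>t. t \<ge> 0 \<Longrightarrow> \<bar>y t\<bar> \<le> M" using y by (auto simp: bounded_signal_def)
  define K where "K = {-M..M} - ball z \<epsilon>"
  have "compact K" by (auto simp: K_def intro: compact_diff)
  have "\<exists>m>0. \<forall>x\<in>K. m \<le> \<bar>h x\<bar>"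
  proof (cases "K = {}")
    case False
    have "continuous_on K (\<lambda>x. \<bar>h x\<bar>)"
      by (intro continuous_on_rabs continuous_on_subset[OF h]) simp
    then obtain x0 where x0: "x0 \<in> K" "\<And>x. x \<in> K \<Longrightarrow> \<bar>h x0\<bar> \<le> \<bar>h x\<bar>"
      using continuous_attains_inf[OF \<open>compact K\<close> False] by meson
    then have "h x0 \<noteq> 0" using zero e by (auto simp: K_def)
    then show ?thesis using x0 by (intro exI[of _ "\<bar>h x0\<bar>"]) auto
  qed (auto intro: exI[of _ 1])
  then obtain m where m: "m > 0" "\<And>x. x \<in> K \<Longrightarrow> m \<le> \<bar>h x\<bar>" by blast
  have "\<forall>\<^sub>F t in at_top. dist (h (y t)) 0 < m" using lim m(1) by (rule tendstoD)
  then show "\<forall>\<^sub>F t in at_top. dist (y t) z < \<epsilon>"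
    using eventually_ge_at_top[of 0]
  proof eventually_elim
    case (elim t)
    then have "y t \<notin> K" using m(2)[of "y t"] by auto
    moreover have "y t \<in> {-M..M}" using M[OF \<open>0 \<le> t\<close>] by (auto simp: abs_le_iff)
    ultimately show ?case by (auto simp: K_def dist_commute)
  qed
qed

text \<open>
  The signals form a set and not a family, since the coordinates of a state have different index types.
\<close>

lemma bounded_signals_common_limit_times:
  assumes "finite S" "\<And>f. f \<in> S \<Longrightarrow> bounded_signal f"
  obtains \<tau> :: "nat \<Rightarrow> real" where "filterlim \<tau> at_top sequentially" "\<And>n. \<tau> n \<ge> 0"
    "\<And>f. f \<in> S \<Longrightarrow> convergent (\<lambda>n. f (\<tau> n))"
proof -
  have "\<exists>r. strict_mono r \<and> (\<forall>f\<in>S. convergent (\<lambda>n. f (real (r n :: nat))))"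
    using assms
  proof (induction S)
    case empty
    then show ?case using strict_mono_id by blast
  next
    case (insert f S)
    then obtain r where r: "strict_mono r" "\<And>f. f \<in> S \<Longrightarrow> convergent (\<lambda>n. f (real (r n)))" by auto
    obtain M where "\<And>t. t \<ge> 0 \<Longrightarrow> \<bar>f t\<bar> \<le> M" using insert.prems by (auto simp: bounded_signal_def)
    then have "bounded (range (\<lambda>n. f (real (r n))))" by (auto simp: bounded_iff intro!: exI[of _ M])
    then obtain l q where q: "strict_mono q" "((\<lambda>n. f (real (r n))) \<circ> q) \<longlonglongrightarrow> l"
      using bounded_imp_convergent_subsequence[of "\<lambda>n. f (real (r n))"] by auto
    have "convergent (\<lambda>n. g (real (r (q n))))" if "g \<in> insert f S" for g
    proof (cases "g = f")
      case True then show ?thesis using q(2) by (auto simp: convergent_def o_def)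
    next
      case False
      then have "convergent ((\<lambda>n. g (real (r n))) \<circ> q)"
        using r(2)[of g] that q(1) by (intro convergent_subseq_convergent) auto
      then show ?thesis by (simp add: o_def)
    qed
    then show ?case using strict_mono_o[OF r(1) q(1)] by (intro exI[of _ "r \<circ> q"]) (auto simp: o_def)
  qed
  then obtain r where r: "strict_mono r" "\<And>f. f \<in> S \<Longrightarrow> convergent (\<lambda>n. f (real (r n)))" by blast
  show thesis
  proof (rule that[of "\<lambda>n. real (r n)"])
    show "filterlim (\<lambda>n. real (r n)) at_top sequentially"
      using filterlim_compose[OF filterlim_real_sequentially filterlim_subseq[OF r(1)]] .
  qed (use r in auto)
qed

lemma bounded_signal_eq:
  assumes "bounded_signal g" "\<And>t. t \<ge> 0 \<Longrightarrow> f t = g t"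
  shows "bounded_signal f"
  using assms by (simp add: bounded_signal_def)

lemma uniformly_continuous_on_eq:
  fixes f g :: "real \<Rightarrow> real"
  assumes "uniformly_continuous_on S g" "\<And>t. t \<in> S \<Longrightarrow> f t = g t"
  shows "uniformly_continuous_on S f"
  using assms by (simp add: uniformly_continuous_on_def)

lemma tendsto_cancel_factor:
  fixes f :: "real \<Rightarrow> real"
  assumes "((\<lambda>t. a * f t) \<longlongrightarrow> 0) F" "a \<noteq> 0"
  shows "(f \<longlongrightarrow> 0) F"
  using tendsto_mult_left[OF assms(1), of "1 / a"] assms(2) by simp

lemma bounded_signal_of_square_le:
  fixes y :: "real \<Rightarrow> real"
  assumes "\<And>t. t \<ge> 0 \<Longrightarrow> (y t - k)\<^sup>2 \<le> a"
  shows "bounded_signal y"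
proof (rule bounded_signalI[where M = "sqrt a + \<bar>k\<bar>"])
  fix t :: real assume "t \<ge> 0"
  then have "\<bar>y t - k\<bar> \<le> sqrt a" using assms real_le_rsqrt[of "\<bar>y t - k\<bar>" a] by simp
  then show "\<bar>y t\<bar> \<le> sqrt a + \<bar>k\<bar>" by linarith
qed

lemma tendsto_of_square_le:
  fixes y V :: "real \<Rightarrow> real"
  assumes V: "(V \<longlongrightarrow> 0) at_top" and le: "\<And>t. t \<ge> 0 \<Longrightarrow> (y t - k)\<^sup>2 \<le> a * V t"
  shows "(y \<longlongrightarrow> k) at_top"
proof -
  have "((\<lambda>t. a * V t) \<longlongrightarrow> 0) at_top" using tendsto_mult_left[OF V, of a] by simp
  then have "((\<lambda>t. (y t - k)\<^sup>2) \<longlongrightarrow> 0) at_top"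
    by (rule Lim_null_comparison[rotated])
      (use le in \<open>auto intro!: eventually_at_top_linorderI[of 0]\<close>)
  then have "((\<lambda>t. sqrt ((y t - k)\<^sup>2)) \<longlongrightarrow> sqrt 0) at_top" by (rule tendsto_real_sqrt)
  then have "((\<lambda>t. y t - k) \<longlongrightarrow> 0) at_top" by (simp add: tendsto_rabs_zero_iff)
  from tendsto_add[OF this tendsto_const[of k]] show ?thesis by simp
qed

lemma tendsto_pos_proj_0: "(f \<longlongrightarrow> 0) F \<Longrightarrow> ((\<lambda>t. pos_proj (f t) (y t)) \<longlongrightarrow> 0) F"
  by (rule tendsto_0_le[where K = 1]) (auto simp: pos_proj_def)

lemma tendsto_bounded_signal_mult_0:
  assumes "bounded_signal f" "(g \<longlongrightarrow> 0) at_top"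
  shows "((\<lambda>t. f t * g t) \<longlongrightarrow> 0) at_top"
proof -
  obtain M where M: "\<And>t. t \<ge> 0 \<Longrightarrow> \<bar>f t\<bar> \<le> M" using assms(1) by (auto simp: bounded_signal_def)
  show ?thesis
  proof (rule tendsto_0_le[OF assms(2), where K = M])
    show "\<forall>\<^sub>F t in at_top. norm (f t * g t) \<le> norm (g t) * M"
      using M by (intro eventually_at_top_linorderI[of 0])
        (auto simp: abs_mult mult.commute[of "\<bar>f _\<bar>"] intro: mult_left_mono)
  qed
qed

text \<open>
  Here \<open>y\<close> is the multiplier of a constraint with violation \<open>f t\<close>, and \<open>m\<close> is the slack of this
  constraint at an optimum. If the slack is nonzero, complementary slackness drives \<open>y\<close> to zero. If it
  vanishes, the violation tends to zero, and with it the derivative of \<open>y\<close>.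
\<close>

lemma slowly_varying_multiplier:
  assumes ode: "caratheodory_ode y (\<lambda>t. k * pos_proj (f t) (y t))"
    and slack: "((\<lambda>t. y t * m) \<longlongrightarrow> 0) at_top"
    and active: "m = 0 \<Longrightarrow> (f \<longlongrightarrow> 0) at_top"
  shows "slowly_varying y"
proof (cases "m = 0")
  case True
  then have "((\<lambda>t. k * pos_proj (f t) (y t)) \<longlongrightarrow> 0) at_top"
    using active by (intro tendsto_mult_right_zero tendsto_pos_proj_0)
  then show ?thesis by (rule slowly_varying_of_derivative_tendsto_0[OF ode])
next
  case False
  then have "(y \<longlongrightarrow> 0) at_top" using tendsto_mult_right[OF slack, of "1 / m"] by simp
  then show ?thesis by (rule tendsto_imp_slowly_varying)
qed

section \<open>Convexity and Karush-Kuhn-Tucker multipliers\<close>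

text \<open>
  The weak inequality at the midpoint of \<open>x\<close> and \<open>y\<close> turns into the strict one at \<open>y\<close>.
\<close>

lemma strictly_convex_tangent:
  assumes f: "strictly_convex_on UNIV f" and df: "\<And>x. (f has_real_derivative f' x) (at x)"
    and "x \<noteq> y"
  shows "f x + f' x * (y - x) < f y"
proof -
  have conv: "convex_on UNIV f"
  proof (rule convex_onI)
    fix t x y :: real assume "0 < t" "t < 1"
    show "f ((1 - t) *\<^sub>R x + t *\<^sub>R y) \<le> (1 - t) * f x + t * f y"
    proof (cases "x = y")
      case True
      have "(1 - t) * y + t * y = y" "(1 - t) * f y + t * f y = f y" by (simp_all add: left_diff_distrib)
      with True show ?thesis by simp
    next
      case False
      then show ?thesis
        using f \<open>0 < t\<close> \<open>t < 1\<close> by (auto simp: strictly_convex_on_def intro!: less_imp_le)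
    qed
  qed simp
  have tangent: "f x + f' x * (z - x) \<le> f z" for z
    using convex_on_imp_above_tangent[OF conv, of x z "f' x"] df[of x] by simp
  have "f (1/2 * x + 1/2 * y) < 1/2 * f x + 1/2 * f y"
    using f[unfolded strictly_convex_on_def, THEN conjunct2, rule_format, of x y "1/2" "1/2"] \<open>x \<noteq> y\<close>
    by simp
  with tangent[of "1/2 * x + 1/2 * y"] show ?thesis by (simp add: field_simps)
qed

lemma strictly_convex_deriv_strict_mono:
  assumes "strictly_convex_on UNIV f" "\<And>x. (f has_real_derivative f' x) (at x)" "x \<noteq> y"
  shows "0 < (f' x - f' y) * (x - y)"
  using strictly_convex_tangent[OF assms] strictly_convex_tangent[OF assms(1,2) assms(3)[symmetric]]
  by (simp add: algebra_simps)

lemma C1_differentiable_on_UNIV_real: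
  fixes f :: "real \<Rightarrow> real"
  assumes "f C1_differentiable_on UNIV"
  shows "(f has_real_derivative deriv f x) (at x)" and "continuous_on UNIV (deriv f)"
proof -
  obtain D where D: "\<And>x. (f has_vector_derivative D x) (at x)" "continuous_on UNIV D"
    using assms by (auto simp: C1_differentiable_on_def)
  have "deriv f x = D x" for x
    using D(1) by (auto intro!: DERIV_imp_deriv simp: has_real_derivative_iff_has_vector_derivative)
  then have "deriv f = D" by auto
  with D show "(f has_real_derivative deriv f x) (at x)" "continuous_on UNIV (deriv f)"
    by (auto simp: has_real_derivative_iff_has_vector_derivative)
qed

text \<open>
  The cone generated by finitely many functionals is polyhedral, hence closed. A functional outside of
  it is separated from it by a hyperplane through the origin, whose normal violates the implication.
\<close>

lemma farkas_linear:
  fixes l :: "'k \<Rightarrow> 'a::euclidean_space \<Rightarrow> real"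
  assumes fin: "finite K" and l: "\<And>k. k \<in> K \<Longrightarrow> linear (l k)" and g: "linear g"
    and impl: "\<And>v. (\<And>k. k \<in> K \<Longrightarrow> l k v \<le> 0) \<Longrightarrow> g v \<le> 0"
  obtains \<kappa> where "\<And>k. k \<in> K \<Longrightarrow> \<kappa> k \<ge> 0" "\<And>v. g v = (\<Sum>k\<in>K. \<kappa> k * l k v)"
proof -
  \<comment> \<open>the vector that represents a linear functional\<close>
  define rep :: "('a \<Rightarrow> real) \<Rightarrow> 'a" where "rep h = (\<Sum>b\<in>Basis. h b *\<^sub>R b)" for h
  have rep: "h v = rep h \<bullet> v" if "linear h" for h v
  proof -
    have "h v = h (\<Sum>b\<in>Basis. (v \<bullet> b) *\<^sub>R b)" by (simp add: euclidean_representation)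
    also have "\<dots> = (\<Sum>b\<in>Basis. (v \<bullet> b) * h b)"
      using that by (simp add: linear_sum linear_cmul)
    also have "\<dots> = rep h \<bullet> v"
      by (simp add: rep_def inner_sum_left inner_commute[of v] mult.commute)
    finally show ?thesis .
  qed
  define C where "C = {\<Sum>k\<in>K. \<kappa> k *\<^sub>R rep (l k) | \<kappa>. \<forall>k\<in>K. \<kappa> k \<ge> 0}"
  have CI: "(\<Sum>k\<in>K. \<kappa> k *\<^sub>R rep (l k)) \<in> C" if "\<And>k. k \<in> K \<Longrightarrow> \<kappa> k \<ge> 0" for \<kappa>
    using that by (auto simp: C_def)
  define H where "H = convex_cone hull ((\<lambda>k. rep (l k)) ` K)"
  have "convex_cone C"
    unfolding convex_cone_iff
  proof (intro conjI ballI allI impI)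
    show "0 \<in> C" using CI[of "\<lambda>k. 0"] by simp
  next
    fix x y assume "x \<in> C" "y \<in> C"
    then obtain \<alpha> \<beta> where "x = (\<Sum>k\<in>K. \<alpha> k *\<^sub>R rep (l k))" "y = (\<Sum>k\<in>K. \<beta> k *\<^sub>R rep (l k))"
      "\<forall>k\<in>K. \<alpha> k \<ge> 0" "\<forall>k\<in>K. \<beta> k \<ge> 0" by (auto simp: C_def)
    then show "x + y \<in> C" using CI[of "\<lambda>k. \<alpha> k + \<beta> k"] by (simp add: sum.distrib scaleR_left_distrib)
  next
    fix x and r :: real assume "x \<in> C" "r \<ge> 0"
    then obtain \<alpha> where "x = (\<Sum>k\<in>K. \<alpha> k *\<^sub>R rep (l k))" "\<forall>k\<in>K. \<alpha> k \<ge> 0" by (auto simp: C_def)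
    then show "r *\<^sub>R x \<in> C" using CI[of "\<lambda>k. r * \<alpha> k"] \<open>r \<ge> 0\<close> by (simp add: scaleR_sum_right)
  qed
  moreover have "rep (l j) \<in> C" if "j \<in> K" for j
  proof -
    have "(\<Sum>k\<in>K. (if k = j then 1 else 0) *\<^sub>R rep (l k)) = rep (l j)"
      using fin that by (simp add: if_distrib[of "\<lambda>c. c *\<^sub>R _"] sum.delta cong: if_cong)
    then show ?thesis using CI[of "\<lambda>k. if k = j then 1 else 0"] by simp
  qed
  ultimately have HC: "H \<subseteq> C" unfolding H_def by (intro hull_minimal) auto
  have "closed H" unfolding H_def
    by (intro polyhedron_imp_closed polyhedron_convex_cone_hull finite_imageI fin)
  have cH: "convex_cone H" unfolding H_def by (rule convex_cone_convex_cone_hull)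
  have "rep g \<in> H"
  proof (rule ccontr)
    assume "rep g \<notin> H"
    moreover have "convex H" "closed H" using cH \<open>closed H\<close> by (auto simp: convex_cone_def)
    ultimately obtain a b where ab: "a \<bullet> rep g < b" "\<And>x. x \<in> H \<Longrightarrow> b < a \<bullet> x"
      using separating_hyperplane_closed_point[of H "rep g"] by blast
    have "b < 0" using ab(2)[of 0] convex_cone_contains_0[OF cH] by simp
    have pos: "a \<bullet> x \<ge> 0" if "x \<in> H" for x
    proof (rule ccontr)
      assume "\<not> a \<bullet> x \<ge> 0"
      then have neg: "a \<bullet> x < 0" by simp
      have "(b / (a \<bullet> x)) *\<^sub>R x \<in> H"
        using neg \<open>b < 0\<close> by (intro convex_cone_scaleR[OF cH _ that]) (simp add: divide_nonpos_neg)
      then have "b < a \<bullet> ((b / (a \<bullet> x)) *\<^sub>R x)" by (rule ab(2))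
      then show False using neg by simp
    qed
    have "g (- a) \<le> 0"
    proof (rule impl)
      fix k assume k: "k \<in> K"
      then have "rep (l k) \<in> H" unfolding H_def by (intro hull_inc) auto
      then show "l k (- a) \<le> 0" using pos[of "rep (l k)"] rep[OF l[OF k]] by (simp add: inner_commute)
    qed
    then show False using ab(1) \<open>b < 0\<close> rep[OF g, of "- a"] by (simp add: inner_commute)
  qed
  then obtain \<kappa> where \<kappa>: "\<forall>k\<in>K. \<kappa> k \<ge> 0" "rep g = (\<Sum>k\<in>K. \<kappa> k *\<^sub>R rep (l k))"
    using HC by (auto simp: C_def)
  show thesis
  proof (rule that)
    show "\<kappa> k \<ge> 0" if "k \<in> K" for k using \<kappa>(1) that by blast
    fix v
    have "g v = (\<Sum>k\<in>K. \<kappa> k * (rep (l k) \<bullet> v))" by (simp add: rep[OF g] \<kappa>(2) inner_sum_left)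
    also have "\<dots> = (\<Sum>k\<in>K. \<kappa> k * l k v)" by (intro sum.cong) (simp_all add: rep[OF l])
    finally show "g v = (\<Sum>k\<in>K. \<kappa> k * l k v)" .
  qed
qed

text \<open>
  In a direction that increases no active constraint one stays feasible for a short time, since the
  inactive constraints hold with room to spare; so \<open>f\<close> has a nonnegative slope there. Farkas' lemma
  for the active constraints turns this into multipliers.
\<close>

lemma kkt_linear_constraints:
  fixes l :: "'k \<Rightarrow> 'a::euclidean_space \<Rightarrow> real"
  assumes fin: "finite K" and l: "\<And>k. k \<in> K \<Longrightarrow> linear (l k)"
    and f: "(f has_derivative f') (at x0)"
    and x0: "\<And>k. k \<in> K \<Longrightarrow> l k x0 \<le> b k"
    and min: "\<And>x. (\<And>k. k \<in> K \<Longrightarrow> l k x \<le> b k) \<Longrightarrow> f x0 \<le> f x"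
  obtains \<kappa> where "\<And>k. k \<in> K \<Longrightarrow> \<kappa> k \<ge> 0" "\<And>k. k \<in> K \<Longrightarrow> \<kappa> k * (l k x0 - b k) = 0"
    "\<And>v. f' v + (\<Sum>k\<in>K. \<kappa> k * l k v) = 0"
proof -
  define A where "A = {k \<in> K. l k x0 = b k}"
  have f'lin: "linear f'" using f by (rule has_derivative_linear)
  have "- f' v \<le> 0" if v: "\<And>k. k \<in> A \<Longrightarrow> l k v \<le> 0" for v
  proof -
    have ev: "\<forall>\<^sub>F t in at_right 0. \<forall>k\<in>K. l k (x0 + t *\<^sub>R v) \<le> b k"
    proof (rule eventually_ball_finite[OF fin], rule ballI)
      fix k assume k: "k \<in> K"
      have eq: "l k (x0 + t *\<^sub>R v) = l k x0 + t * l k v" for t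
        using l[OF k] by (simp add: linear_add linear_cmul)
      show "\<forall>\<^sub>F t in at_right 0. l k (x0 + t *\<^sub>R v) \<le> b k"
      proof (cases "k \<in> A")
        case True
        then show ?thesis using v[OF True] eventually_at_right_less[of "0::real"]
          by (auto simp: eq A_def mult_nonneg_nonpos elim!: eventually_mono)
      next
        case False
        have "((\<lambda>t. l k x0 + t * l k v) \<longlongrightarrow> l k x0 + 0 * l k v) (at_right 0)"
          by (intro tendsto_intros)
        moreover have "l k x0 + 0 * l k v < b k" using x0[OF k] False k by (simp add: A_def)
        ultimately have "\<forall>\<^sub>F t in at_right 0. l k x0 + t * l k v < b k" by (rule order_tendstoD(2))
        then show ?thesis by (auto simp: eq elim: eventually_mono)
      qed
    qed
    have "((\<lambda>t. x0 + t *\<^sub>R v) has_derivative (\<lambda>t. t *\<^sub>R v)) (at 0)"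
      by (auto intro!: derivative_eq_intros)
    from diff_chain_at[OF this, of f f'] f
    have "((\<lambda>t. f (x0 + t *\<^sub>R v)) has_derivative (\<lambda>t. t * f' v)) (at 0)"
      by (simp add: o_def linear_cmul[OF f'lin])
    then have "((\<lambda>t. f (x0 + t *\<^sub>R v)) has_real_derivative f' v) (at 0)"
      by (simp add: has_field_derivative_def mult_commute_abs)
    then have "((\<lambda>t. (f (x0 + t *\<^sub>R v) - f x0) / t) \<longlongrightarrow> f' v) (at_right 0)"
      by (auto simp: has_field_derivative_iff intro: tendsto_mono[OF at_le])
    moreover have "\<forall>\<^sub>F t in at_right 0. 0 \<le> (f (x0 + t *\<^sub>R v) - f x0) / t"
      using ev eventually_at_right_less[of "0::real"]
      by eventually_elim (use min in auto)
    ultimately have "0 \<le> f' v" by (rule tendsto_lowerbound) simp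
    then show ?thesis by simp
  qed
  moreover have "finite A" "linear (\<lambda>v. - f' v)" using fin f'lin by (auto simp: A_def linear_compose_neg)
  moreover have "\<And>k. k \<in> A \<Longrightarrow> linear (l k)" using l by (simp add: A_def)
  ultimately obtain \<kappa> where \<kappa>: "\<And>k. k \<in> A \<Longrightarrow> \<kappa> k \<ge> 0" "\<And>v. - f' v = (\<Sum>k\<in>A. \<kappa> k * l k v)"
    using farkas_linear[of A l "\<lambda>v. - f' v"] by blast
  show thesis
  proof (rule that[of "\<lambda>k. if k \<in> A then \<kappa> k else 0"])
    fix v
    have "(\<Sum>k\<in>K. (if k \<in> A then \<kappa> k else 0) * l k v) = (\<Sum>k\<in>A. \<kappa> k * l k v)"
      by (rule sum.mono_neutral_cong_right) (use fin in \<open>auto simp: A_def\<close>)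
    then show "f' v + (\<Sum>k\<in>K. (if k \<in> A then \<kappa> k else 0) * l k v) = 0" using \<kappa>(2)[of v] by simp
  qed (use \<kappa>(1) in \<open>auto simp: A_def\<close>)
qed

section \<open>Optimality conditions of the load control problem\<close>

lemma net_outflow_diff:
  "net_outflow S (\<lambda>i j. F i j - G i j) i = net_outflow S F i - net_outflow S G i"
  by (simp add: net_outflow_def sum_subtractf)

lemma net_outflow_cong:
  "(\<And>i j. (i, j) \<in> S \<Longrightarrow> F i j = G i j) \<Longrightarrow> net_outflow S F i = net_outflow S G i"
  by (auto simp: net_outflow_def intro!: arg_cong2[where f = "(-)"] sum.cong)

text \<open>
  Summation by parts on the graph: the net outflow is adjoint to the difference along lines. All
  cancellations between bus and line quantities come from this identity.
\<close>

lemma sum_net_outflow: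
  fixes \<phi> :: "'n::finite \<Rightarrow> real"
  shows "(\<Sum>i\<in>UNIV. \<phi> i * net_outflow S F i) = (\<Sum>(i, j)\<in>S. F i j * (\<phi> i - \<phi> j))"
proof -
  have out: "net_outflow S F i =
      (\<Sum>j\<in>UNIV. if (i, j) \<in> S then F i j else 0) - (\<Sum>k\<in>UNIV. if (k, i) \<in> S then F k i else 0)" for i
    unfolding net_outflow_def by (simp add: sum.If_cases)
  have "(\<Sum>i\<in>UNIV. \<phi> i * net_outflow S F i) =
      (\<Sum>i\<in>UNIV. \<Sum>j\<in>UNIV. \<phi> i * (if (i, j) \<in> S then F i j else 0)) -
      (\<Sum>i\<in>UNIV. \<Sum>k\<in>UNIV. \<phi> i * (if (k, i) \<in> S then F k i else 0))"
    by (simp add: out right_diff_distrib sum_subtractf sum_distrib_left)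
  also have "(\<Sum>i\<in>UNIV. \<Sum>k\<in>UNIV. \<phi> i * (if (k, i) \<in> S then F k i else 0)) =
      (\<Sum>k\<in>UNIV. \<Sum>i\<in>UNIV. \<phi> i * (if (k, i) \<in> S then F k i else 0))"
    by (rule sum.swap)
  also have "(\<Sum>i\<in>UNIV. \<Sum>j\<in>UNIV. \<phi> i * (if (i, j) \<in> S then F i j else 0)) - \<dots> =
      (\<Sum>i\<in>UNIV. \<Sum>j\<in>UNIV. if (i, j) \<in> S then F i j * (\<phi> i - \<phi> j) else 0)"
    unfolding sum_subtractf[symmetric] by (intro sum.cong refl) (simp add: algebra_simps)
  also have "\<dots> = (\<Sum>p\<in>UNIV. if p \<in> S then F (fst p) (snd p) * (\<phi> (fst p) - \<phi> (snd p)) else 0)"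
    by (simp add: sum.cartesian_product case_prod_unfold flip: UNIV_Times_UNIV)
  also have "\<dots> = (\<Sum>(i, j)\<in>S. F i j * (\<phi> i - \<phi> j))"
    by (simp add: sum.If_cases case_prod_unfold)
  finally show ?thesis .
qed

lemma dc_flow_diff: "dc_flow N (\<lambda>i. \<theta> i - \<phi> i) i j = dc_flow N \<theta> i j - dc_flow N \<phi> i j"
  by (simp add: dc_flow_def algebra_simps)

lemma net_outflow_dc_flow_diff:
  "net_outflow S (dc_flow N (\<lambda>i. \<theta> i - \<phi> i)) i = net_outflow S (dc_flow N \<theta>) i - net_outflow S (dc_flow N \<phi>) i"
  by (simp add: net_outflow_def dc_flow_diff sum_subtractf)

text \<open>
  The quantity whose net outflow drives the virtual phase angles: minus the gradient of the Lagrangian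
  in \<open>\<psi>\<close> is the net outflow of the prices.
\<close>

definition line_price :: "'n power_network \<Rightarrow> 'n alc_gains \<Rightarrow> 'n alc_state \<Rightarrow> 'n \<Rightarrow> 'n \<Rightarrow> real" where
  "line_price N e s i j =
     (alc_mu N e s i - alc_mu N e s j - st_sigma_hi s i j + st_sigma_lo s i j) * suscept N i j"

lemma rhs_psi_eq: "rhs_psi N e s i = eps_psi e i * net_outflow (inner_lines N) (line_price N e s) i"
proof -
  have "(\<Sum>k | (k, i) \<in> inner_lines N.
      (alc_mu N e s i - alc_mu N e s k + st_sigma_hi s k i - st_sigma_lo s k i) * suscept N k i)
    = - (\<Sum>k | (k, i) \<in> inner_lines N. line_price N e s k i)"
    unfolding sum_negf[symmetric] by (intro sum.cong refl) (simp add: line_price_def algebra_simps)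
  then show ?thesis by (simp add: rhs_psi_def net_outflow_def line_price_def)
qed

text \<open>
  The Karush-Kuhn-Tucker conditions of the reformulated problem, with \<open>alc_mu\<close> as the multiplier of the
  balance of virtual flows. The multiplier of the physical balance is \<open>\<omega>\<close> by stationarity in \<open>\<omega>\<close>;
  stationarity in \<open>P\<close> makes it the same at all buses, and adding up the two balances over all buses
  shows that it vanishes. Hence \<open>\<omega> = 0\<close>, and the physical balance appears without damping.
\<close>

definition kkt_point ::
    "'n::finite power_network \<Rightarrow> 'n alc_gains \<Rightarrow> ('n \<Rightarrow> real \<Rightarrow> real) \<Rightarrow> 'n alc_state \<Rightarrow> bool" where
  "kkt_point N e c s \<longleftrightarrow>
     (\<forall>i. st_omega s i = 0 \<and>
          deriv (c i) (st_d s i) = alc_mu N e s i - st_gamma_hi s i + st_gamma_lo s i \<and>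
          st_d s i = injection N i - net_outflow (lines N) (st_P s) i \<and>
          st_d s i = injection N i - net_outflow (inner_lines N) (dc_flow N (st_psi s)) i \<and>
          net_outflow (inner_lines N) (line_price N e s) i = 0 \<and>
          load_min N i \<le> st_d s i \<and> st_d s i \<le> load_max N i \<and>
          st_gamma_hi s i \<ge> 0 \<and> st_gamma_hi s i * (load_max N i - st_d s i) = 0 \<and>
          st_gamma_lo s i \<ge> 0 \<and> st_gamma_lo s i * (st_d s i - load_min N i) = 0) \<and>
     (\<forall>(i, j)\<in>inner_lines N.
          flow_min N i j \<le> dc_flow N (st_psi s) i j \<and> dc_flow N (st_psi s) i j \<le> flow_max N i j \<and>
          st_sigma_hi s i j \<ge> 0 \<and>
          st_sigma_hi s i j * (flow_max N i j - dc_flow N (st_psi s) i j) = 0 \<and>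
          st_sigma_lo s i j \<ge> 0 \<and>
          st_sigma_lo s i j * (dc_flow N (st_psi s) i j - flow_min N i j) = 0)"

lemma kkt_pointD:
  assumes "kkt_point N e c s"
  shows "st_omega s i = 0"
    and "deriv (c i) (st_d s i) = alc_mu N e s i - st_gamma_hi s i + st_gamma_lo s i"
    and "st_d s i = injection N i - net_outflow (lines N) (st_P s) i"
    and "st_d s i = injection N i - net_outflow (inner_lines N) (dc_flow N (st_psi s)) i"
    and "net_outflow (inner_lines N) (line_price N e s) i = 0"
    and "load_min N i \<le> st_d s i" and "st_d s i \<le> load_max N i"
    and "st_gamma_hi s i \<ge> 0" and "st_gamma_hi s i * (load_max N i - st_d s i) = 0"
    and "st_gamma_lo s i \<ge> 0" and "st_gamma_lo s i * (st_d s i - load_min N i) = 0"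
  using assms unfolding kkt_point_def by blast+

lemma kkt_point_lineD:
  assumes "kkt_point N e c s" "(i, j) \<in> inner_lines N"
  shows "flow_min N i j \<le> dc_flow N (st_psi s) i j" and "dc_flow N (st_psi s) i j \<le> flow_max N i j"
    and "st_sigma_hi s i j \<ge> 0"
    and "st_sigma_hi s i j * (flow_max N i j - dc_flow N (st_psi s) i j) = 0"
    and "st_sigma_lo s i j \<ge> 0"
    and "st_sigma_lo s i j * (dc_flow N (st_psi s) i j - flow_min N i j) = 0"
  using assms unfolding kkt_point_def by blast+

text \<open>
  Bound the cost from below by its tangent at \<open>s\<close>. The slope in \<open>d\<close> is the marginal cost, which splits
  into multipliers; summation by parts and stationarity in \<open>\<psi>\<close> convert the part of \<open>alc_mu\<close> into line
  multipliers, and complementary slackness makes every remaining term nonnegative on the feasible set.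
\<close>

lemma kkt_point_imp_rolc_optimal:
  fixes N :: "'n::finite power_network"
  assumes kkt: "kkt_point N e c s" and D: "\<And>i. damping N i > 0"
    and c: "\<And>i. strictly_convex_on UNIV (c i)" "\<And>i. c i C1_differentiable_on UNIV"
  shows "rolc_optimal N c (st_d s, st_omega s, st_P s, st_psi s)"
proof -
  let ?E = "inner_lines N"
  have feas: "rolc_feasible_point N (st_d s, st_omega s, st_P s, st_psi s)"
    using kkt unfolding kkt_point_def rolc_feasible_point_def by fastforce
  have "rolc_cost N c (st_d s, st_omega s, st_P s, st_psi s) \<le> rolc_cost N c (d, \<omega>, P, \<psi>)"
    if p: "rolc_feasible_point N (d, \<omega>, P, \<psi>)" for d \<omega> P \<psi>
  proof -
    define \<Delta> where "\<Delta> = (\<lambda>i. \<psi> i - st_psi s i)"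
    have tangent: "c i (st_d s i) + deriv (c i) (st_d s i) * (d i - st_d s i) \<le> c i (d i)" for i
      using strictly_convex_tangent[OF c(1) C1_differentiable_on_UNIV_real(1)[OF c(2)], of "st_d s i" "d i"]
      by (cases "st_d s i = d i") (auto simp: less_imp_le)
    have pbus: "load_min N i \<le> d i" "d i \<le> load_max N i"
      "d i = injection N i - net_outflow ?E (dc_flow N \<psi>) i" for i
      using p unfolding rolc_feasible_point_def prod.case by blast+
    have pline: "flow_min N i j \<le> dc_flow N \<psi> i j" "dc_flow N \<psi> i j \<le> flow_max N i j"
      if "(i, j) \<in> ?E" for i j
      using p that unfolding rolc_feasible_point_def prod.case by blast+
    have bus: "- alc_mu N e s i * net_outflow ?E (dc_flow N \<Delta>) i \<le> c i (d i) - c i (st_d s i)" for i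
    proof -
      have "d i - st_d s i = - net_outflow ?E (dc_flow N \<Delta>) i"
        using pbus(3)[of i] kkt_pointD(4)[OF kkt, of i] by (simp add: \<Delta>_def net_outflow_dc_flow_diff)
      moreover have "0 \<le> st_gamma_hi s i * (load_max N i - d i)" "0 \<le> st_gamma_lo s i * (d i - load_min N i)"
        using pbus(1,2)[of i] kkt_pointD(8,10)[OF kkt, of i] by auto
      moreover have "deriv (c i) (st_d s i) * (d i - st_d s i) = alc_mu N e s i * (d i - st_d s i)
          + st_gamma_hi s i * (load_max N i - d i) + st_gamma_lo s i * (d i - load_min N i)"
        using kkt_pointD(2,9,11)[OF kkt, of i] by algebra
      ultimately show ?thesis using tangent[of i] by simp
    qed
    have "0 \<le> (\<Sum>(i, j)\<in>?E. st_sigma_hi s i j * (flow_max N i j - dc_flow N \<psi> i j)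
                          + st_sigma_lo s i j * (dc_flow N \<psi> i j - flow_min N i j))"
      using pline kkt_point_lineD(3,5)[OF kkt] by (intro sum_nonneg) auto
    also have "\<dots> = (\<Sum>(i, j)\<in>?E. line_price N e s i j * (\<Delta> i - \<Delta> j)
                   - dc_flow N \<Delta> i j * (alc_mu N e s i - alc_mu N e s j))"
    proof (intro sum.cong refl, clarify)
      fix i j assume "(i, j) \<in> ?E"
      then have "st_sigma_hi s i j * (flow_max N i j - dc_flow N (st_psi s) i j) = 0"
          "st_sigma_lo s i j * (dc_flow N (st_psi s) i j - flow_min N i j) = 0"
        by (auto dest: kkt_point_lineD[OF kkt])
      moreover have "dc_flow N \<psi> i j = dc_flow N (st_psi s) i j + suscept N i j * (\<Delta> i - \<Delta> j)"
        by (simp add: \<Delta>_def dc_flow_def algebra_simps)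
      ultimately show "st_sigma_hi s i j * (flow_max N i j - dc_flow N \<psi> i j)
          + st_sigma_lo s i j * (dc_flow N \<psi> i j - flow_min N i j) =
          line_price N e s i j * (\<Delta> i - \<Delta> j) - dc_flow N \<Delta> i j * (alc_mu N e s i - alc_mu N e s j)"
        unfolding line_price_def dc_flow_def[of N \<Delta>] by algebra
    qed
    also have "\<dots> = (\<Sum>i\<in>UNIV. \<Delta> i * net_outflow ?E (line_price N e s) i)
                   + (\<Sum>i\<in>UNIV. - alc_mu N e s i * net_outflow ?E (dc_flow N \<Delta>) i)"
      using sum_net_outflow[of \<Delta> ?E "line_price N e s"] sum_net_outflow[of "alc_mu N e s" ?E "dc_flow N \<Delta>"]
      by (simp add: case_prod_unfold sum_subtractf sum_negf)
    also have "(\<Sum>i\<in>UNIV. \<Delta> i * net_outflow ?E (line_price N e s) i) = 0"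
      using kkt unfolding kkt_point_def by simp
    also have "0 + (\<Sum>i\<in>UNIV. - alc_mu N e s i * net_outflow ?E (dc_flow N \<Delta>) i)
        \<le> (\<Sum>i\<in>UNIV. c i (d i) - c i (st_d s i))"
      unfolding add_0 by (intro sum_mono bus)
    finally have "(\<Sum>i\<in>UNIV. c i (st_d s i)) \<le> (\<Sum>i\<in>UNIV. c i (d i))" by (simp add: sum_subtractf)
    moreover have "(\<Sum>i\<in>UNIV. 1 / 2 * damping N i * (\<omega> i)\<^sup>2) \<ge> 0"
      using D by (intro sum_nonneg mult_nonneg_nonneg) (auto simp: less_imp_le)
    moreover have "st_omega s i = 0" for i using kkt unfolding kkt_point_def by simp
    ultimately show ?thesis by (simp add: rolc_cost_def)
  qed
  with feas show ?thesis by (auto simp: rolc_optimal_def is_arg_min_linorder)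
qed

text \<open>
  The phase angles are not confined to a bounded set, but the load and the cost depend only on the flows
  along inner lines. These range over a subspace intersected with a box, which is compact.
\<close>

lemma olc_minimizer_exists:
  fixes N :: "'n::finite power_network" and c :: "'n \<Rightarrow> real \<Rightarrow> real"
  assumes feas: "olc_feasible N" and c: "\<And>i. continuous_on UNIV (c i)"
  obtains d \<theta> where "olc_feasible_point N (d, \<theta>)"
    "\<And>d' \<theta>'. olc_feasible_point N (d', \<theta>') \<Longrightarrow> (\<Sum>i\<in>UNIV. c i (d i)) \<le> (\<Sum>i\<in>UNIV. c i (d' i))"
proof -
  let ?E = "inner_lines N"
  \<comment> \<open>the inner flows caused by phase angles, set to zero off the inner lines to bound all entries\<close>
  define T :: "real^'n \<Rightarrow> real^('n \<times> 'n)" where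
    "T v = (\<chi> p. if p \<in> ?E then dc_flow N (($) v) (fst p) (snd p) else 0)" for v
  define load :: "real^('n \<times> 'n) \<Rightarrow> 'n \<Rightarrow> real" where
    "load f i = injection N i - net_outflow ?E (\<lambda>i j. f $ (i, j)) i" for f i
  have load_cont: "continuous_on S (\<lambda>f. load f i)" for S i
    unfolding load_def net_outflow_def by (intro continuous_intros)
  have load_T: "load (T v) i = injection N i - net_outflow ?E (dc_flow N (($) v)) i" for v i
    unfolding load_def by (subst net_outflow_cong[of ?E _ "dc_flow N (($) v)"]) (auto simp: T_def)
  have lin: "linear T"
    by (rule linearI) (auto simp: T_def vec_eq_iff dc_flow_def algebra_simps)
  have closed_range: "closed (range T)"
    by (rule closed_subspace) (rule linear_subspace_image[OF lin subspace_UNIV])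
  define X where "X = range T
      \<inter> cbox (\<chi> p. if p \<in> ?E then flow_min N (fst p) (snd p) else 0)
             (\<chi> p. if p \<in> ?E then flow_max N (fst p) (snd p) else 0)
      \<inter> (\<Inter>i. {f. load_min N i \<le> load f i \<and> load f i \<le> load_max N i})"
  have "closed {f. load_min N i \<le> load f i \<and> load f i \<le> load_max N i}" for i
    using load_cont[of UNIV i] by (intro closed_Collect_conj closed_Collect_le continuous_intros)
  then have "compact X"
    unfolding X_def by (intro compact_Int_closed closed_Int_compact closed_range compact_cbox closed_INT) auto
  have T_in_X: "T (\<chi> i. \<theta> i) \<in> X" "\<And>i. load (T (\<chi> i. \<theta> i)) i = d i"
    if "olc_feasible_point N (d, \<theta>)" for d \<theta>
  proof -
    have eq: "($) (\<chi> i. \<theta> i) = \<theta>" by auto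
    show d: "load (T (\<chi> i. \<theta> i)) i = d i" for i
      using that unfolding load_T eq olc_feasible_point_def by auto
    show "T (\<chi> i. \<theta> i) \<in> X"
      unfolding X_def
    proof (intro IntI INT_I CollectI)
      show "T (\<chi> i. \<theta> i) \<in> cbox (\<chi> p. if p \<in> ?E then flow_min N (fst p) (snd p) else 0)
             (\<chi> p. if p \<in> ?E then flow_max N (fst p) (snd p) else 0)"
        using that by (auto simp: olc_feasible_point_def mem_box_cart T_def dc_flow_def)
      show "load_min N i \<le> load (T (\<chi> i. \<theta> i)) i \<and> load (T (\<chi> i. \<theta> i)) i \<le> load_max N i" for i
        unfolding d using that unfolding olc_feasible_point_def prod.case by blast
    qed simp
  qed
  have nonempty: "X \<noteq> {}" using feas T_in_X(1) unfolding olc_feasible_def by auto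
  have cost_cont: "continuous_on X (\<lambda>f. \<Sum>i\<in>UNIV. c i (load f i))"
  proof (rule continuous_on_sum)
    fix i
    show "continuous_on X (\<lambda>f. c i (load f i))"
      by (rule continuous_on_compose2[OF c load_cont]) simp
  qed
  have "\<exists>f\<in>X. \<forall>g\<in>X. (\<Sum>i\<in>UNIV. c i (load f i)) \<le> (\<Sum>i\<in>UNIV. c i (load g i))"
    by (rule continuous_attains_inf[OF \<open>compact X\<close> nonempty cost_cont])
  then obtain f where f: "f \<in> X"
    "\<And>g. g \<in> X \<Longrightarrow> (\<Sum>i\<in>UNIV. c i (load f i)) \<le> (\<Sum>i\<in>UNIV. c i (load g i))"
    by (elim bexE) (rule that, assumption, drule bspec, assumption+)
  from f(1) obtain v where v: "f = T v" by (auto simp: X_def)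
  show thesis
  proof (rule that)
    have "flow_min N i j \<le> dc_flow N (($) v) i j \<and> dc_flow N (($) v) i j \<le> flow_max N i j"
      if ij: "(i, j) \<in> ?E" for i j
    proof -
      have "T v \<in> cbox (\<chi> p. if p \<in> ?E then flow_min N (fst p) (snd p) else 0)
             (\<chi> p. if p \<in> ?E then flow_max N (fst p) (snd p) else 0)"
        using f(1) unfolding X_def v by (elim IntE)
      note this[unfolded mem_box_cart, rule_format, of "(i, j)"]
      then show ?thesis using ij by (simp add: T_def)
    qed
    moreover have "load_min N i \<le> load f i \<and> load f i \<le> load_max N i" for i
      using f(1) by (simp add: X_def)
    ultimately show "olc_feasible_point N (load f, ($) v)"
      unfolding olc_feasible_point_def by (auto simp: v load_T)
  next
    fix d' \<theta>' assume p: "olc_feasible_point N (d', \<theta>')"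
    show "(\<Sum>i\<in>UNIV. c i (load f i)) \<le> (\<Sum>i\<in>UNIV. c i (d' i))"
      using f(2)[OF T_in_X(1)[OF p]] by (simp add: T_in_X(2)[OF p])
  qed
qed

lemma net_outflow_dc_flow_eq_sum:
  "net_outflow S (dc_flow N (($) (v :: real^'n::finite))) i =
     (\<Sum>j | (i, j) \<in> S. suscept N i j * (v $ i - v $ j)) - (\<Sum>k | (k, i) \<in> S. suscept N k i * (v $ k - v $ i))"
  by (simp add: net_outflow_def dc_flow_def)

text \<open>
  At a minimizer of the load control problem, seen as a problem in the phase angles alone, the
  multipliers of the load and line limits give \<open>\<gamma>\<close> and \<open>\<sigma>\<close>. Then \<open>\<mu>\<close> is determined by stationarity in
  the load. The flows \<open>P\<close> are taken equal to the virtual flows on inner lines and zero elsewhere, so that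
  both balances coincide.
\<close>

lemma kkt_point_exists:
  fixes N :: "'n::finite power_network"
  assumes feas: "olc_feasible N" and e: "valid_gains N e"
    and c: "\<And>i. c i C1_differentiable_on UNIV"
  obtains s where "kkt_point N e c s"
proof -
  let ?E = "inner_lines N"
  note dc = C1_differentiable_on_UNIV_real[OF c]
  have "continuous_on UNIV (c i)" for i
    using dc(1) by (intro continuous_at_imp_continuous_on) (auto intro: DERIV_isCont)
  then obtain d \<theta> where feas0: "olc_feasible_point N (d, \<theta>)"
    and min: "\<And>d' \<theta>'. olc_feasible_point N (d', \<theta>') \<Longrightarrow> (\<Sum>i\<in>UNIV. c i (d i)) \<le> (\<Sum>i\<in>UNIV. c i (d' i))"
    using olc_minimizer_exists[OF feas] by blast
  define A where "A i v = net_outflow ?E (dc_flow N (($) v)) i" for i and v :: "real^'n"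
  define fl where "fl p v = dc_flow N (($) v) (fst p) (snd p)" for p and v :: "real^'n"
  define x0 :: "real^'n" where "x0 = (\<chi> i. \<theta> i)"
  have x0: "($) x0 = \<theta>" by (auto simp: x0_def)
  have d: "d i = injection N i - A i x0" for i
    using feas0 by (auto simp: olc_feasible_point_def A_def x0)
  have Alin: "linear (A i)" for i
    by (rule linearI) (simp_all add: A_def net_outflow_dc_flow_eq_sum algebra_simps sum.distrib sum_subtractf sum_distrib_left)
  have fllin: "linear (fl p)" for p
    by (rule linearI) (simp_all add: fl_def dc_flow_def algebra_simps)
  define l where "l = case_sum (case_sum (\<lambda>i v. - A i v) A) (case_sum fl (\<lambda>p v. - fl p v))"
  define b where "b = case_sum (case_sum (\<lambda>i. load_max N i - injection N i) (\<lambda>i. injection N i - load_min N i))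
      (case_sum (\<lambda>p. flow_max N (fst p) (snd p)) (\<lambda>p. - flow_min N (fst p) (snd p)))"
  define K where "K = ((UNIV :: 'n set) <+> (UNIV :: 'n set)) <+> (?E <+> ?E)"
  have K_mem: "Inl (Inl i) \<in> K" "Inl (Inr i) \<in> K"
      "p \<in> ?E \<Longrightarrow> Inr (Inl p) \<in> K" "p \<in> ?E \<Longrightarrow> Inr (Inr p) \<in> K" for i p
    by (auto simp: K_def)
  have K_iff: "(\<forall>k\<in>K. l k v \<le> b k) \<longleftrightarrow> olc_feasible_point N (\<lambda>i. injection N i - A i v, ($) v)" for v
    unfolding K_def Plus_def l_def b_def olc_feasible_point_def
    by (auto simp: A_def fl_def ball_Un algebra_simps)
  define f where "f v = (\<Sum>i\<in>UNIV. c i (injection N i - A i v))" for v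
  define f' where "f' v = (\<Sum>i\<in>UNIV. deriv (c i) (d i) * (- A i v))" for v
  have "(f has_derivative f') (at x0)"
    unfolding f_def f'_def
  proof (rule has_derivative_sum)
    fix i
    have "((\<lambda>v. injection N i - A i v) has_derivative (\<lambda>v. - A i v)) (at x0)"
      using linear_imp_has_derivative[OF Alin[of i]] by (auto intro!: derivative_eq_intros)
    moreover have "(c i has_derivative (\<lambda>h. deriv (c i) (d i) * h)) (at (injection N i - A i x0))"
      using dc(1)[of i "d i"] by (simp add: has_field_derivative_def d)
    ultimately show "((\<lambda>v. c i (injection N i - A i v)) has_derivative (\<lambda>v. deriv (c i) (d i) * (- A i v))) (at x0)"
      by (rule diff_chain_at[unfolded o_def])
  qed
  moreover have "finite K" by (simp add: K_def)
  moreover have "linear (l k)" for k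
    using Alin fllin by (auto simp: l_def linear_compose_neg split: sum.split)
  moreover have "l k x0 \<le> b k" if "k \<in> K" for k
    using K_iff[of x0] feas0 that by (simp add: x0 d[symmetric])
  moreover have "f x0 \<le> f v" if "\<And>k. k \<in> K \<Longrightarrow> l k v \<le> b k" for v
    using min K_iff[of v] that by (auto simp: f_def d[symmetric])
  ultimately obtain \<kappa> where \<kappa>: "\<And>k. k \<in> K \<Longrightarrow> \<kappa> k \<ge> 0" "\<And>k. k \<in> K \<Longrightarrow> \<kappa> k * (l k x0 - b k) = 0"
    "\<And>v. f' v + (\<Sum>k\<in>K. \<kappa> k * l k v) = 0"
    using kkt_linear_constraints[of K l f f' x0 b] by blast
  define ghi where "ghi i = \<kappa> (Inl (Inl i))" for i
  define glo where "glo i = \<kappa> (Inl (Inr i))" for i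
  define shi where "shi i j = \<kappa> (Inr (Inl (i, j)))" for i j
  define slo where "slo i j = \<kappa> (Inr (Inr (i, j)))" for i j
  define \<mu> where "\<mu> i = deriv (c i) (d i) + ghi i - glo i" for i
  define s :: "'n alc_state" where "s = \<lparr>st_d = d, st_omega = (\<lambda>i. 0),
     st_P = (\<lambda>i j. if (i, j) \<in> ?E then dc_flow N \<theta> i j else 0), st_psi = \<theta>,
     st_gamma_hi = ghi, st_gamma_lo = glo, st_r = (\<lambda>i. gain_K e i / eps_mu e i * \<mu> i),
     st_sigma_hi = shi, st_sigma_lo = slo\<rparr>"
  have gains: "gain_K e i > 0" "eps_mu e i > 0" for i using e by (auto simp: valid_gains_def)
  have mu: "alc_mu N e s i = \<mu> i" for i
    using gains[of i] by (simp add: alc_mu_def s_def)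
  have sigma: "st_sigma_hi s = shi" "st_sigma_lo s = slo" by (simp_all add: s_def)
  \<comment> \<open>stationarity in the phase angles, tested against \<open>v\<close>; unit vectors give the condition at each bus\<close>
  have stat: "(\<Sum>i\<in>UNIV. v $ i * net_outflow ?E (line_price N e s) i) = 0" for v
  proof -
    have "(\<Sum>k\<in>K. \<kappa> k * l k v) =
        ((\<Sum>i\<in>UNIV. ghi i * - A i v) + (\<Sum>i\<in>UNIV. glo i * A i v))
        + ((\<Sum>(i, j)\<in>?E. shi i j * fl (i, j) v) + (\<Sum>(i, j)\<in>?E. slo i j * - fl (i, j) v))"
      unfolding K_def
      by (simp add: sum.Plus l_def o_def ghi_def glo_def shi_def slo_def case_prod_unfold del: UNIV_Plus_UNIV)
    then have "0 = (\<Sum>i\<in>UNIV. \<mu> i * - A i v) + (\<Sum>(i, j)\<in>?E. (shi i j - slo i j) * fl (i, j) v)"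
      using \<kappa>(3)[of v] by (simp add: f'_def \<mu>_def algebra_simps sum.distrib sum_subtractf sum_negf case_prod_unfold)
    also have "(\<Sum>i\<in>UNIV. \<mu> i * - A i v) = - (\<Sum>(i, j)\<in>?E. dc_flow N (($) v) i j * (\<mu> i - \<mu> j))"
      using sum_net_outflow[of \<mu> ?E "dc_flow N (($) v)"] by (simp add: A_def sum_negf)
    also have "\<dots> + (\<Sum>(i, j)\<in>?E. (shi i j - slo i j) * fl (i, j) v)
        = - (\<Sum>(i, j)\<in>?E. line_price N e s i j * (v $ i - v $ j))"
      unfolding sum_negf[symmetric] sum.distrib[symmetric]
      by (intro sum.cong refl)
        (simp add: case_prod_unfold line_price_def mu sigma fl_def dc_flow_def algebra_simps)
    finally show ?thesis using sum_net_outflow[of "($) v" ?E "line_price N e s"] by simp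
  qed
  have price: "net_outflow ?E (line_price N e s) i = 0" for i
    using stat[of "axis i 1"] by (simp add: axis_def if_distrib[of "\<lambda>x. x * _"] cong: if_cong)
  have inner_sub: "?E \<subseteq> lines N" by (auto simp: inner_lines_def)
  have outP: "net_outflow (lines N) (st_P s) i = net_outflow ?E (dc_flow N \<theta>) i" for i
    unfolding net_outflow_def
    by (intro arg_cong2[where f = "(-)"] sum.mono_neutral_cong_right) (use inner_sub in \<open>auto simp: s_def\<close>)
  have multipliers: "ghi i \<ge> 0" "glo i \<ge> 0" "ghi i * (load_max N i - d i) = 0" "glo i * (d i - load_min N i) = 0" for i
    using \<kappa>(1,2)[of "Inl (Inl i)"] \<kappa>(1,2)[of "Inl (Inr i)"]
    by (auto simp: K_mem ghi_def glo_def l_def b_def d algebra_simps)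
  have multipliers': "shi i j \<ge> 0" "slo i j \<ge> 0" "shi i j * (flow_max N i j - dc_flow N \<theta> i j) = 0"
    "slo i j * (dc_flow N \<theta> i j - flow_min N i j) = 0" if "(i, j) \<in> ?E" for i j
    using \<kappa>(1,2)[of "Inr (Inl (i, j))"] \<kappa>(1,2)[of "Inr (Inr (i, j))"] that
    by (auto simp: K_mem shi_def slo_def l_def b_def fl_def x0 algebra_simps)
  have bus: "d i = injection N i - net_outflow ?E (dc_flow N \<theta>) i" "load_min N i \<le> d i" "d i \<le> load_max N i" for i
    using feas0 unfolding olc_feasible_point_def prod.case by blast+
  have line: "flow_min N i j \<le> dc_flow N \<theta> i j" "dc_flow N \<theta> i j \<le> flow_max N i j" if "(i, j) \<in> ?E" for i j
    using feas0 that unfolding olc_feasible_point_def prod.case by blast+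
  have sel: "st_d s = d" "st_omega s i = 0" "st_psi s = \<theta>" "st_gamma_hi s = ghi" "st_gamma_lo s = glo" for i
    by (simp_all add: s_def)
  have "deriv (c i) (d i) = \<mu> i - ghi i + glo i" for i by (simp add: \<mu>_def)
  then have "kkt_point N e c s"
    unfolding kkt_point_def sel sigma mu price outP
    using bus line multipliers multipliers' by blast
  then show thesis by (rule that)
qed

lemma bounded_signal_net_outflow:
  "(\<And>i j. (i, j) \<in> S \<Longrightarrow> bounded_signal (\<lambda>t. F t i j)) \<Longrightarrow> bounded_signal (\<lambda>t. net_outflow S (F t) i)"
  unfolding net_outflow_def by (intro bounded_signal_diff bounded_signal_sum) auto

lemma uniformly_continuous_on_net_outflow:
  fixes X :: "real set"
  shows "(\<And>i j. (i, j) \<in> S \<Longrightarrow> uniformly_continuous_on X (\<lambda>t. F t i j)) \<Longrightarrow>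
     uniformly_continuous_on X (\<lambda>t. net_outflow S (F t) i)"
  unfolding net_outflow_def by (intro uniformly_continuous_on_diff uniformly_continuous_on_sum) auto

lemma slowly_varying_net_outflow:
  "(\<And>i j. (i, j) \<in> S \<Longrightarrow> slowly_varying (\<lambda>t. F t i j)) \<Longrightarrow> slowly_varying (\<lambda>t. net_outflow S (F t) i)"
  unfolding net_outflow_def by (intro slowly_varying_diff slowly_varying_sum) auto

lemma tendsto_net_outflow:
  "(\<And>i j. (i, j) \<in> S \<Longrightarrow> ((\<lambda>t. F t i j) \<longlongrightarrow> G i j) X) \<Longrightarrow>
     ((\<lambda>t. net_outflow S (F t) i) \<longlongrightarrow> net_outflow S G i) X"
  unfolding net_outflow_def by (intro tendsto_diff tendsto_sum) auto

section \<open>Energy and dissipation\<close>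

lemma rhs_d_eq:
  assumes "valid_network N" "valid_gains N e"
  shows "rhs_d N e c s i = eps_d e i * (- deriv (c i) (st_d s i) + st_omega s i + alc_mu N e s i
           - st_gamma_hi s i + st_gamma_lo s i)"
proof (cases "i \<in> generators N")
  case True
  then have "eps_omega e i \<noteq> 0" using assms by (auto simp: valid_gains_def valid_network_def)
  then show ?thesis using True by (simp add: rhs_d_def alc_eta_def alc_mu_def add_divide_distrib algebra_simps)
qed (simp add: rhs_d_def alc_eta_def alc_mu_def algebra_simps)

text \<open>
  The coordinate \<open>r\<close> enters through \<open>alc_mu\<close>, in which the dynamics is a gradient flow. The frequencies
  of load buses carry no inertia and no energy.
\<close>

definition energy ::
    "'n::finite power_network \<Rightarrow> 'n alc_gains \<Rightarrow> 'n alc_state \<Rightarrow> 'n alc_state \<Rightarrow> real" where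
  "energy N e z s =
     (\<Sum>i\<in>UNIV. 1 / eps_d e i * (st_d s i - st_d z i)\<^sup>2)
   + (\<Sum>i\<in>UNIV. 1 / eps_psi e i * (st_psi s i - st_psi z i)\<^sup>2)
   + (\<Sum>i\<in>UNIV. 1 / eps_gamma_hi e i * (st_gamma_hi s i - st_gamma_hi z i)\<^sup>2)
   + (\<Sum>i\<in>UNIV. 1 / eps_gamma_lo e i * (st_gamma_lo s i - st_gamma_lo z i)\<^sup>2)
   + (\<Sum>i\<in>UNIV. 1 / eps_mu e i * (alc_mu N e s i - alc_mu N e z i)\<^sup>2)
   + (\<Sum>i\<in>generators N. inertia N i * (st_omega s i - st_omega z i)\<^sup>2)
   + (\<Sum>(i, j)\<in>lines N. 1 / suscept N i j * (st_P s i j - st_P z i j)\<^sup>2)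
   + (\<Sum>(i, j)\<in>inner_lines N. 1 / eps_sigma_hi e i j * (st_sigma_hi s i j - st_sigma_hi z i j)\<^sup>2)
   + (\<Sum>(i, j)\<in>inner_lines N. 1 / eps_sigma_lo e i j * (st_sigma_lo s i j - st_sigma_lo z i j)\<^sup>2)"

text \<open>
  The inner product of the displacement \<open>s - z\<close> with the velocity at \<open>s\<close> in the metric of \<open>energy\<close>,
  where the step sizes cancel against the weights.
\<close>

definition half_energy_rate ::
    "'n::finite power_network \<Rightarrow> 'n alc_gains \<Rightarrow> ('n \<Rightarrow> real \<Rightarrow> real) \<Rightarrow> 'n alc_state \<Rightarrow> 'n alc_state \<Rightarrow> real" where
  "half_energy_rate N e c z s =
     (\<Sum>i\<in>UNIV. (st_d s i - st_d z i) *
        (- deriv (c i) (st_d s i) + st_omega s i + alc_mu N e s i - st_gamma_hi s i + st_gamma_lo s i))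
   + (\<Sum>i\<in>UNIV. (st_psi s i - st_psi z i) * net_outflow (inner_lines N) (line_price N e s) i)
   + (\<Sum>i\<in>UNIV. (st_gamma_hi s i - st_gamma_hi z i) * pos_proj (st_d s i - load_max N i) (st_gamma_hi s i))
   + (\<Sum>i\<in>UNIV. (st_gamma_lo s i - st_gamma_lo z i) * pos_proj (- st_d s i + load_min N i) (st_gamma_lo s i))
   + (\<Sum>i\<in>UNIV. (alc_mu N e s i - alc_mu N e z i) *
        (injection N i - st_d s i - net_outflow (inner_lines N) (dc_flow N (st_psi s)) i))
   + (\<Sum>i\<in>generators N. (st_omega s i - st_omega z i) * - power_imbalance N s i)
   + (\<Sum>(i, j)\<in>lines N. (st_P s i j - st_P z i j) * (st_omega s i - st_omega s j))
   + (\<Sum>(i, j)\<in>inner_lines N. (st_sigma_hi s i j - st_sigma_hi z i j) *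
        pos_proj (dc_flow N (st_psi s) i j - flow_max N i j) (st_sigma_hi s i j))
   + (\<Sum>(i, j)\<in>inner_lines N. (st_sigma_lo s i j - st_sigma_lo z i j) *
        pos_proj (- dc_flow N (st_psi s) i j + flow_min N i j) (st_sigma_lo s i j))"

text \<open>
  Strict monotonicity is available in \<open>d\<close> and \<open>\<omega>\<close> only; for the multipliers there is just the product
  with the slack at the optimum.
\<close>

definition bus_dissipation ::
    "'n power_network \<Rightarrow> ('n \<Rightarrow> real \<Rightarrow> real) \<Rightarrow> 'n alc_state \<Rightarrow> 'n alc_state \<Rightarrow> 'n \<Rightarrow> real" where
  "bus_dissipation N c z s i =
     (deriv (c i) (st_d s i) - deriv (c i) (st_d z i)) * (st_d s i - st_d z i)
   + damping N i * (st_omega s i)\<^sup>2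
   + st_gamma_hi s i * (load_max N i - st_d z i) + st_gamma_lo s i * (st_d z i - load_min N i)"

definition line_dissipation :: "'n power_network \<Rightarrow> 'n alc_state \<Rightarrow> 'n alc_state \<Rightarrow> 'n \<Rightarrow> 'n \<Rightarrow> real" where
  "line_dissipation N z s i j =
     st_sigma_hi s i j * (flow_max N i j - dc_flow N (st_psi z) i j)
   + st_sigma_lo s i j * (dc_flow N (st_psi z) i j - flow_min N i j)"

text \<open>
  The projection acts only at \<open>y = 0\<close> and against a negative \<open>x\<close>, where leaving it out would move \<open>y\<close>
  away from the nonnegative \<open>z\<close>.
\<close>

lemma pos_proj_dissipative:
  assumes "y \<ge> 0" "z \<ge> 0"
  shows "(y - z) * pos_proj x y \<le> (y - z) * x"
proof (cases "x > 0 \<or> y > 0")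
  case False
  then have "y = 0" "x \<le> 0" using assms(1) by auto
  then show ?thesis using assms(2) by (simp add: pos_proj_def mult_nonneg_nonpos)
qed (simp add: pos_proj_def)

text \<open>
  The Lagrangian is bilinear up to the cost and the damping, so the cross terms between descending and
  ascending variables cancel after summation by parts: \<open>d\<close> against \<open>\<omega>\<close>, \<open>\<mu>\<close> and \<open>\<gamma>\<close> at each bus, \<open>P\<close>
  against \<open>\<omega>\<close> on each line, and \<open>\<psi>\<close> against \<open>\<mu>\<close> and \<open>\<sigma>\<close> on each inner line.
\<close>

lemma half_energy_rate_le:
  fixes N :: "'n::finite power_network"
  assumes kkt: "kkt_point N e c z" and nonneg: "multipliers_nonneg N s"
    and loads: "\<And>i. i \<notin> generators N \<Longrightarrow> power_imbalance N s i = 0"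
  shows "half_energy_rate N e c z s \<le>
    - ((\<Sum>i\<in>UNIV. bus_dissipation N c z s i) + (\<Sum>(i, j)\<in>inner_lines N. line_dissipation N z s i j))"
proof -
  let ?L = "lines N" and ?E = "inner_lines N"
  define \<Delta>\<mu> where "\<Delta>\<mu> i = alc_mu N e s i - alc_mu N e z i" for i
  define \<Delta>\<psi> where "\<Delta>\<psi> = (\<lambda>i. st_psi s i - st_psi z i)"
  define \<Delta>P where "\<Delta>P = (\<lambda>i j. st_P s i j - st_P z i j)"
  define \<Delta>p where "\<Delta>p = (\<lambda>i j. line_price N e s i j - line_price N e z i j)"
  \<comment> \<open>load buses may be added, as they are balanced\<close>
  have gen: "(\<Sum>i\<in>generators N. (st_omega s i - st_omega z i) * - power_imbalance N s i)
      = (\<Sum>i\<in>UNIV. st_omega s i * - power_imbalance N s i)"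
    using loads kkt_pointD(1)[OF kkt] by (intro sum.mono_neutral_cong_left) auto
  have bus: "(st_d s i - st_d z i) *
        (- deriv (c i) (st_d s i) + st_omega s i + alc_mu N e s i - st_gamma_hi s i + st_gamma_lo s i)
      + (st_psi s i - st_psi z i) * net_outflow ?E (line_price N e s) i
      + (st_gamma_hi s i - st_gamma_hi z i) * pos_proj (st_d s i - load_max N i) (st_gamma_hi s i)
      + (st_gamma_lo s i - st_gamma_lo z i) * pos_proj (- st_d s i + load_min N i) (st_gamma_lo s i)
      + (alc_mu N e s i - alc_mu N e z i) *
          (injection N i - st_d s i - net_outflow ?E (dc_flow N (st_psi s)) i)
      + st_omega s i * - power_imbalance N s i
      \<le> - bus_dissipation N c z s i - st_omega s i * net_outflow ?L \<Delta>P i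
        - \<Delta>\<mu> i * net_outflow ?E (dc_flow N \<Delta>\<psi>) i + \<Delta>\<psi> i * net_outflow ?E \<Delta>p i" for i
  proof -
    have outP: "net_outflow ?L \<Delta>P i = net_outflow ?L (st_P s) i - net_outflow ?L (st_P z) i"
      by (simp add: \<Delta>P_def net_outflow_diff)
    have outE: "net_outflow ?E (dc_flow N \<Delta>\<psi>) i
        = net_outflow ?E (dc_flow N (st_psi s)) i - net_outflow ?E (dc_flow N (st_psi z)) i"
      by (simp add: \<Delta>\<psi>_def net_outflow_dc_flow_diff)
    have outp: "net_outflow ?E \<Delta>p i = net_outflow ?E (line_price N e s) i"
      using kkt_pointD(5)[OF kkt, of i] by (simp add: \<Delta>p_def net_outflow_diff)
    have "(st_d s i - st_d z i) *
        (- deriv (c i) (st_d s i) + st_omega s i + alc_mu N e s i - st_gamma_hi s i + st_gamma_lo s i)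
      + (st_gamma_hi s i - st_gamma_hi z i) * (st_d s i - load_max N i)
      + (st_gamma_lo s i - st_gamma_lo z i) * (- st_d s i + load_min N i)
      + (alc_mu N e s i - alc_mu N e z i) *
          (injection N i - st_d s i - net_outflow ?E (dc_flow N (st_psi s)) i)
      + st_omega s i * - power_imbalance N s i
      = - bus_dissipation N c z s i - st_omega s i * net_outflow ?L \<Delta>P i
        - \<Delta>\<mu> i * net_outflow ?E (dc_flow N \<Delta>\<psi>) i"
      using kkt_pointD(2,3,4,9,11)[OF kkt, of i]
      unfolding outP outE bus_dissipation_def power_imbalance_def \<Delta>\<mu>_def
      by algebra
    moreover have
      "(st_gamma_hi s i - st_gamma_hi z i) * pos_proj (st_d s i - load_max N i) (st_gamma_hi s i)
        \<le> (st_gamma_hi s i - st_gamma_hi z i) * (st_d s i - load_max N i)"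
      "(st_gamma_lo s i - st_gamma_lo z i) * pos_proj (- st_d s i + load_min N i) (st_gamma_lo s i)
        \<le> (st_gamma_lo s i - st_gamma_lo z i) * (- st_d s i + load_min N i)"
      using nonneg kkt_pointD(8,10)[OF kkt, of i]
      by (auto simp: multipliers_nonneg_def intro!: pos_proj_dissipative)
    ultimately show ?thesis unfolding outp \<Delta>\<psi>_def by linarith
  qed
  have line: "(st_sigma_hi s i j - st_sigma_hi z i j) *
        pos_proj (dc_flow N (st_psi s) i j - flow_max N i j) (st_sigma_hi s i j)
      + (st_sigma_lo s i j - st_sigma_lo z i j) *
        pos_proj (- dc_flow N (st_psi s) i j + flow_min N i j) (st_sigma_lo s i j)
      \<le> - line_dissipation N z s i j + dc_flow N \<Delta>\<psi> i j * (\<Delta>\<mu> i - \<Delta>\<mu> j) - \<Delta>p i j * (\<Delta>\<psi> i - \<Delta>\<psi> j)"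
    if ij: "(i, j) \<in> ?E" for i j
  proof -
    have "(st_sigma_hi s i j - st_sigma_hi z i j) * (dc_flow N (st_psi s) i j - flow_max N i j)
      + (st_sigma_lo s i j - st_sigma_lo z i j) * (- dc_flow N (st_psi s) i j + flow_min N i j)
      = - line_dissipation N z s i j + dc_flow N \<Delta>\<psi> i j * (\<Delta>\<mu> i - \<Delta>\<mu> j) - \<Delta>p i j * (\<Delta>\<psi> i - \<Delta>\<psi> j)"
      using kkt_point_lineD(4,6)[OF kkt ij]
      unfolding line_dissipation_def \<Delta>\<mu>_def \<Delta>p_def \<Delta>\<psi>_def line_price_def dc_flow_def
      by algebra
    moreover have "(st_sigma_hi s i j - st_sigma_hi z i j) *
        pos_proj (dc_flow N (st_psi s) i j - flow_max N i j) (st_sigma_hi s i j)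
      \<le> (st_sigma_hi s i j - st_sigma_hi z i j) * (dc_flow N (st_psi s) i j - flow_max N i j)"
      "(st_sigma_lo s i j - st_sigma_lo z i j) *
        pos_proj (- dc_flow N (st_psi s) i j + flow_min N i j) (st_sigma_lo s i j)
      \<le> (st_sigma_lo s i j - st_sigma_lo z i j) * (- dc_flow N (st_psi s) i j + flow_min N i j)"
      using nonneg ij kkt_point_lineD(3,5)[OF kkt ij]
      by (auto simp: multipliers_nonneg_def intro!: pos_proj_dissipative)
    ultimately show ?thesis by linarith
  qed
  have "half_energy_rate N e c z s \<le>
      (\<Sum>i\<in>UNIV. - bus_dissipation N c z s i - st_omega s i * net_outflow ?L \<Delta>P i
        - \<Delta>\<mu> i * net_outflow ?E (dc_flow N \<Delta>\<psi>) i + \<Delta>\<psi> i * net_outflow ?E \<Delta>p i)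
    + (\<Sum>(i, j)\<in>?L. \<Delta>P i j * (st_omega s i - st_omega s j))
    + (\<Sum>(i, j)\<in>?E. - line_dissipation N z s i j + dc_flow N \<Delta>\<psi> i j * (\<Delta>\<mu> i - \<Delta>\<mu> j)
        - \<Delta>p i j * (\<Delta>\<psi> i - \<Delta>\<psi> j))"
  proof -
    have "half_energy_rate N e c z s = (\<Sum>i\<in>UNIV. (st_d s i - st_d z i) *
        (- deriv (c i) (st_d s i) + st_omega s i + alc_mu N e s i - st_gamma_hi s i + st_gamma_lo s i)
      + (st_psi s i - st_psi z i) * net_outflow ?E (line_price N e s) i
      + (st_gamma_hi s i - st_gamma_hi z i) * pos_proj (st_d s i - load_max N i) (st_gamma_hi s i)
      + (st_gamma_lo s i - st_gamma_lo z i) * pos_proj (- st_d s i + load_min N i) (st_gamma_lo s i)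
      + (alc_mu N e s i - alc_mu N e z i) *
          (injection N i - st_d s i - net_outflow ?E (dc_flow N (st_psi s)) i)
      + st_omega s i * - power_imbalance N s i)
    + (\<Sum>(i, j)\<in>?L. \<Delta>P i j * (st_omega s i - st_omega s j))
    + (\<Sum>(i, j)\<in>?E. (st_sigma_hi s i j - st_sigma_hi z i j) *
        pos_proj (dc_flow N (st_psi s) i j - flow_max N i j) (st_sigma_hi s i j)
      + (st_sigma_lo s i j - st_sigma_lo z i j) *
        pos_proj (- dc_flow N (st_psi s) i j + flow_min N i j) (st_sigma_lo s i j))"
      unfolding half_energy_rate_def gen \<Delta>P_def by (simp only: sum.distrib case_prod_unfold)
    also have "\<dots> \<le> (\<Sum>i\<in>UNIV. - bus_dissipation N c z s i - st_omega s i * net_outflow ?L \<Delta>P i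
        - \<Delta>\<mu> i * net_outflow ?E (dc_flow N \<Delta>\<psi>) i + \<Delta>\<psi> i * net_outflow ?E \<Delta>p i)
    + (\<Sum>(i, j)\<in>?L. \<Delta>P i j * (st_omega s i - st_omega s j))
    + (\<Sum>(i, j)\<in>?E. - line_dissipation N z s i j + dc_flow N \<Delta>\<psi> i j * (\<Delta>\<mu> i - \<Delta>\<mu> j)
        - \<Delta>p i j * (\<Delta>\<psi> i - \<Delta>\<psi> j))"
      by (intro add_mono order_refl sum_mono bus) (use line in auto)
    finally show ?thesis .
  qed
  also have "\<dots> = - ((\<Sum>i\<in>UNIV. bus_dissipation N c z s i) + (\<Sum>(i, j)\<in>?E. line_dissipation N z s i j))"
    using sum_net_outflow[of "st_omega s" ?L \<Delta>P] sum_net_outflow[of \<Delta>\<mu> ?E "dc_flow N \<Delta>\<psi>"]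
      sum_net_outflow[of \<Delta>\<psi> ?E \<Delta>p]
    by (simp add: sum.distrib sum_subtractf sum_negf case_prod_unfold)
  finally show ?thesis .
qed

lemma energy_nonneg_and_coordinate_le:
  fixes N :: "'n::finite power_network"
  assumes net: "valid_network N" and gains: "valid_gains N e"
  shows "energy N e z s \<ge> 0"
    and "(st_d s i - st_d z i)\<^sup>2 \<le> eps_d e i * energy N e z s"
    and "(st_psi s i - st_psi z i)\<^sup>2 \<le> eps_psi e i * energy N e z s"
    and "(st_gamma_hi s i - st_gamma_hi z i)\<^sup>2 \<le> eps_gamma_hi e i * energy N e z s"
    and "(st_gamma_lo s i - st_gamma_lo z i)\<^sup>2 \<le> eps_gamma_lo e i * energy N e z s"
    and "(alc_mu N e s i - alc_mu N e z i)\<^sup>2 \<le> eps_mu e i * energy N e z s"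
    and "i \<in> generators N \<Longrightarrow> (st_omega s i - st_omega z i)\<^sup>2 \<le> 1 / inertia N i * energy N e z s"
    and "(i, j) \<in> lines N \<Longrightarrow> (st_P s i j - st_P z i j)\<^sup>2 \<le> suscept N i j * energy N e z s"
    and "(i, j) \<in> inner_lines N \<Longrightarrow>
           (st_sigma_hi s i j - st_sigma_hi z i j)\<^sup>2 \<le> eps_sigma_hi e i j * energy N e z s"
    and "(i, j) \<in> inner_lines N \<Longrightarrow>
           (st_sigma_lo s i j - st_sigma_lo z i j)\<^sup>2 \<le> eps_sigma_lo e i j * energy N e z s"
proof -
  have pos: "eps_d e i > 0" "eps_psi e i > 0" "eps_gamma_hi e i > 0" "eps_gamma_lo e i > 0" "eps_mu e i > 0" for i
    using gains by (auto simp: valid_gains_def)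
  have posM: "inertia N i > 0" if "i \<in> generators N" for i
    using net that by (auto simp: valid_network_def)
  have posB: "suscept N i j > 0" if "(i, j) \<in> lines N" for i j
    using net that by (auto simp: valid_network_def)
  have pos\<sigma>: "eps_sigma_hi e i j > 0" "eps_sigma_lo e i j > 0" if "(i, j) \<in> inner_lines N" for i j
    using gains that by (auto simp: valid_gains_def)
  define T1 where "T1 i = 1 / eps_d e i * (st_d s i - st_d z i)\<^sup>2" for i
  define T2 where "T2 i = 1 / eps_psi e i * (st_psi s i - st_psi z i)\<^sup>2" for i
  define T3 where "T3 i = 1 / eps_gamma_hi e i * (st_gamma_hi s i - st_gamma_hi z i)\<^sup>2" for i
  define T4 where "T4 i = 1 / eps_gamma_lo e i * (st_gamma_lo s i - st_gamma_lo z i)\<^sup>2" for i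
  define T5 where "T5 i = 1 / eps_mu e i * (alc_mu N e s i - alc_mu N e z i)\<^sup>2" for i
  define T6 where "T6 i = inertia N i * (st_omega s i - st_omega z i)\<^sup>2" for i
  define T7 where "T7 = (\<lambda>(i, j). 1 / suscept N i j * (st_P s i j - st_P z i j)\<^sup>2)"
  define T8 where "T8 = (\<lambda>(i, j). 1 / eps_sigma_hi e i j * (st_sigma_hi s i j - st_sigma_hi z i j)\<^sup>2)"
  define T9 where "T9 = (\<lambda>(i, j). 1 / eps_sigma_lo e i j * (st_sigma_lo s i j - st_sigma_lo z i j)\<^sup>2)"
  have V: "energy N e z s = sum T1 UNIV + sum T2 UNIV + sum T3 UNIV + sum T4 UNIV + sum T5 UNIV
      + sum T6 (generators N) + sum T7 (lines N) + sum T8 (inner_lines N) + sum T9 (inner_lines N)"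
    unfolding energy_def T1_def T2_def T3_def T4_def T5_def T6_def T7_def T8_def T9_def ..
  have nn: "T1 k \<ge> 0" "T2 k \<ge> 0" "T3 k \<ge> 0" "T4 k \<ge> 0" "T5 k \<ge> 0" for k
    using pos[of k] by (simp_all add: T1_def T2_def T3_def T4_def T5_def)
  have nn6: "T6 k \<ge> 0" if "k \<in> generators N" for k
    using posM[OF that] by (simp add: T6_def)
  have nn7: "T7 p \<ge> 0" if "p \<in> lines N" for p
    using posB[of "fst p" "snd p"] that by (simp add: T7_def case_prod_unfold)
  have nn8: "T8 p \<ge> 0" "T9 p \<ge> 0" if "p \<in> inner_lines N" for p
    using pos\<sigma>[of "fst p" "snd p"] that by (simp_all add: T8_def T9_def case_prod_unfold)
  have sums: "sum T1 UNIV \<ge> 0" "sum T2 UNIV \<ge> 0" "sum T3 UNIV \<ge> 0" "sum T4 UNIV \<ge> 0" "sum T5 UNIV \<ge> 0"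
    "sum T6 (generators N) \<ge> 0" "sum T7 (lines N) \<ge> 0" "sum T8 (inner_lines N) \<ge> 0" "sum T9 (inner_lines N) \<ge> 0"
    using nn nn6 nn7 nn8 by (auto intro: sum_nonneg)
  show "energy N e z s \<ge> 0" unfolding V using sums by linarith
  have le: "T1 k \<le> sum T1 UNIV" "T2 k \<le> sum T2 UNIV" "T3 k \<le> sum T3 UNIV" "T4 k \<le> sum T4 UNIV" "T5 k \<le> sum T5 UNIV" for k
    using nn by (auto intro: member_le_sum)
  have le6: "T6 k \<le> sum T6 (generators N)" if "k \<in> generators N" for k
    using nn6 that by (auto intro: member_le_sum)
  have le7: "T7 p \<le> sum T7 (lines N)" if "p \<in> lines N" for p
    using nn7 that by (auto intro: member_le_sum)
  have le8: "T8 p \<le> sum T8 (inner_lines N)" "T9 p \<le> sum T9 (inner_lines N)" if "p \<in> inner_lines N" for p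
    using nn8 that by (auto intro: member_le_sum)
  have "T1 i \<le> energy N e z s" "T2 i \<le> energy N e z s" "T3 i \<le> energy N e z s" "T4 i \<le> energy N e z s"
    "T5 i \<le> energy N e z s"
    unfolding V using sums le[of i] by linarith+
  then show "(st_d s i - st_d z i)\<^sup>2 \<le> eps_d e i * energy N e z s"
    "(st_psi s i - st_psi z i)\<^sup>2 \<le> eps_psi e i * energy N e z s"
    "(st_gamma_hi s i - st_gamma_hi z i)\<^sup>2 \<le> eps_gamma_hi e i * energy N e z s"
    "(st_gamma_lo s i - st_gamma_lo z i)\<^sup>2 \<le> eps_gamma_lo e i * energy N e z s"
    "(alc_mu N e s i - alc_mu N e z i)\<^sup>2 \<le> eps_mu e i * energy N e z s"
    using pos[of i] by (simp_all add: T1_def T2_def T3_def T4_def T5_def pos_divide_le_eq mult.commute)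
  show "(st_omega s i - st_omega z i)\<^sup>2 \<le> 1 / inertia N i * energy N e z s" if "i \<in> generators N"
  proof -
    have "T6 i \<le> energy N e z s" unfolding V using sums le6[OF that] by linarith
    then show ?thesis using posM[OF that] by (simp add: T6_def pos_le_divide_eq mult.commute)
  qed
  show "(st_P s i j - st_P z i j)\<^sup>2 \<le> suscept N i j * energy N e z s" if "(i, j) \<in> lines N"
  proof -
    have "T7 (i, j) \<le> energy N e z s" unfolding V using sums le7[OF that] by linarith
    then show ?thesis using posB[OF that] by (simp add: T7_def pos_divide_le_eq mult.commute)
  qed
  show "(st_sigma_hi s i j - st_sigma_hi z i j)\<^sup>2 \<le> eps_sigma_hi e i j * energy N e z s"
    "(st_sigma_lo s i j - st_sigma_lo z i j)\<^sup>2 \<le> eps_sigma_lo e i j * energy N e z s"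
    if "(i, j) \<in> inner_lines N"
  proof -
    have "T8 (i, j) \<le> energy N e z s" "T9 (i, j) \<le> energy N e z s"
      unfolding V using sums le8[OF that] by linarith+
    then show "(st_sigma_hi s i j - st_sigma_hi z i j)\<^sup>2 \<le> eps_sigma_hi e i j * energy N e z s"
      "(st_sigma_lo s i j - st_sigma_lo z i j)\<^sup>2 \<le> eps_sigma_lo e i j * energy N e z s"
      using pos\<sigma>[OF that] by (simp_all add: T8_def T9_def pos_divide_le_eq mult.commute)
  qed
qed

section \<open>Asymptotics of the closed loop\<close>

text \<open>
  The coordinatewise convergence of \<open>state_converges\<close> along an arbitrary filter, so that it also covers
  limits along sequences of times.
\<close>

definition state_tendsto ::
    "'n power_network \<Rightarrow> ('k \<Rightarrow> 'n alc_state) \<Rightarrow> 'n alc_state \<Rightarrow> 'k filter \<Rightarrow> bool" where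
  "state_tendsto N y s F \<longleftrightarrow>
     (\<forall>i. ((\<lambda>k. st_d (y k) i) \<longlongrightarrow> st_d s i) F \<and>
          ((\<lambda>k. st_omega (y k) i) \<longlongrightarrow> st_omega s i) F \<and>
          ((\<lambda>k. st_psi (y k) i) \<longlongrightarrow> st_psi s i) F \<and>
          ((\<lambda>k. st_gamma_hi (y k) i) \<longlongrightarrow> st_gamma_hi s i) F \<and>
          ((\<lambda>k. st_gamma_lo (y k) i) \<longlongrightarrow> st_gamma_lo s i) F \<and>
          ((\<lambda>k. st_r (y k) i) \<longlongrightarrow> st_r s i) F) \<and>
     (\<forall>(i, j)\<in>lines N. ((\<lambda>k. st_P (y k) i j) \<longlongrightarrow> st_P s i j) F) \<and>
     (\<forall>(i, j)\<in>inner_lines N.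
          ((\<lambda>k. st_sigma_hi (y k) i j) \<longlongrightarrow> st_sigma_hi s i j) F \<and>
          ((\<lambda>k. st_sigma_lo (y k) i j) \<longlongrightarrow> st_sigma_lo s i j) F)"

lemma state_tendstoD:
  assumes "state_tendsto N y s F"
  shows "((\<lambda>k. st_d (y k) i) \<longlongrightarrow> st_d s i) F" and "((\<lambda>k. st_omega (y k) i) \<longlongrightarrow> st_omega s i) F"
    and "((\<lambda>k. st_psi (y k) i) \<longlongrightarrow> st_psi s i) F"
    and "((\<lambda>k. st_gamma_hi (y k) i) \<longlongrightarrow> st_gamma_hi s i) F"
    and "((\<lambda>k. st_gamma_lo (y k) i) \<longlongrightarrow> st_gamma_lo s i) F"
    and "((\<lambda>k. st_r (y k) i) \<longlongrightarrow> st_r s i) F"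
    and "(i, j) \<in> lines N \<Longrightarrow> ((\<lambda>k. st_P (y k) i j) \<longlongrightarrow> st_P s i j) F"
    and "(i, j) \<in> inner_lines N \<Longrightarrow> ((\<lambda>k. st_sigma_hi (y k) i j) \<longlongrightarrow> st_sigma_hi s i j) F"
    and "(i, j) \<in> inner_lines N \<Longrightarrow> ((\<lambda>k. st_sigma_lo (y k) i j) \<longlongrightarrow> st_sigma_lo s i j) F"
  using assms unfolding state_tendsto_def by blast+

lemma tendsto_alc_mu:
  assumes "((\<lambda>k. st_omega (y k) i) \<longlongrightarrow> st_omega s i) F" "((\<lambda>k. st_r (y k) i) \<longlongrightarrow> st_r s i) F"
  shows "((\<lambda>k. alc_mu N e (y k) i) \<longlongrightarrow> alc_mu N e s i) F"
proof (cases "i \<in> generators N")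
  case True
  show ?thesis
    unfolding alc_mu_def if_P[OF True] by (intro tendsto_add tendsto_mult tendsto_const assms)
next
  case False
  show ?thesis
    unfolding alc_mu_def if_not_P[OF False] by (intro tendsto_mult tendsto_const assms)
qed

locale closed_loop =
  fixes N :: "'n::finite power_network"
    and e :: "'n alc_gains"
    and c :: "'n \<Rightarrow> real \<Rightarrow> real"
    and x :: "real \<Rightarrow> 'n alc_state"
  assumes net: "valid_network N" and gains: "valid_gains N e"
    and convex: "\<And>i. strictly_convex_on UNIV (c i)"
    and C1: "\<And>i. c i C1_differentiable_on UNIV"
    and feasible: "olc_feasible N"
    and net_sol: "net_solution N x" and alc_sol: "alc_solution N e c x"
    and nonneg0: "multipliers_nonneg N (x 0)"
begin

abbreviation E where "E \<equiv> inner_lines N"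

lemma gain_pos:
  "eps_d e i > 0" "eps_psi e i > 0" "eps_gamma_hi e i > 0" "eps_gamma_lo e i > 0" "eps_mu e i > 0" "gain_K e i > 0"
  "damping N i > 0"
  "i \<in> generators N \<Longrightarrow> inertia N i > 0" "i \<in> generators N \<Longrightarrow> eps_omega e i = 1 / inertia N i"
  "(i, j) \<in> lines N \<Longrightarrow> suscept N i j > 0"
  "(i, j) \<in> E \<Longrightarrow> eps_sigma_hi e i j > 0" "(i, j) \<in> E \<Longrightarrow> eps_sigma_lo e i j > 0"
  using net gains by (auto simp: valid_network_def valid_gains_def)

lemma inner_lines_subset: "(i, j) \<in> E \<Longrightarrow> (i, j) \<in> lines N"
  by (auto simp: inner_lines_def)

lemma balance_at_loads: "i \<notin> generators N \<Longrightarrow> t \<ge> 0 \<Longrightarrow> power_imbalance N (x t) i = 0"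
proof -
  assume "i \<notin> generators N" "t \<ge> 0"
  moreover have "i \<in> generators N \<union> load_buses N" using net by (simp add: valid_network_def)
  ultimately show ?thesis using net_sol unfolding net_solution_def by simp
qed

lemma ode_omega: "i \<in> generators N \<Longrightarrow>
    caratheodory_ode (\<lambda>t. st_omega (x t) i) (\<lambda>t. - power_imbalance N (x t) i / inertia N i)"
  using net_sol by (auto simp: net_solution_def)

lemma ode_P: "(i, j) \<in> lines N \<Longrightarrow>
    caratheodory_ode (\<lambda>t. st_P (x t) i j) (\<lambda>t. suscept N i j * (st_omega (x t) i - st_omega (x t) j))"
  using net_sol by (auto simp: net_solution_def)

lemma ode_d: "caratheodory_ode (\<lambda>t. st_d (x t) i)
    (\<lambda>t. eps_d e i * (- deriv (c i) (st_d (x t) i) + st_omega (x t) i + alc_mu N e (x t) i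
           - st_gamma_hi (x t) i + st_gamma_lo (x t) i))"
  using alc_sol unfolding alc_solution_def rhs_d_eq[OF net gains] by blast

lemma ode_psi: "caratheodory_ode (\<lambda>t. st_psi (x t) i)
    (\<lambda>t. eps_psi e i * net_outflow E (line_price N e (x t)) i)"
  using alc_sol unfolding alc_solution_def rhs_psi_eq by blast

lemma ode_gamma:
  "caratheodory_ode (\<lambda>t. st_gamma_hi (x t) i)
    (\<lambda>t. eps_gamma_hi e i * pos_proj (st_d (x t) i - load_max N i) (st_gamma_hi (x t) i))"
  "caratheodory_ode (\<lambda>t. st_gamma_lo (x t) i)
    (\<lambda>t. eps_gamma_lo e i * pos_proj (- st_d (x t) i + load_min N i) (st_gamma_lo (x t) i))"
  using alc_sol unfolding alc_solution_def by blast+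

lemma ode_r: "caratheodory_ode (\<lambda>t. st_r (x t) i) (\<lambda>t. rhs_r N e (x t) i)"
  using alc_sol unfolding alc_solution_def by blast

lemma ode_sigma:
  assumes "(i, j) \<in> E"
  shows "caratheodory_ode (\<lambda>t. st_sigma_hi (x t) i j)
      (\<lambda>t. eps_sigma_hi e i j * pos_proj (dc_flow N (st_psi (x t)) i j - flow_max N i j) (st_sigma_hi (x t) i j))"
    and "caratheodory_ode (\<lambda>t. st_sigma_lo (x t) i j)
      (\<lambda>t. eps_sigma_lo e i j * pos_proj (- dc_flow N (st_psi (x t)) i j + flow_min N i j) (st_sigma_lo (x t) i j))"
  using alc_sol assms unfolding alc_solution_def by blast+

text \<open>
  The physical flows drop out: \<open>\<mu>\<close> integrates the mismatch of the virtual balance, which makes it the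
  multiplier of that constraint. At a load bus this uses the algebraic balance.
\<close>

lemma ode_mu: "caratheodory_ode (\<lambda>t. alc_mu N e (x t) i)
    (\<lambda>t. eps_mu e i * (injection N i - st_d (x t) i - net_outflow E (dc_flow N (st_psi (x t))) i))"
proof (cases "i \<in> generators N")
  case True
  show ?thesis
  proof (rule caratheodory_ode_linear_combination[OF ode_omega[OF True] ode_r[of i]])
    show "alc_mu N e (x t) i = eps_mu e i / eps_omega e i * st_omega (x t) i + eps_mu e i / gain_K e i * st_r (x t) i" for t
      using True by (simp add: alc_mu_def)
    show "eps_mu e i * (injection N i - st_d (x t) i - net_outflow E (dc_flow N (st_psi (x t))) i)
      = eps_mu e i / eps_omega e i * (- power_imbalance N (x t) i / inertia N i) + eps_mu e i / gain_K e i * rhs_r N e (x t) i" for t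
      using True gain_pos(6)[of i] gain_pos(8,9)[OF True]
      by (simp add: power_imbalance_def rhs_r_def field_simps)
  qed
next
  case False
  show ?thesis
  proof (rule caratheodory_ode_linear_combination[OF ode_r[of i] ode_r[of i]])
    show "alc_mu N e (x t) i = eps_mu e i / gain_K e i * st_r (x t) i + 0 * st_r (x t) i" for t
      using False by (simp add: alc_mu_def)
    fix t :: real assume "t > 0"
    then have "injection N i - st_d (x t) i = damping N i * st_omega (x t) i + net_outflow (lines N) (st_P (x t)) i"
      using balance_at_loads[OF False, of t] by (simp add: power_imbalance_def)
    then show "eps_mu e i * (injection N i - st_d (x t) i - net_outflow E (dc_flow N (st_psi (x t))) i)
      = eps_mu e i / gain_K e i * rhs_r N e (x t) i + 0 * rhs_r N e (x t) i"
      using gain_pos(6)[of i] by (simp add: rhs_r_def)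
  qed
qed

lemma multipliers_nonneg: "t \<ge> 0 \<Longrightarrow> multipliers_nonneg N (x t)"
  unfolding multipliers_nonneg_def
proof (intro conjI allI ballI)
  fix i assume t: "t \<ge> 0"
  have "st_gamma_hi (x 0) i \<ge> 0" "st_gamma_lo (x 0) i \<ge> 0"
    using nonneg0 by (simp_all add: multipliers_nonneg_def)
  then show "st_gamma_hi (x t) i \<ge> 0" "st_gamma_lo (x t) i \<ge> 0"
    using projected_ode_nonneg[OF ode_gamma(1)[of i] _ _ t] projected_ode_nonneg[OF ode_gamma(2)[of i] _ _ t]
      gain_pos(3,4)[of i] by simp_all
next
  fix p assume t: "t \<ge> 0" and p: "p \<in> E"
  obtain i j where ij: "p = (i, j)" "(i, j) \<in> E" using p by (cases p) auto
  have "st_sigma_hi (x 0) i j \<ge> 0" "st_sigma_lo (x 0) i j \<ge> 0"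
    using nonneg0 ij(2) unfolding multipliers_nonneg_def by auto
  then show "case p of (i, j) \<Rightarrow> st_sigma_hi (x t) i j \<ge> 0 \<and> st_sigma_lo (x t) i j \<ge> 0"
    using projected_ode_nonneg[OF ode_sigma(1)[OF ij(2)] _ _ t]
      projected_ode_nonneg[OF ode_sigma(2)[OF ij(2)] _ _ t] gain_pos(11,12)[OF ij(2)] ij(1) by simp
qed

lemma ode_energy: "caratheodory_ode (\<lambda>t. energy N e z (x t)) (\<lambda>t. 2 * half_energy_rate N e c z (x t))"
proof -
  \<comment> \<open>the weight of a coordinate cancels its step size \<open>a\<close>\<close>
  have square: "caratheodory_ode (\<lambda>t. 1 / a * (y t - k)\<^sup>2) (\<lambda>t. 2 * ((y t - k) * g t))"
    if "caratheodory_ode y (\<lambda>t. a * g t)" "a > 0" for y g a and k :: real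
    using caratheodory_ode_cmult[OF caratheodory_ode_square[OF that(1)], of "1 / a" k] that(2)
    by (simp add: mult.left_commute)
  have plus: "caratheodory_ode (\<lambda>t. y t + y' t) (\<lambda>t. 2 * (g t + g' t))"
    if "caratheodory_ode y (\<lambda>t. 2 * g t)" "caratheodory_ode y' (\<lambda>t. 2 * g' t)" for y g y' g' :: "real \<Rightarrow> real"
    using caratheodory_ode_add[OF that] by (simp add: distrib_left)
  have sum: "caratheodory_ode (\<lambda>t. \<Sum>k\<in>K. y k t) (\<lambda>t. 2 * (\<Sum>k\<in>K. g k t))"
    if "\<And>k. k \<in> K \<Longrightarrow> caratheodory_ode (y k) (\<lambda>t. 2 * g k t)" for K :: "'k set" and y g
    using caratheodory_ode_sum[of K y "\<lambda>k t. 2 * g k t"] that by (simp add: sum_distrib_left)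
  have sum': "caratheodory_ode (\<lambda>t. \<Sum>(i, j)\<in>K. y i j t) (\<lambda>t. 2 * (\<Sum>(i, j)\<in>K. g i j t))"
    if "\<And>i j. (i, j) \<in> K \<Longrightarrow> caratheodory_ode (y i j) (\<lambda>t. 2 * g i j t)" for K :: "('n \<times> 'n) set" and y g
    using caratheodory_ode_sum[of K "\<lambda>p. y (fst p) (snd p)" "\<lambda>p t. 2 * g (fst p) (snd p) t"] that
    by (simp add: sum_distrib_left case_prod_unfold)
  have omega: "caratheodory_ode (\<lambda>t. inertia N i * (st_omega (x t) i - st_omega z i)\<^sup>2)
      (\<lambda>t. 2 * ((st_omega (x t) i - st_omega z i) * - power_imbalance N (x t) i))" if "i \<in> generators N" for i
    using square[of "\<lambda>t. st_omega (x t) i" "1 / inertia N i" "\<lambda>t. - power_imbalance N (x t) i" "st_omega z i"]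
      ode_omega[OF that] gain_pos(8)[OF that] by simp
  show ?thesis
    unfolding energy_def half_energy_rate_def
    by (intro plus) (rule sum sum', rule omega square,
      (rule ode_d ode_psi ode_gamma ode_mu ode_P ode_sigma gain_pos | assumption)+)+
qed

lemma deriv_cost_continuous: "continuous_on UNIV (deriv (c i))"
  using C1_differentiable_on_UNIV_real(2)[OF C1] .

lemma cost_strictly_monotone: "u \<noteq> v \<Longrightarrow> (deriv (c i) u - deriv (c i) v) * (u - v) > 0"
  using strictly_convex_deriv_strict_mono[OF convex C1_differentiable_on_UNIV_real(1)[OF C1]] .

lemma dissipation_nonneg:
  assumes kkt: "kkt_point N e c z" and t: "t \<ge> 0"
  shows "(deriv (c i) (st_d (x t) i) - deriv (c i) (st_d z i)) * (st_d (x t) i - st_d z i) \<ge> 0"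
    and "damping N i * (st_omega (x t) i)\<^sup>2 \<ge> 0"
    and "st_gamma_hi (x t) i * (load_max N i - st_d z i) \<ge> 0"
    and "st_gamma_lo (x t) i * (st_d z i - load_min N i) \<ge> 0"
    and "(i, j) \<in> E \<Longrightarrow> st_sigma_hi (x t) i j * (flow_max N i j - dc_flow N (st_psi z) i j) \<ge> 0"
    and "(i, j) \<in> E \<Longrightarrow> st_sigma_lo (x t) i j * (dc_flow N (st_psi z) i j - flow_min N i j) \<ge> 0"
proof -
  note nn = multipliers_nonneg[OF t, unfolded multipliers_nonneg_def]
  show "(deriv (c i) (st_d (x t) i) - deriv (c i) (st_d z i)) * (st_d (x t) i - st_d z i) \<ge> 0"
    using cost_strictly_monotone[of "st_d (x t) i" "st_d z i" i]
    by (cases "st_d (x t) i = st_d z i") auto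
  show "damping N i * (st_omega (x t) i)\<^sup>2 \<ge> 0" using gain_pos(7)[of i] by simp
  show "st_gamma_hi (x t) i * (load_max N i - st_d z i) \<ge> 0"
    "st_gamma_lo (x t) i * (st_d z i - load_min N i) \<ge> 0"
    using nn kkt_pointD(6,7)[OF kkt, of i] by simp_all
  show "st_sigma_hi (x t) i j * (flow_max N i j - dc_flow N (st_psi z) i j) \<ge> 0"
    "st_sigma_lo (x t) i j * (dc_flow N (st_psi z) i j - flow_min N i j) \<ge> 0" if ij: "(i, j) \<in> E"
    using nn ij kkt_point_lineD(1,2)[OF kkt ij] by auto
qed

definition dissipation :: "'n alc_state \<Rightarrow> real \<Rightarrow> real" where
  "dissipation z t =
     (\<Sum>i\<in>UNIV. bus_dissipation N c z (x t) i) + (\<Sum>(i, j)\<in>E. line_dissipation N z (x t) i j)"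

lemma half_energy_rate_le_dissipation:
  assumes "kkt_point N e c z" "t \<ge> 0"
  shows "half_energy_rate N e c z (x t) \<le> - dissipation z t"
  unfolding dissipation_def
  using half_energy_rate_le[OF assms(1) multipliers_nonneg[OF assms(2)]] balance_at_loads assms(2) by blast

lemma dissipation_ge:
  assumes kkt: "kkt_point N e c z" and t: "t \<ge> 0"
  shows "bus_dissipation N c z (x t) i \<le> dissipation z t"
    and "(i, j) \<in> E \<Longrightarrow> line_dissipation N z (x t) i j \<le> dissipation z t"
    and "0 \<le> dissipation z t"
proof -
  note nn = dissipation_nonneg[OF kkt t]
  have bus: "bus_dissipation N c z (x t) k \<ge> 0" for k
    unfolding bus_dissipation_def using nn(1-4)[of k] by linarith
  have line: "line_dissipation N z (x t) (fst p) (snd p) \<ge> 0" if "p \<in> E" for p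
    unfolding line_dissipation_def using nn(5,6)[of "fst p" "snd p"] that by simp
  have busS: "bus_dissipation N c z (x t) i \<le> (\<Sum>i\<in>UNIV. bus_dissipation N c z (x t) i)"
    using bus by (intro member_le_sum) auto
  have lineS: "line_dissipation N z (x t) i j \<le> (\<Sum>(i, j)\<in>E. line_dissipation N z (x t) i j)" if "(i, j) \<in> E"
    using member_le_sum[of "(i, j)" E "\<lambda>p. line_dissipation N z (x t) (fst p) (snd p)"] line that
    by (simp add: case_prod_unfold)
  have S: "0 \<le> (\<Sum>i\<in>UNIV. bus_dissipation N c z (x t) i)" "0 \<le> (\<Sum>(i, j)\<in>E. line_dissipation N z (x t) i j)"
    using bus line by (auto intro!: sum_nonneg simp: case_prod_unfold)
  show "bus_dissipation N c z (x t) i \<le> dissipation z t" "0 \<le> dissipation z t"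
    unfolding dissipation_def using busS S by linarith+
  show "line_dissipation N z (x t) i j \<le> dissipation z t" if "(i, j) \<in> E"
    unfolding dissipation_def using lineS[OF that] S by linarith
qed

lemma energy_rate_nonpos: "kkt_point N e c z \<Longrightarrow> t \<ge> 0 \<Longrightarrow> 2 * half_energy_rate N e c z (x t) \<le> 0"
  using half_energy_rate_le_dissipation[of z t] dissipation_ge(3)[of z t] by simp

lemma energy_le_initial:
  assumes "kkt_point N e c z" "t \<ge> 0"
  shows "energy N e z (x t) \<le> energy N e z (x 0)"
  using caratheodory_ode_increment_le[OF ode_energy[of z], of 0 t 0] energy_rate_nonpos[OF assms(1)] assms(2) by simp

lemma omega_at_load:
  assumes "i \<notin> generators N" "t \<ge> 0"
  shows "st_omega (x t) i = (injection N i - st_d (x t) i - net_outflow (lines N) (st_P (x t)) i) / damping N i"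
  using balance_at_loads[OF assms] gain_pos(7)[of i] by (simp add: power_imbalance_def field_simps)

text \<open>
  Recovers \<open>r\<close> from the coordinates that \<open>energy\<close> controls.
\<close>

lemma r_eq: "st_r (x t) i = gain_K e i / eps_mu e i *
    (alc_mu N e (x t) i - (if i \<in> generators N then eps_mu e i / eps_omega e i else 0) * st_omega (x t) i)"
  using gain_pos(5,6)[of i] by (simp add: alc_mu_def)

text \<open>
  The energy with respect to any Karush-Kuhn-Tucker point stays below its initial value. It does not see
  the frequencies at load buses, which are bounded through the algebraic balance.
\<close>

lemma bounded_coordinates:
  shows "bounded_signal (\<lambda>t. st_d (x t) i)" and "bounded_signal (\<lambda>t. st_psi (x t) i)"
    and "bounded_signal (\<lambda>t. st_gamma_hi (x t) i)" and "bounded_signal (\<lambda>t. st_gamma_lo (x t) i)"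
    and "bounded_signal (\<lambda>t. alc_mu N e (x t) i)"
    and "(i, j) \<in> lines N \<Longrightarrow> bounded_signal (\<lambda>t. st_P (x t) i j)"
    and "(i, j) \<in> E \<Longrightarrow> bounded_signal (\<lambda>t. st_sigma_hi (x t) i j)"
    and "(i, j) \<in> E \<Longrightarrow> bounded_signal (\<lambda>t. st_sigma_lo (x t) i j)"
    and "bounded_signal (\<lambda>t. st_omega (x t) i)"
    and "bounded_signal (\<lambda>t. st_r (x t) i)"
proof -
  obtain z where kkt: "kkt_point N e c z" using kkt_point_exists[OF feasible gains C1] .
  have bnd: "bounded_signal y" if "\<And>t. (y t - k)\<^sup>2 \<le> a * energy N e z (x t)" "a > 0" for y and k a :: real
  proof (rule bounded_signal_of_square_le)
    fix t :: real assume "t \<ge> 0"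
    then show "(y t - k)\<^sup>2 \<le> a * energy N e z (x 0)"
      using that(1)[of t] mult_left_mono[OF energy_le_initial[OF kkt \<open>t \<ge> 0\<close>], of a] \<open>a > 0\<close> by linarith
  qed
  note le = energy_nonneg_and_coordinate_le[OF net gains]
  show d: "bounded_signal (\<lambda>t. st_d (x t) i)" for i by (rule bnd[OF le(2) gain_pos(1)])
  show "bounded_signal (\<lambda>t. st_psi (x t) i)" by (rule bnd[OF le(3) gain_pos(2)])
  show "bounded_signal (\<lambda>t. st_gamma_hi (x t) i)" by (rule bnd[OF le(4) gain_pos(3)])
  show "bounded_signal (\<lambda>t. st_gamma_lo (x t) i)" by (rule bnd[OF le(5) gain_pos(4)])
  show mu: "bounded_signal (\<lambda>t. alc_mu N e (x t) i)" by (rule bnd[OF le(6) gain_pos(5)])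
  show P: "bounded_signal (\<lambda>t. st_P (x t) i j)" if "(i, j) \<in> lines N" for i j
    by (rule bnd[OF le(8)[OF that] gain_pos(10)[OF that]])
  show "bounded_signal (\<lambda>t. st_sigma_hi (x t) i j)" if "(i, j) \<in> E"
    by (rule bnd[OF le(9)[OF that] gain_pos(11)[OF that]])
  show "bounded_signal (\<lambda>t. st_sigma_lo (x t) i j)" if "(i, j) \<in> E"
    by (rule bnd[OF le(10)[OF that] gain_pos(12)[OF that]])
  show omega: "bounded_signal (\<lambda>t. st_omega (x t) i)"
  proof (cases "i \<in> generators N")
    case True
    then show ?thesis using bnd[OF le(7)[OF True]] gain_pos(8)[OF True] by simp
  next
    case False
    show ?thesis
      by (rule bounded_signal_eq[OF _ omega_at_load[OF False]])
        (intro bounded_signal_divide bounded_signal_diff bounded_signal_const d bounded_signal_net_outflow P)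
  qed
  show "bounded_signal (\<lambda>t. st_r (x t) i)"
    unfolding r_eq by (intro bounded_signal_cmult bounded_signal_diff mu omega)
qed

lemma bounded_dc_flow: "bounded_signal (\<lambda>t. dc_flow N (st_psi (x t)) i j)"
  unfolding dc_flow_def by (intro bounded_signal_cmult bounded_signal_diff bounded_coordinates)

text \<open>
  All right-hand sides are bounded along the bounded trajectory; at load buses the frequency is an
  affine function of load and flows.
\<close>

lemma uniformly_continuous_coordinates:
  shows "uniformly_continuous_on {0..} (\<lambda>t. st_d (x t) i)"
    and "uniformly_continuous_on {0..} (\<lambda>t. st_psi (x t) i)"
    and "uniformly_continuous_on {0..} (\<lambda>t. st_gamma_hi (x t) i)"
    and "uniformly_continuous_on {0..} (\<lambda>t. st_gamma_lo (x t) i)"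
    and "uniformly_continuous_on {0..} (\<lambda>t. alc_mu N e (x t) i)"
    and "(i, j) \<in> lines N \<Longrightarrow> uniformly_continuous_on {0..} (\<lambda>t. st_P (x t) i j)"
    and "(i, j) \<in> E \<Longrightarrow> uniformly_continuous_on {0..} (\<lambda>t. st_sigma_hi (x t) i j)"
    and "(i, j) \<in> E \<Longrightarrow> uniformly_continuous_on {0..} (\<lambda>t. st_sigma_lo (x t) i j)"
    and "uniformly_continuous_on {0..} (\<lambda>t. st_omega (x t) i)"
proof -
  note bnd = bounded_signal_cmult bounded_signal_add bounded_signal_diff bounded_signal_minus bounded_signal_const
    bounded_signal_divide bounded_signal_pos_proj bounded_signal_net_outflow bounded_coordinates bounded_dc_flow
  show d: "uniformly_continuous_on {0..} (\<lambda>t. st_d (x t) i)" for i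
    by (rule caratheodory_ode_uniformly_continuous[OF ode_d])
      (intro bnd bounded_signal_compose[OF _ deriv_cost_continuous])
  show "uniformly_continuous_on {0..} (\<lambda>t. st_psi (x t) i)"
    by (rule caratheodory_ode_uniformly_continuous[OF ode_psi], unfold line_price_def)
      (intro bnd bounded_signal_multc; assumption)
  show "uniformly_continuous_on {0..} (\<lambda>t. st_gamma_hi (x t) i)"
    by (rule caratheodory_ode_uniformly_continuous[OF ode_gamma(1)]) (intro bnd)
  show "uniformly_continuous_on {0..} (\<lambda>t. st_gamma_lo (x t) i)"
    by (rule caratheodory_ode_uniformly_continuous[OF ode_gamma(2)]) (intro bnd)
  show "uniformly_continuous_on {0..} (\<lambda>t. alc_mu N e (x t) i)"
    by (rule caratheodory_ode_uniformly_continuous[OF ode_mu]) (intro bnd)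
  show P: "uniformly_continuous_on {0..} (\<lambda>t. st_P (x t) i j)" if "(i, j) \<in> lines N" for i j
    by (rule caratheodory_ode_uniformly_continuous[OF ode_P[OF that]]) (intro bnd)
  show "uniformly_continuous_on {0..} (\<lambda>t. st_sigma_hi (x t) i j)" if "(i, j) \<in> E"
    by (rule caratheodory_ode_uniformly_continuous[OF ode_sigma(1)[OF that]]) (intro bnd)
  show "uniformly_continuous_on {0..} (\<lambda>t. st_sigma_lo (x t) i j)" if "(i, j) \<in> E"
    by (rule caratheodory_ode_uniformly_continuous[OF ode_sigma(2)[OF that]]) (intro bnd)
  show "uniformly_continuous_on {0..} (\<lambda>t. st_omega (x t) i)"
  proof (cases "i \<in> generators N")
    case True
    show ?thesis
      by (rule caratheodory_ode_uniformly_continuous[OF ode_omega[OF True]], unfold power_imbalance_def)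
        (intro bnd; assumption)
  next
    case False
    show ?thesis
      by (rule uniformly_continuous_on_eq[OF _ omega_at_load[OF False]])
        (auto intro!: uniformly_continuous_on_divide_const uniformly_continuous_on_diff uniformly_continuous_on_const
           d uniformly_continuous_on_net_outflow P)
  qed
qed

lemma dissipation_component_tendsto_0:
  assumes kkt: "kkt_point N e c z"
    and "\<And>t. t \<ge> 0 \<Longrightarrow> w t \<ge> 0" "\<And>t. t \<ge> 0 \<Longrightarrow> w t \<le> dissipation z t" "uniformly_continuous_on {0..} w"
  shows "(w \<longlongrightarrow> 0) at_top"
proof (rule dissipation_tendsto_0[OF ode_energy[of z]])
  fix t :: real assume t: "t \<ge> 0"
  show "energy N e z (x t) \<ge> 0" by (rule energy_nonneg_and_coordinate_le(1)[OF net gains])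
  show "2 * half_energy_rate N e c z (x t) \<le> - w t"
    using half_energy_rate_le_dissipation[OF kkt t] dissipation_ge(3)[OF kkt t] assms(3)[OF t] by linarith
qed (use assms in auto)

text \<open>
  Each dissipation term is a continuous function of one bounded coordinate, hence uniformly continuous
  in time. Strict convexity of the cost and positivity of the damping identify the limits of \<open>d\<close> and \<open>\<omega>\<close>.
\<close>

lemma dissipation_limits:
  assumes kkt: "kkt_point N e c z"
  shows "((\<lambda>t. st_d (x t) i) \<longlongrightarrow> st_d z i) at_top"
    and "((\<lambda>t. st_omega (x t) i) \<longlongrightarrow> 0) at_top"
    and "((\<lambda>t. st_gamma_hi (x t) i * (load_max N i - st_d z i)) \<longlongrightarrow> 0) at_top"
    and "((\<lambda>t. st_gamma_lo (x t) i * (st_d z i - load_min N i)) \<longlongrightarrow> 0) at_top"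
    and "(i, j) \<in> E \<Longrightarrow>
          ((\<lambda>t. st_sigma_hi (x t) i j * (flow_max N i j - dc_flow N (st_psi z) i j)) \<longlongrightarrow> 0) at_top"
    and "(i, j) \<in> E \<Longrightarrow>
          ((\<lambda>t. st_sigma_lo (x t) i j * (dc_flow N (st_psi z) i j - flow_min N i j)) \<longlongrightarrow> 0) at_top"
proof -
  note to0 = dissipation_component_tendsto_0[OF kkt]
  note nn = dissipation_nonneg[OF kkt]
  have bus: "(deriv (c i) (st_d (x t) i) - deriv (c i) (st_d z i)) * (st_d (x t) i - st_d z i) \<le> dissipation z t"
    "damping N i * (st_omega (x t) i)\<^sup>2 \<le> dissipation z t"
    "st_gamma_hi (x t) i * (load_max N i - st_d z i) \<le> dissipation z t"
    "st_gamma_lo (x t) i * (st_d z i - load_min N i) \<le> dissipation z t" if "t \<ge> 0" for t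
    using dissipation_ge(1)[OF kkt that, of i] nn(1-4)[OF that, of i] unfolding bus_dissipation_def by linarith+
  define h where "h u = (deriv (c i) u - deriv (c i) (st_d z i)) * (u - st_d z i)" for u
  have h: "continuous_on UNIV h"
    unfolding h_def by (intro continuous_intros deriv_cost_continuous)
  show "((\<lambda>t. st_d (x t) i) \<longlongrightarrow> st_d z i) at_top"
  proof (rule tendsto_unique_zero[OF bounded_coordinates(1) h])
    show "u = st_d z i" if "h u = 0" for u
      using cost_strictly_monotone[of u "st_d z i" i] that unfolding h_def
      by (cases "u = st_d z i") simp_all
    show "((\<lambda>t. h (st_d (x t) i)) \<longlongrightarrow> 0) at_top"
      using bus(1) nn(1) by (intro to0 uniformly_continuous_on_compose_bounded[OF _ _ h]
        bounded_coordinates uniformly_continuous_coordinates) (auto simp: h_def)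
  qed
  have sq: "continuous_on UNIV (\<lambda>u. damping N i * u\<^sup>2)" by (intro continuous_intros)
  show "((\<lambda>t. st_omega (x t) i) \<longlongrightarrow> 0) at_top"
  proof (rule tendsto_unique_zero[OF bounded_coordinates(9) sq])
    show "u = 0" if "damping N i * u\<^sup>2 = 0" for u using that gain_pos(7)[of i] by simp
    show "((\<lambda>t. damping N i * (st_omega (x t) i)\<^sup>2) \<longlongrightarrow> 0) at_top"
      using bus(2) nn(2) by (intro to0 uniformly_continuous_on_compose_bounded[OF _ _ sq]
        bounded_coordinates uniformly_continuous_coordinates)
  qed
  show "((\<lambda>t. st_gamma_hi (x t) i * (load_max N i - st_d z i)) \<longlongrightarrow> 0) at_top"
    using bus(3) nn(3) by (intro to0 uniformly_continuous_on_cmul_right uniformly_continuous_coordinates)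
  show "((\<lambda>t. st_gamma_lo (x t) i * (st_d z i - load_min N i)) \<longlongrightarrow> 0) at_top"
    using bus(4) nn(4) by (intro to0 uniformly_continuous_on_cmul_right uniformly_continuous_coordinates)
  assume ij: "(i, j) \<in> E"
  have line: "st_sigma_hi (x t) i j * (flow_max N i j - dc_flow N (st_psi z) i j) \<le> dissipation z t"
    "st_sigma_lo (x t) i j * (dc_flow N (st_psi z) i j - flow_min N i j) \<le> dissipation z t" if "t \<ge> 0" for t
    using dissipation_ge(2)[OF kkt that ij] nn(5,6)[OF that ij] unfolding line_dissipation_def by linarith+
  show "((\<lambda>t. st_sigma_hi (x t) i j * (flow_max N i j - dc_flow N (st_psi z) i j)) \<longlongrightarrow> 0) at_top"
    using line(1) nn(5)[OF _ ij]
    by (intro to0 uniformly_continuous_on_cmul_right uniformly_continuous_coordinates ij)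
  show "((\<lambda>t. st_sigma_lo (x t) i j * (dc_flow N (st_psi z) i j - flow_min N i j)) \<longlongrightarrow> 0) at_top"
    using line(2) nn(6)[OF _ ij]
    by (intro to0 uniformly_continuous_on_cmul_right uniformly_continuous_coordinates ij)
qed

lemma power_imbalance_tendsto_0:
  assumes kkt: "kkt_point N e c z"
  shows "((\<lambda>t. power_imbalance N (x t) i) \<longlongrightarrow> 0) at_top"
proof (cases "i \<in> generators N")
  case True
  have "uniformly_continuous_on {0..} (\<lambda>t. power_imbalance N (x t) i)"
    unfolding power_imbalance_def
    by (intro uniformly_continuous_on_add uniformly_continuous_on_diff uniformly_continuous_on_cmul_left
        uniformly_continuous_on_const uniformly_continuous_on_net_outflow uniformly_continuous_coordinates)
  then have "uniformly_continuous_on {0..} (\<lambda>t. - power_imbalance N (x t) i / inertia N i)"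
    by (intro uniformly_continuous_on_divide_const uniformly_continuous_on_minus)
  then have "((\<lambda>t. - power_imbalance N (x t) i / inertia N i) \<longlongrightarrow> 0) at_top"
    by (rule barbalat[OF ode_omega[OF True] tendsto_imp_slowly_varying[OF dissipation_limits(2)[OF kkt]]])
  then have "((\<lambda>t. (- 1 / inertia N i) * power_imbalance N (x t) i) \<longlongrightarrow> 0) at_top" by simp
  then show ?thesis by (rule tendsto_cancel_factor) (use gain_pos(8)[OF True] in simp)
next
  case False
  show ?thesis
    by (rule tendsto_eventually) (rule eventually_at_top_linorderI[of 0], rule balance_at_loads[OF False])
qed

lemma load_price_tendsto_0:
  assumes kkt: "kkt_point N e c z"
  shows "((\<lambda>t. - deriv (c i) (st_d (x t) i) + st_omega (x t) i + alc_mu N e (x t) i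
           - st_gamma_hi (x t) i + st_gamma_lo (x t) i) \<longlongrightarrow> 0) at_top"
proof (rule tendsto_cancel_factor[where a = "eps_d e i"])
  show "((\<lambda>t. eps_d e i * (- deriv (c i) (st_d (x t) i) + st_omega (x t) i + alc_mu N e (x t) i
           - st_gamma_hi (x t) i + st_gamma_lo (x t) i)) \<longlongrightarrow> 0) at_top"
    by (rule barbalat[OF ode_d tendsto_imp_slowly_varying[OF dissipation_limits(1)[OF kkt]]])
      (intro uniformly_continuous_on_cmul_left uniformly_continuous_on_minus
        uniformly_continuous_on_add uniformly_continuous_on_diff uniformly_continuous_coordinates
        uniformly_continuous_on_compose_bounded[OF _ _ deriv_cost_continuous] bounded_coordinates)
qed (use gain_pos(1)[of i] in simp)

lemma slowly_varying_gamma: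
  assumes kkt: "kkt_point N e c z"
  shows "slowly_varying (\<lambda>t. st_gamma_hi (x t) i)" and "slowly_varying (\<lambda>t. st_gamma_lo (x t) i)"
proof -
  have d: "((\<lambda>t. st_d (x t) i - k) \<longlongrightarrow> st_d z i - k) at_top" for k
    by (intro tendsto_intros dissipation_limits(1)[OF kkt])
  show "slowly_varying (\<lambda>t. st_gamma_hi (x t) i)"
    using d[of "load_max N i"]
    by (intro slowly_varying_multiplier[OF ode_gamma(1) dissipation_limits(3)[OF kkt]]) simp
  show "slowly_varying (\<lambda>t. st_gamma_lo (x t) i)"
    using tendsto_minus[OF d[of "load_min N i"]]
    by (intro slowly_varying_multiplier[OF ode_gamma(2) dissipation_limits(4)[OF kkt]]) (simp add: algebra_simps)
qed

text \<open>
  As \<open>d\<close> settles, its velocity vanishes in the limit, which expresses \<open>\<mu>\<close> through the marginal cost, the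
  frequency and \<open>\<gamma>\<close>, all of them slowly varying.
\<close>

lemma slowly_varying_mu:
  assumes kkt: "kkt_point N e c z"
  shows "slowly_varying (\<lambda>t. alc_mu N e (x t) i)"
proof -
  have "isCont (deriv (c i)) (st_d z i)"
    using deriv_cost_continuous[of i] by (simp add: continuous_on_eq_continuous_at)
  then have "((\<lambda>t. deriv (c i) (st_d (x t) i)) \<longlongrightarrow> deriv (c i) (st_d z i)) at_top"
    by (rule isCont_tendsto_compose[OF _ dissipation_limits(1)[OF kkt]])
  note slow = tendsto_imp_slowly_varying[OF this] tendsto_imp_slowly_varying[OF load_price_tendsto_0[OF kkt, of i]]
    tendsto_imp_slowly_varying[OF dissipation_limits(2)[OF kkt, of i]]
  have "slowly_varying (\<lambda>t. (- deriv (c i) (st_d (x t) i) + st_omega (x t) i + alc_mu N e (x t) i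
           - st_gamma_hi (x t) i + st_gamma_lo (x t) i) + deriv (c i) (st_d (x t) i) - st_omega (x t) i
           + st_gamma_hi (x t) i - st_gamma_lo (x t) i)"
    by (intro slowly_varying_add[OF slow(2)] slowly_varying_add slowly_varying_diff slow slowly_varying_gamma[OF kkt])
  then show ?thesis by simp
qed

lemma inner_balance_tendsto_0:
  assumes kkt: "kkt_point N e c z"
  shows "((\<lambda>t. injection N i - st_d (x t) i - net_outflow E (dc_flow N (st_psi (x t))) i) \<longlongrightarrow> 0) at_top"
proof (rule tendsto_cancel_factor[where a = "eps_mu e i"])
  show "((\<lambda>t. eps_mu e i * (injection N i - st_d (x t) i - net_outflow E (dc_flow N (st_psi (x t))) i)) \<longlongrightarrow> 0) at_top"
    by (rule barbalat[OF ode_mu slowly_varying_mu[OF kkt]])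
      (unfold dc_flow_def, intro uniformly_continuous_on_cmul_left uniformly_continuous_on_diff uniformly_continuous_on_const
        uniformly_continuous_on_net_outflow uniformly_continuous_coordinates)
qed (use gain_pos(5)[of i] in simp)

text \<open>
  The virtual flows are determined by their net outflows. Indeed, for the deviation \<open>\<phi>\<close> of the angles
  from those of \<open>z\<close>, the sum of \<open>\<phi> i\<close> times the net outflow at \<open>i\<close> equals the sum of
  \<open>B * (\<phi> i - \<phi> j)\<^sup>2\<close> over the inner lines, and it tends to zero because \<open>\<phi>\<close> is bounded and the net
  outflows tend to zero.
\<close>

lemma dc_flow_tendsto:
  assumes kkt: "kkt_point N e c z" and ij: "(i, j) \<in> E"
  shows "((\<lambda>t. dc_flow N (st_psi (x t)) i j) \<longlongrightarrow> dc_flow N (st_psi z) i j) at_top"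
proof -
  define \<phi> where "\<phi> t = (\<lambda>k. st_psi (x t) k - st_psi z k)" for t
  have out: "((\<lambda>t. net_outflow E (dc_flow N (\<phi> t)) k) \<longlongrightarrow> 0) at_top" for k
  proof -
    have "((\<lambda>t. st_d z k - st_d (x t) k - (injection N k - st_d (x t) k - net_outflow E (dc_flow N (st_psi (x t))) k))
        \<longlongrightarrow> st_d z k - st_d z k - 0) at_top"
      by (intro tendsto_diff tendsto_const dissipation_limits(1)[OF kkt] inner_balance_tendsto_0[OF kkt])
    moreover have "st_d z k - st_d (x t) k - (injection N k - st_d (x t) k - net_outflow E (dc_flow N (st_psi (x t))) k)
        = net_outflow E (dc_flow N (\<phi> t)) k" for t
      unfolding \<phi>_def net_outflow_dc_flow_diff using kkt_pointD(4)[OF kkt, of k] by simp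
    ultimately show ?thesis by simp
  qed
  have "((\<lambda>t. \<Sum>k\<in>UNIV. \<phi> t k * net_outflow E (dc_flow N (\<phi> t)) k) \<longlongrightarrow> (\<Sum>k\<in>(UNIV :: 'n set). 0)) at_top"
    by (intro tendsto_sum tendsto_bounded_signal_mult_0 out)
      (unfold \<phi>_def, intro bounded_signal_diff bounded_signal_const bounded_coordinates)
  then have lim: "((\<lambda>t. \<Sum>(k, l)\<in>E. dc_flow N (\<phi> t) k l * (\<phi> t k - \<phi> t l)) \<longlongrightarrow> 0) at_top"
    by (simp add: sum_net_outflow)
  have B: "suscept N k l > 0" if "(k, l) \<in> E" for k l
    using gain_pos(10)[OF inner_lines_subset[OF that]] .
  have "((\<lambda>t. (dc_flow N (\<phi> t) i j)\<^sup>2) \<longlongrightarrow> 0) at_top"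
  proof (rule Lim_null_comparison[OF always_eventually])
    show "\<forall>t. norm ((dc_flow N (\<phi> t) i j)\<^sup>2)
        \<le> suscept N i j * (\<Sum>(k, l)\<in>E. dc_flow N (\<phi> t) k l * (\<phi> t k - \<phi> t l))"
    proof
      fix t
      let ?f = "\<lambda>p. dc_flow N (\<phi> t) (fst p) (snd p) * (\<phi> t (fst p) - \<phi> t (snd p))"
      have "?f p \<ge> 0" if "p \<in> E" for p
        using B[of "fst p" "snd p"] that by (simp add: dc_flow_def mult.assoc)
      then have "?f (i, j) \<le> sum ?f E"
        using ij by (intro member_le_sum) auto
      then have "dc_flow N (\<phi> t) i j * (\<phi> t i - \<phi> t j) \<le> sum ?f E" by simp
      from mult_left_mono[OF this, of "suscept N i j"]
      have "suscept N i j * (dc_flow N (\<phi> t) i j * (\<phi> t i - \<phi> t j)) \<le> suscept N i j * sum ?f E"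
        using B[OF ij] by simp
      moreover have "suscept N i j * (dc_flow N (\<phi> t) i j * (\<phi> t i - \<phi> t j)) = (dc_flow N (\<phi> t) i j)\<^sup>2"
        by (simp add: dc_flow_def power2_eq_square)
      ultimately show "norm ((dc_flow N (\<phi> t) i j)\<^sup>2)
        \<le> suscept N i j * (\<Sum>(k, l)\<in>E. dc_flow N (\<phi> t) k l * (\<phi> t k - \<phi> t l))"
        by (simp add: case_prod_unfold)
    qed
    show "((\<lambda>t. suscept N i j * (\<Sum>(k, l)\<in>E. dc_flow N (\<phi> t) k l * (\<phi> t k - \<phi> t l))) \<longlongrightarrow> 0) at_top"
      using tendsto_mult_left[OF lim, of "suscept N i j"] by simp
  qed
  then have "((\<lambda>t. 1 * (dc_flow N (\<phi> t) i j)\<^sup>2) \<longlongrightarrow> 0) at_top" by simp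
  then show ?thesis
    by (rule tendsto_of_square_le[where a = 1]) (simp add: \<phi>_def dc_flow_diff)
qed

lemma slowly_varying_sigma:
  assumes kkt: "kkt_point N e c z" and ij: "(i, j) \<in> E"
  shows "slowly_varying (\<lambda>t. st_sigma_hi (x t) i j)" and "slowly_varying (\<lambda>t. st_sigma_lo (x t) i j)"
proof -
  have f: "((\<lambda>t. dc_flow N (st_psi (x t)) i j - k) \<longlongrightarrow> dc_flow N (st_psi z) i j - k) at_top" for k
    by (intro tendsto_intros dc_flow_tendsto[OF kkt ij])
  show "slowly_varying (\<lambda>t. st_sigma_hi (x t) i j)"
    using f[of "flow_max N i j"]
    by (intro slowly_varying_multiplier[OF ode_sigma(1)[OF ij] dissipation_limits(5)[OF kkt ij]]) simp
  show "slowly_varying (\<lambda>t. st_sigma_lo (x t) i j)"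
    using tendsto_minus[OF f[of "flow_min N i j"]]
    by (intro slowly_varying_multiplier[OF ode_sigma(2)[OF ij] dissipation_limits(6)[OF kkt ij]])
      (simp add: algebra_simps)
qed

text \<open>
  The velocity of \<open>\<psi>\<close> is linear in \<open>\<mu>\<close> and \<open>\<sigma>\<close>, hence slowly varying. Nothing is known yet on the
  increments of \<open>\<psi>\<close> itself, and its boundedness serves instead.
\<close>

lemma line_price_outflow_tendsto_0:
  assumes kkt: "kkt_point N e c z"
  shows "((\<lambda>t. net_outflow E (line_price N e (x t)) i) \<longlongrightarrow> 0) at_top"
proof (rule tendsto_cancel_factor[where a = "eps_psi e i"])
  have price: "slowly_varying (\<lambda>t. line_price N e (x t) k l)" if "(k, l) \<in> E" for k l
    unfolding line_price_def mult.commute[of _ "suscept N k l"]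
    by (intro slowly_varying_cmult slowly_varying_add slowly_varying_diff slowly_varying_mu[OF kkt]
        slowly_varying_sigma[OF kkt that])
  show "((\<lambda>t. eps_psi e i * net_outflow E (line_price N e (x t)) i) \<longlongrightarrow> 0) at_top"
    by (rule slowly_varying_derivative_of_bounded[OF ode_psi bounded_coordinates(2)])
      (intro slowly_varying_cmult slowly_varying_net_outflow price)
qed (use gain_pos(2)[of i] in simp)

lemma limit_point_exists:
  assumes kkt: "kkt_point N e c z"
  obtains \<tau> :: "nat \<Rightarrow> real" and s :: "'n alc_state"
  where "filterlim \<tau> at_top sequentially" "\<forall>n. \<tau> n \<ge> 0" "state_tendsto N (\<lambda>n. x (\<tau> n)) s sequentially"
proof -
  define S where "S = (\<Union>i. {\<lambda>t. st_psi (x t) i, \<lambda>t. st_gamma_hi (x t) i, \<lambda>t. st_gamma_lo (x t) i, \<lambda>t. st_r (x t) i})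
    \<union> (\<lambda>(i, j) t. st_P (x t) i j) ` lines N
    \<union> (\<lambda>(i, j) t. st_sigma_hi (x t) i j) ` E \<union> (\<lambda>(i, j) t. st_sigma_lo (x t) i j) ` E"
  have fin: "finite S" by (auto simp: S_def)
  have bd: "bounded_signal f" if "f \<in> S" for f
    using that unfolding S_def by (auto intro: bounded_coordinates)
  obtain \<tau> where \<tau>: "filterlim \<tau> at_top sequentially" "\<And>n. \<tau> n \<ge> 0"
    and conv: "\<And>f. f \<in> S \<Longrightarrow> convergent (\<lambda>n. f (\<tau> n))"
    by (rule bounded_signals_common_limit_times[OF fin bd]) (assumption, rule that)
  have conv: "(\<lambda>n. f (\<tau> n)) \<longlonglongrightarrow> lim (\<lambda>n. f (\<tau> n))" if "f \<in> S" for f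
    using conv[OF that] by (simp add: convergent_LIMSEQ_iff)
  define s :: "'n alc_state" where "s = \<lparr>st_d = st_d z, st_omega = (\<lambda>i. 0),
    st_P = (\<lambda>i j. lim (\<lambda>n. st_P (x (\<tau> n)) i j)), st_psi = (\<lambda>i. lim (\<lambda>n. st_psi (x (\<tau> n)) i)),
    st_gamma_hi = (\<lambda>i. lim (\<lambda>n. st_gamma_hi (x (\<tau> n)) i)),
    st_gamma_lo = (\<lambda>i. lim (\<lambda>n. st_gamma_lo (x (\<tau> n)) i)),
    st_r = (\<lambda>i. lim (\<lambda>n. st_r (x (\<tau> n)) i)),
    st_sigma_hi = (\<lambda>i j. lim (\<lambda>n. st_sigma_hi (x (\<tau> n)) i j)),
    st_sigma_lo = (\<lambda>i j. lim (\<lambda>n. st_sigma_lo (x (\<tau> n)) i j))\<rparr>"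
  have "state_tendsto N (\<lambda>n. x (\<tau> n)) s sequentially"
    unfolding state_tendsto_def
  proof (intro conjI allI ballI)
    fix i
    show "(\<lambda>n. st_d (x (\<tau> n)) i) \<longlonglongrightarrow> st_d s i" "(\<lambda>n. st_omega (x (\<tau> n)) i) \<longlonglongrightarrow> st_omega s i"
      using filterlim_compose[OF dissipation_limits(1)[OF kkt, of i] \<tau>(1)]
        filterlim_compose[OF dissipation_limits(2)[OF kkt, of i] \<tau>(1)] by (simp_all add: s_def)
    have mem: "(\<lambda>t. st_psi (x t) i) \<in> S" "(\<lambda>t. st_gamma_hi (x t) i) \<in> S"
      "(\<lambda>t. st_gamma_lo (x t) i) \<in> S" "(\<lambda>t. st_r (x t) i) \<in> S" by (auto simp: S_def)
    show "(\<lambda>n. st_psi (x (\<tau> n)) i) \<longlonglongrightarrow> st_psi s i"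
      "(\<lambda>n. st_gamma_hi (x (\<tau> n)) i) \<longlonglongrightarrow> st_gamma_hi s i"
      "(\<lambda>n. st_gamma_lo (x (\<tau> n)) i) \<longlonglongrightarrow> st_gamma_lo s i"
      "(\<lambda>n. st_r (x (\<tau> n)) i) \<longlonglongrightarrow> st_r s i"
      using mem[THEN conv] by (simp_all add: s_def)
  next
    fix p assume "p \<in> lines N"
    then obtain i j where p: "p = (i, j)" "(i, j) \<in> lines N" by (cases p) auto
    then have "(\<lambda>t. st_P (x t) i j) \<in> S" unfolding S_def by force
    then show "case p of (i, j) \<Rightarrow> (\<lambda>n. st_P (x (\<tau> n)) i j) \<longlonglongrightarrow> st_P s i j"
      using conv p by (simp add: s_def)
  next
    fix p assume "p \<in> E"
    then obtain i j where p: "p = (i, j)" "(i, j) \<in> E" by (cases p) auto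
    then have "(\<lambda>t. st_sigma_hi (x t) i j) \<in> S" "(\<lambda>t. st_sigma_lo (x t) i j) \<in> S" unfolding S_def by force+
    from this[THEN conv] show "case p of (i, j) \<Rightarrow> (\<lambda>n. st_sigma_hi (x (\<tau> n)) i j) \<longlonglongrightarrow> st_sigma_hi s i j \<and>
        (\<lambda>n. st_sigma_lo (x (\<tau> n)) i j) \<longlonglongrightarrow> st_sigma_lo s i j" using p by (simp add: s_def)
  qed
  with \<tau> show thesis by (intro that) auto
qed

text \<open>
  Each equation passes to the limit from a quantity that tends to zero along the whole trajectory.
  Feasibility is inherited from \<open>z\<close>, whose load and inner flows the limit point shares.
\<close>

lemma limit_point_is_kkt_point:
  assumes kkt: "kkt_point N e c z"
    and \<tau>: "filterlim \<tau> at_top sequentially" "\<forall>n. \<tau> n \<ge> 0"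
    and lim: "state_tendsto N (\<lambda>n. x (\<tau> n)) s sequentially"
  shows "kkt_point N e c s"
proof -
  note d = state_tendstoD(1)[OF lim] and w = state_tendstoD(2)[OF lim] and psi = state_tendstoD(3)[OF lim]
    and ghi = state_tendstoD(4)[OF lim] and glo = state_tendstoD(5)[OF lim] and r = state_tendstoD(6)[OF lim]
    and P = state_tendstoD(7)[OF lim] and shi = state_tendstoD(8)[OF lim] and slo = state_tendstoD(9)[OF lim]
  have mu: "(\<lambda>n. alc_mu N e (x (\<tau> n)) i) \<longlonglongrightarrow> alc_mu N e s i" for i
    by (rule tendsto_alc_mu[OF w r])
  have along: "l = m" if "(f \<longlongrightarrow> l) at_top" "(\<lambda>n. f (\<tau> n)) \<longlonglongrightarrow> m" for f :: "real \<Rightarrow> real" and l m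
    using LIMSEQ_unique[OF filterlim_compose[OF that(1) \<tau>(1)] that(2)] .
  have dz: "st_d s i = st_d z i" and w0: "st_omega s i = 0" for i
    using along[OF dissipation_limits(1)[OF kkt, of i] d] along[OF dissipation_limits(2)[OF kkt, of i] w]
    by simp_all
  have nonneg: "multipliers_nonneg N (x (\<tau> n))" for n
    using multipliers_nonneg \<tau>(2) by blast
  have flow: "(\<lambda>n. dc_flow N (st_psi (x (\<tau> n))) i j) \<longlonglongrightarrow> dc_flow N (st_psi s) i j" for i j
    unfolding dc_flow_def by (intro tendsto_mult tendsto_diff tendsto_const psi)
  have nn: "st_gamma_hi s i \<ge> 0" "st_gamma_lo s i \<ge> 0" for i
    using nonneg
    by (auto intro!: LIMSEQ_le_const[OF ghi] LIMSEQ_le_const[OF glo] simp: multipliers_nonneg_def)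
  have nn': "st_sigma_hi s i j \<ge> 0" "st_sigma_lo s i j \<ge> 0" if ij: "(i, j) \<in> E" for i j
  proof -
    have "st_sigma_hi (x (\<tau> n)) i j \<ge> 0" "st_sigma_lo (x (\<tau> n)) i j \<ge> 0" for n
      using nonneg[of n] ij unfolding multipliers_nonneg_def by blast+
    then show "st_sigma_hi s i j \<ge> 0" "st_sigma_lo s i j \<ge> 0"
      by (auto intro: LIMSEQ_le_const[OF shi[OF ij]] LIMSEQ_le_const[OF slo[OF ij]])
  qed
  have price: "deriv (c i) (st_d s i) = alc_mu N e s i - st_gamma_hi s i + st_gamma_lo s i" for i
  proof -
    have "isCont (deriv (c i)) (st_d s i)"
      using deriv_cost_continuous[of i] by (simp add: continuous_on_eq_continuous_at)
    then have "0 = - deriv (c i) (st_d s i) + st_omega s i + alc_mu N e s i - st_gamma_hi s i + st_gamma_lo s i"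
      by (intro along[OF load_price_tendsto_0[OF kkt, of i]] tendsto_add tendsto_diff tendsto_minus
          isCont_tendsto_compose[OF _ d] w mu ghi glo)
    then show ?thesis using w0[of i] by simp
  qed
  have balance: "st_d s i = injection N i - net_outflow (lines N) (st_P s) i" for i
  proof -
    have "0 = damping N i * st_omega s i + st_d s i - injection N i + net_outflow (lines N) (st_P s) i"
      by (intro along[OF power_imbalance_tendsto_0[OF kkt, of i]], unfold power_imbalance_def)
        (intro tendsto_add tendsto_diff tendsto_mult tendsto_const d w tendsto_net_outflow P)
    then show ?thesis using w0[of i] by simp
  qed
  have inner: "st_d s i = injection N i - net_outflow E (dc_flow N (st_psi s)) i" for i
  proof -
    have "0 = injection N i - st_d s i - net_outflow E (dc_flow N (st_psi s)) i"
      by (intro along[OF inner_balance_tendsto_0[OF kkt, of i]] tendsto_diff tendsto_const d tendsto_net_outflow flow)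
    then show ?thesis by simp
  qed
  have stationary: "net_outflow E (line_price N e s) i = 0" for i
  proof -
    have "(\<lambda>n. line_price N e (x (\<tau> n)) k l) \<longlonglongrightarrow> line_price N e s k l" if "(k, l) \<in> E" for k l
      unfolding line_price_def
      by (intro tendsto_add tendsto_diff tendsto_mult tendsto_const mu shi slo that)
    then show ?thesis by (intro along[OF line_price_outflow_tendsto_0[OF kkt, of i], symmetric] tendsto_net_outflow)
  qed
  have slack: "st_gamma_hi s i * (load_max N i - st_d s i) = 0" "st_gamma_lo s i * (st_d s i - load_min N i) = 0" for i
    unfolding dz
    by (intro along[OF dissipation_limits(3)[OF kkt, of i], symmetric] along[OF dissipation_limits(4)[OF kkt, of i], symmetric]
        tendsto_mult tendsto_const ghi glo)+
  have line: "dc_flow N (st_psi s) i j = dc_flow N (st_psi z) i j" if "(i, j) \<in> E" for i j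
    by (rule along[OF dc_flow_tendsto[OF kkt that] flow, symmetric])
  have slack': "st_sigma_hi s i j * (flow_max N i j - dc_flow N (st_psi s) i j) = 0"
    "st_sigma_lo s i j * (dc_flow N (st_psi s) i j - flow_min N i j) = 0" if ij: "(i, j) \<in> E" for i j
    unfolding line[OF ij]
    by (intro along[OF dissipation_limits(5)[OF kkt ij], symmetric] along[OF dissipation_limits(6)[OF kkt ij], symmetric]
        tendsto_mult tendsto_const shi[OF ij] slo[OF ij])+
  have box: "load_min N i \<le> st_d s i" "st_d s i \<le> load_max N i" for i
    unfolding dz using kkt_pointD(6,7)[OF kkt, of i] by simp_all
  have box': "flow_min N i j \<le> dc_flow N (st_psi s) i j" "dc_flow N (st_psi s) i j \<le> flow_max N i j" if "(i, j) \<in> E" for i j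
    unfolding line[OF that] using kkt_point_lineD(1,2)[OF kkt that] by simp_all
  show ?thesis
    unfolding kkt_point_def
  proof (intro conjI allI ballI)
    fix p assume "p \<in> E"
    then show "case p of (i, j) \<Rightarrow> flow_min N i j \<le> dc_flow N (st_psi s) i j \<and> dc_flow N (st_psi s) i j \<le> flow_max N i j \<and>
        st_sigma_hi s i j \<ge> 0 \<and> st_sigma_hi s i j * (flow_max N i j - dc_flow N (st_psi s) i j) = 0 \<and>
        st_sigma_lo s i j \<ge> 0 \<and> st_sigma_lo s i j * (dc_flow N (st_psi s) i j - flow_min N i j) = 0"
      using box'[of "fst p" "snd p"] nn'[of "fst p" "snd p"] slack'[of "fst p" "snd p"]
      by (simp only: case_prod_unfold prod.collapse simp_thms)
  qed (rule w0 price balance inner stationary box nn slack)+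
qed

text \<open>
  The energy with respect to the limit point \<open>s\<close> is monotone and vanishes along a sequence of times.
\<close>

theorem converges_to_kkt_point:
  obtains s where "kkt_point N e c s" "state_converges N x s"
proof -
  obtain z where kkt: "kkt_point N e c z" using kkt_point_exists[OF feasible gains C1] .
  obtain \<tau> s where \<tau>: "filterlim \<tau> at_top sequentially" "\<forall>n. \<tau> n \<ge> 0"
    and lim: "state_tendsto N (\<lambda>n. x (\<tau> n)) s sequentially"
    using limit_point_exists[OF kkt] by blast
  have kkt_s: "kkt_point N e c s"
    by (rule limit_point_is_kkt_point[OF kkt \<tau> lim])
  note lims = state_tendstoD[OF lim]
  note le = energy_nonneg_and_coordinate_le[OF net gains]
  obtain l where l: "((\<lambda>t. energy N e s (x t)) \<longlongrightarrow> l) at_top"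
    by (rule caratheodory_ode_decreasing_converges[OF ode_energy[of s] le(1) energy_rate_nonpos[OF kkt_s]])
  have "(\<lambda>n. energy N e s (x (\<tau> n))) \<longlonglongrightarrow> energy N e s s"
    unfolding energy_def case_prod_unfold
    by (intro tendsto_add tendsto_sum tendsto_mult tendsto_power tendsto_diff tendsto_const
        lims tendsto_alc_mu) simp_all
  moreover have "energy N e s s = 0" by (simp add: energy_def)
  ultimately have "l = 0"
    using LIMSEQ_unique[OF filterlim_compose[OF l \<tau>(1)]] by simp
  with l have V: "((\<lambda>t. energy N e s (x t)) \<longlongrightarrow> 0) at_top" by simp
  note conv = tendsto_of_square_le[OF V]
  have omega: "((\<lambda>t. st_omega (x t) i) \<longlongrightarrow> st_omega s i) at_top" for i
    using dissipation_limits(2)[OF kkt_s, of i] kkt_pointD(1)[OF kkt_s, of i] by simp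
  have mu_conv: "((\<lambda>t. alc_mu N e (x t) i) \<longlongrightarrow> alc_mu N e s i) at_top" for i
    by (rule conv) (rule le(6))
  have "((\<lambda>t. st_r (x t) i) \<longlongrightarrow> gain_K e i / eps_mu e i *
    (alc_mu N e s i - (if i \<in> generators N then eps_mu e i / eps_omega e i else 0) * st_omega s i)) at_top" for i
    unfolding r_eq by (intro tendsto_mult tendsto_diff tendsto_const omega mu_conv)
  moreover have "gain_K e i / eps_mu e i *
    (alc_mu N e s i - (if i \<in> generators N then eps_mu e i / eps_omega e i else 0) * st_omega s i) = st_r s i" for i
    using gain_pos(5,6)[of i] by (simp add: alc_mu_def)
  ultimately have r_conv: "((\<lambda>t. st_r (x t) i) \<longlongrightarrow> st_r s i) at_top" for i by simp
  have "state_converges N x s"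
    unfolding state_converges_def
  proof (intro conjI allI ballI)
    fix i
    show "((\<lambda>t. st_d (x t) i) \<longlongrightarrow> st_d s i) at_top" by (rule conv) (rule le(2))
    show "((\<lambda>t. st_psi (x t) i) \<longlongrightarrow> st_psi s i) at_top" by (rule conv) (rule le(3))
    show "((\<lambda>t. st_gamma_hi (x t) i) \<longlongrightarrow> st_gamma_hi s i) at_top" by (rule conv) (rule le(4))
    show "((\<lambda>t. st_gamma_lo (x t) i) \<longlongrightarrow> st_gamma_lo s i) at_top" by (rule conv) (rule le(5))
  next
    fix p assume "p \<in> lines N"
    then obtain i j where "p = (i, j)" "(i, j) \<in> lines N" by (cases p) auto
    then show "case p of (i, j) \<Rightarrow> ((\<lambda>t. st_P (x t) i j) \<longlongrightarrow> st_P s i j) at_top"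
      using conv[OF le(8)] by simp
  next
    fix p assume "p \<in> E"
    then obtain i j where "p = (i, j)" "(i, j) \<in> E" by (cases p) auto
    then show "case p of (i, j) \<Rightarrow> ((\<lambda>t. st_sigma_hi (x t) i j) \<longlongrightarrow> st_sigma_hi s i j) at_top \<and>
        ((\<lambda>t. st_sigma_lo (x t) i j) \<longlongrightarrow> st_sigma_lo s i j) at_top"
      using conv[OF le(9)] conv[OF le(10)] by simp
  qed (rule omega r_conv)+
  with kkt_s show thesis by (rule that)
qed

end

theorem theorem1:
  fixes N :: "'n::finite power_network"
    and e :: "'n alc_gains"
    and c :: "'n \<Rightarrow> real \<Rightarrow> real"
    and x :: "real \<Rightarrow> 'n alc_state"
  assumes "valid_network N" and "valid_gains N e"
    and "\<And>i. strictly_convex_on UNIV (c i)"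
    and "\<And>i. c i C1_differentiable_on UNIV"
    and "olc_feasible N"
    and "net_solution N x" and "alc_solution N e c x"
    and "multipliers_nonneg N (x 0)"
  shows "\<exists>s. state_converges N x s \<and> rolc_optimal N c (st_d s, st_omega s, st_P s, st_psi s)"
proof -
  interpret closed_loop N e c x by (unfold_locales; fact)
  obtain s where s: "kkt_point N e c s" "state_converges N x s" by (rule converges_to_kkt_point)
  from kkt_point_imp_rolc_optimal[OF s(1) gain_pos(7) convex C1] s(2) show ?thesis by blast
qed

end
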